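(* Every edge-colouring $\chi : E(K_n^{(3)}) \to \mathbb{N}$ in which each edge lies in at least $\lfloor n/4 \rfloor$ monochromatic copies of $K_4^{(3)}$ has a spanning colour.
   Context: $K_n^{(3)}$ is the complete $3$-uniform hypergraph on $n$ vertices: its edges are all $3$-element subsets of the vertex set. An edge-colouring is an arbitrary map $\chi: E(K_n^{(3)}) \to \mathbb{N}$. A copy of $K_4^{(3)}$ is given by a set of four vertices (its edges being the four triples inside this set); it is monochromatic if all four triples have the same colour. A colour $i \in \mathbb{N}$ is spanning if every vertex of $K_n^{(3)}$ lies in some edge $e$ with $\chi(e) = i$. *)

theory Defs
  imports "HOL-Library.Ramsey"
begin

text \<open>
  The edges of the complete 3-uniform hypergraph on a vertex set \<open>V\<close> are the elements of
  \<open>[V]\<^bsup>3\<^esup>\<close>.  An edge-colouring is a total function \<open>\<chi> :: 'a set \<Rightarrow> nat\<close>; only its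
  values on \<open>[V]\<^bsup>3\<^esup>\<close> are ever used, and a copy of the complete 3-uniform hypergraph on
  four vertices is identified with its vertex set.
\<close>

definition mono_K4_copies :: "'a set \<Rightarrow> ('a set \<Rightarrow> nat) \<Rightarrow> 'a set set" where
  "mono_K4_copies V \<chi> = {Q \<in> [V]\<^bsup>4\<^esup>. \<exists>c. \<forall>e \<in> [Q]\<^bsup>3\<^esup>. \<chi> e = c}"

definition spanning_colour :: "'a set \<Rightarrow> ('a set \<Rightarrow> nat) \<Rightarrow> nat \<Rightarrow> bool" where
  "spanning_colour V \<chi> i \<longleftrightarrow> (\<forall>v \<in> V. \<exists>e \<in> [V]\<^bsup>3\<^esup>. v \<in> e \<and> \<chi> e = i)"

end

(* Suppose that no colour spans, let k be the floor of n/4, and let N(e) be the set of vertices w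
   for which e together with w is monochromatic.  If two edges share a pair and differ in colour, their
   sets N are disjoint; since every N has at least k elements, this excludes rainbow four-sets, pairs
   seeing four colours and one five-point pattern, and these exclusions survive merging colours.  Name
   every colour by a vertex that it misses.  The sets of colours seen at the pairs vx, for fixed v,
   pairwise meet, have at most three elements and no common element; if seven colours occurred at v
   they would be the lines of a Fano plane, and counting the 21 edges spanned by v and one
   representative of each line gives a contradiction.  So at most six colours occur at v; the vertices
   naming them, together with v, hit the missed vertices of every colour, and the colours can be renamed
   into a set of seven vertices.  No colouring of the triples of a seven-point set by its own points
   satisfies the three exclusions; this is a finite case analysis, stored as a list of refutations. *)

theory Submission
  imports Defs
begin

text \<open>The obstacle is that the vertices and the colours are both unbounded, while the
  exclusions are local. A finite contradiction needs a bounded vertex set that contains a missed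
  vertex for each of its own colours. The star of one vertex v supplies it: a colour not seen at v
  can be named v itself, so only the colours seen at v need further names. For this reason colours
  are named twice, once arbitrarily to bound the star of v, and once more with all names confined to
  the seven-point set. Merging colours that receive the same name is harmless because it can only
  enlarge the sets N(e). The local exclusions rest on n <= 4k + 3: four disjoint sets of size k do
  not fit outside four vertices. The pattern on five points needs a weighted version of the same
  count. The sets of colours at pairs through v meet pairwise because the colour of vxy is seen both
  at vx and at vy; they have no common element because no vertex x is the name of a colour seen at
  the pair vx.\<close>

lemma of_bool_sum_le:
  assumes "\<not> (b \<and> c1)" "\<not> (b \<and> c2)" "\<not> (b \<and> d1)" "\<not> (b \<and> e)" "\<not> (c1 \<and> d2)" "\<not> (c1 \<and> a1)" "\<not> (d1 \<and> e)" "\<not> (d1 \<and> a2)" "\<not> (c2 \<and> d2)" "\<not> (c2 \<and> e)" "\<not> (c2 \<and> a1)" "\<not> (e \<and> d2)" "\<not> (e \<and> a2)" "\<not> (d2 \<and> a1)" "\<not> (d2 \<and> a2)" "\<not> (c1 \<and> d1)"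
    "\<not> (b \<and> a1 \<and> a2)" "\<not> (c1 \<and> c2 \<and> a2)"
  shows "of_bool b + of_bool c1 + of_bool c2 + of_bool d1 + of_bool d2 + of_bool e + of_bool a1 + of_bool a2 \<le> (2::nat)"
  using assms
  by (cases b; cases c1; cases c2; simp; cases d1; cases d2; cases e; simp; cases a1; cases a2; simp)

section \<open>Disjoint sets \<open>N\<close> and the three local exclusions\<close>

text \<open>The colour type stays free so that the locale can be instantiated again after colours
  are merged or renamed. The hypothesis \<open>card_V\<close> carries all that is used of
  \<open>k\<close> being the floor of n/4.\<close>

locale rich_colouring =
  fixes V :: "'a set" and c :: "'a \<Rightarrow> 'a \<Rightarrow> 'a \<Rightarrow> 'c" and k :: nat
  assumes finite_V: "finite V"
    and sym1: "c x y z = c y x z"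
    and sym2: "c x y z = c x z y"
    and card_V: "card V \<le> 4 * k + 3"
    and rich: "\<lbrakk>{x, y, z} \<subseteq> V; distinct [x, y, z]\<rbrakk> \<Longrightarrow>
      k \<le> card {w \<in> V. w \<notin> {x, y, z} \<and> c x y w = c x y z \<and> c x z w = c x y z \<and> c y z w = c x y z}"
begin

definition N :: "'a \<Rightarrow> 'a \<Rightarrow> 'a \<Rightarrow> 'a set" where
  "N x y z = {w \<in> V. w \<notin> {x, y, z} \<and> c x y w = c x y z \<and> c x z w = c x y z \<and> c y z w = c x y z}"

lemma sym: "c x y z = c y x z" "c x y z = c x z y" "c x y z = c y z x" "c x y z = c z x y" "c x y z = c z y x"
  by (metis sym1 sym2)+

lemma card_N: "\<lbrakk>x \<in> V; y \<in> V; z \<in> V; x \<noteq> y; x \<noteq> z; y \<noteq> z\<rbrakk> \<Longrightarrow> k \<le> card (N x y z)"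
  using rich[of x y z] unfolding N_def by simp

lemma finite_N: "finite (N x y z)"
  using finite_V unfolding N_def by simp

lemma N_iff: "w \<in> N x y z \<longleftrightarrow> w \<in> V \<and> w \<noteq> x \<and> w \<noteq> y \<and> w \<noteq> z \<and>
    c x y w = c x y z \<and> c x z w = c x y z \<and> c y z w = c x y z"
  unfolding N_def by auto

text \<open>Four disjoint sets outside \<open>P\<close> need 4k <= n - 4, whereas
  \<open>card_V\<close> gives n - 4 <= 4k - 1.\<close>

lemma four_disjoint:
  assumes sub: "\<And>i. i < 4 \<Longrightarrow> f i \<subseteq> V - P" and P: "P \<subseteq> V" "card P = 4"
    and k: "\<And>i. i < (4::nat) \<Longrightarrow> k \<le> card (f i)"
    and dis: "\<And>i j. \<lbrakk>i < j; j < 4\<rbrakk> \<Longrightarrow> f i \<inter> f j = {}"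
  shows False
proof -
  have fin: "finite (f i)" if "i < 4" for i
    using sub[OF that] finite_V by (meson finite_Diff finite_subset)
  have "4 * k = (\<Sum>i<4::nat. k)" by simp
  also have "\<dots> \<le> (\<Sum>i<4. card (f i))" using k by (intro sum_mono) simp
  also have "\<dots> = card (\<Union>i<4. f i)"
    using fin dis by (intro card_UN_disjoint[symmetric]) (auto, metis disjoint_iff nat_neq_iff)
  also have "\<dots> \<le> card (V - P)" using sub finite_V by (intro card_mono) auto
  also have "\<dots> = card V - 4" using P finite_V by (simp add: card_Diff_subset finite_subset)
  finally have "4 * k \<le> card V - 4" .
  moreover have "4 \<le> card V" using P finite_V by (metis card_mono)
  ultimately show False using card_V by linarith
qed

lemma four_disjoint':
  assumes "A1 \<subseteq> V - P" "A2 \<subseteq> V - P" "A3 \<subseteq> V - P" "A4 \<subseteq> V - P" "P \<subseteq> V" "card P = 4"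
    and "k \<le> card A1" "k \<le> card A2" "k \<le> card A3" "k \<le> card A4"
    and "A1 \<inter> A2 = {}" "A1 \<inter> A3 = {}" "A1 \<inter> A4 = {}" "A2 \<inter> A3 = {}" "A2 \<inter> A4 = {}" "A3 \<inter> A4 = {}"
  shows False
proof (rule four_disjoint[of "\<lambda>i. [A1, A2, A3, A4] ! i" P])
  have less4: "i < 4 \<longleftrightarrow> i = 0 \<or> i = 1 \<or> i = 2 \<or> i = 3" for i :: nat by auto
  show "[A1, A2, A3, A4] ! i \<subseteq> V - P" "k \<le> card ([A1, A2, A3, A4] ! i)" if "i < 4" for i
    using that assms unfolding less4 by auto
  show "[A1, A2, A3, A4] ! i \<inter> [A1, A2, A3, A4] ! j = {}" if "i < j" "j < 4" for i j
  proof -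
    have "i < 4" using that by simp
    with that show ?thesis using assms(11-16) unfolding less4 by auto
  qed
qed (use assms in auto)

text \<open>Any two triples of a four-set share a pair, so four different colours make their sets
  \<open>N\<close> disjoint. Each of these sets also avoids the four-set, since the fourth point
  sees another colour on every pair of the triple.\<close>

lemma no_rainbow_quad:
  assumes V: "{x, y, z, w} \<subseteq> V" and d: "distinct [x, y, z, w]"
  shows "\<not> distinct [c x y z, c x y w, c x z w, c y z w]"
proof
  assume r: "distinct [c x y z, c x y w, c x z w, c y z w]"
  have e: "c x w z = c x z w" "c y w z = c y z w" "c z w x = c x z w" "c z w y = c y z w" "c y w x = c x y w"
     "c y z x = c x y z" "c z x w = c x z w" "c x w y = c x y w" "c x z y = c x y z"
    using sym by metis+
  show False
  proof (rule four_disjoint'[of "N x y z" "{x, y, z, w}" "N x y w" "N x z w" "N y z w"])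
    show "k \<le> card (N x y z)" "k \<le> card (N x y w)" "k \<le> card (N x z w)" "k \<le> card (N y z w)"
      using V d by (auto intro!: card_N)
    show "card {x, y, z, w} = 4" using d by auto
  qed (use V d r in \<open>auto simp: N_iff e\<close>)
qed

text \<open>The four triples share the pair \<open>x y\<close>, so their sets \<open>N\<close> are
  disjoint, and none of them contains one of the four other points. Four excluded points suffice for
  the count, hence the choice of \<open>x\<close>, \<open>y\<close>, \<open>p\<close>,
  \<open>q\<close>.\<close>

lemma card_colours_le:
  assumes V: "{x, y, p, q, r, s} \<subseteq> V" and d: "distinct [x, y, p, q, r, s]"
  shows "\<not> distinct [c x y p, c x y q, c x y r, c x y s]"
proof
  assume r: "distinct [c x y p, c x y q, c x y r, c x y s]"
  show False
  proof (rule four_disjoint'[of "N x y p" "{x, y, p, q}" "N x y q" "N x y r" "N x y s"])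
    show "k \<le> card (N x y p)" "k \<le> card (N x y q)" "k \<le> card (N x y r)" "k \<le> card (N x y s)"
      using V d by (auto intro!: card_N)
    show "card {x, y, p, q} = 4" using d by auto
  qed (use V d r in \<open>auto simp: N_iff\<close>)
qed

lemma card_sum_eq:
  assumes "finite W" "\<And>i. i \<in> I \<Longrightarrow> f i \<subseteq> W" "finite I"
  shows "(\<Sum>i\<in>I. card (f i)) = (\<Sum>w\<in>W. card {i \<in> I. w \<in> f i})"
proof -
  have "(\<Sum>i\<in>I. card (f i)) = (\<Sum>i\<in>I. \<Sum>w\<in>W. of_bool (w \<in> f i))"
    using assms by (intro sum.cong refl) (simp add: sum.inter_filter[symmetric] of_bool_def Int_absorb1 flip: Int_def) 
  also have "\<dots> = (\<Sum>w\<in>W. \<Sum>i\<in>I. of_bool (w \<in> f i))" by (rule sum.swap)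
  also have "\<dots> = (\<Sum>w\<in>W. card {i \<in> I. w \<in> f i})"
    using assms by (intro sum.cong refl) (simp add: sum.inter_filter[symmetric] of_bool_def)
  finally show ?thesis .
qed

text \<open>
  Every vertex lies in at most two of the sets \<open>N e\<close> of the eight edges involved.  The two triples of
  edges that no shared pair separates need \<open>card_colours_le\<close> at a pair already seeing three colours.
\<close>

lemma eight_count:
  assumes V: "{v, p, q, r, s} \<subseteq> V" and d: "distinct [v, p, q, r, s]"
  shows "\<not> (\<forall>i \<in> {c v p q}. \<forall>j \<in> {c v p r, c v p s}. \<forall>k \<in> {c v q r, c v r s}.
         \<forall>l \<in> {c v q s}. \<forall>m \<in> {c p r s, c q r s}. distinct [i, j, k, l, m])"
proof
  assume "\<forall>i \<in> {c v p q}. \<forall>j \<in> {c v p r, c v p s}. \<forall>k \<in> {c v q r, c v r s}.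
         \<forall>l \<in> {c v q s}. \<forall>m \<in> {c p r s, c q r s}. distinct [i, j, k, l, m]"
  then have D: "c v p q \<noteq> c v p r" "c v p q \<noteq> c v p s" "c v p q \<noteq> c v q r" "c v p q \<noteq> c v q s"
      "c v p r \<noteq> c v r s" "c v p r \<noteq> c p r s" "c v q r \<noteq> c v q s" "c v q r \<noteq> c q r s"
      "c v p s \<noteq> c v r s" "c v p s \<noteq> c v q s" "c v p s \<noteq> c p r s" "c v q s \<noteq> c v r s" "c v q s \<noteq> c q r s"
      "c v r s \<noteq> c p r s" "c v r s \<noteq> c q r s" "c v p r \<noteq> c v q r"
      "c v p q \<noteq> c v r s" "c v p q \<noteq> c p r s" "c v p q \<noteq> c q r s" "c v p r \<noteq> c v q s" "c v p r \<noteq> c q r s"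
      "c v q r \<noteq> c v p s" "c v q r \<noteq> c p r s" "c v p s \<noteq> c q r s" "c v q s \<noteq> c p r s"
    by auto
  let ?E = "[N v p q, N v p r, N v p s, N v q r, N v r s, N v q s, N p r s, N q r s]"
  have less8: "i < 8 \<longleftrightarrow> i \<in> {0, 1, 2, 3, 4, 5, 6, 7}" for i :: nat by auto
  define g where "g w = (\<Sum>i<8. of_bool (w \<in> ?E ! i) :: nat)" for w
  have g: "g w = of_bool (w \<in> N v p q) + of_bool (w \<in> N v p r) + of_bool (w \<in> N v p s) + of_bool (w \<in> N v q r)
      + of_bool (w \<in> N v r s) + of_bool (w \<in> N v q s) + of_bool (w \<in> N p r s) + of_bool (w \<in> N q r s)" for w
    unfolding g_def by (simp add: eval_nat_numeral)
  have e: "c r s v = c v r s" "c p s v = c v p s" "c p r v = c v p r" "c q r v = c v q r" "c q s v = c v q s"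
     "c v q p = c v p q" "c v r p = c v p r" "c v s p = c v p s" "c v r q = c v q r" "c v s q = c v q s" "c v s r = c v r s"
     "c r s p = c p r s" "c r s q = c q r s" "c p q v = c v p q"
    using sym by metis+
  have t1: "\<not> (w \<in> N v p q \<and> w \<in> N p r s \<and> w \<in> N q r s)" for w
  proof
    assume w: "w \<in> N v p q \<and> w \<in> N p r s \<and> w \<in> N q r s"
    then have V': "{v, s, p, q, r, w} \<subseteq> V" "{v, p, s, w} \<subseteq> V" "{v, q, s, w} \<subseteq> V"
      and d': "distinct [v, s, p, q, r, w]" "distinct [v, p, s, w]" "distinct [v, q, s, w]"
      using V d unfolding N_iff by auto
    have cw: "c v p w = c v p q" "c v q w = c v p q" "c p s w = c p r s" "c q s w = c q r s"
      using w unfolding N_iff by auto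
    have "c v s w \<in> {c v p s, c v q s, c v r s}"
      using card_colours_le[OF V'(1) d'(1)] by (auto simp: e D D[symmetric])
    \<comment> \<open>In the four-set v, p, s, w the other three triples have three different
      colours, so the fourth must repeat one of them. The three resulting lists for
      \<open>c v s w\<close> have no common colour.\<close>
    moreover have "c v s w \<in> {c v p s, c v p q, c p r s}"
      using no_rainbow_quad[OF V'(2) d'(2)] by (auto simp: cw D D[symmetric])
    moreover have "c v s w \<in> {c v q s, c v p q, c q r s}"
      using no_rainbow_quad[OF V'(3) d'(3)] by (auto simp: cw D D[symmetric])
    ultimately show False by (auto simp: D D[symmetric])
  qed
  have t2: "\<not> (w \<in> N v p r \<and> w \<in> N v p s \<and> w \<in> N q r s)" for w
  proof
    assume w: "w \<in> N v p r \<and> w \<in> N v p s \<and> w \<in> N q r s"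
    then have V': "{v, q, p, r, s, w} \<subseteq> V" "{v, q, r, w} \<subseteq> V" "{v, q, s, w} \<subseteq> V"
      and d': "distinct [v, q, p, r, s, w]" "distinct [v, q, r, w]" "distinct [v, q, s, w]"
      using V d unfolding N_iff by auto
    have cw: "c v r w = c v p r" "c v s w = c v p r" "c q r w = c q r s" "c q s w = c q r s"
      using w unfolding N_iff by auto
    have "c v q w \<in> {c v p q, c v q r, c v q s}"
      using card_colours_le[OF V'(1) d'(1)] by (auto simp: e D D[symmetric])
    moreover have "c v q w \<in> {c v q r, c v p r, c q r s}"
      using no_rainbow_quad[OF V'(2) d'(2)] by (auto simp: cw D D[symmetric])
    moreover have "c v q w \<in> {c v q s, c v p r, c q r s}"
      using no_rainbow_quad[OF V'(3) d'(3)] by (auto simp: cw D D[symmetric])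
    ultimately show False by (auto simp: D D[symmetric])
  qed
  have 2: "g w \<le> 2" for w
  proof -
    have "\<not> (w \<in> N v p q \<and> w \<in> N v p r)" "\<not> (w \<in> N v p q \<and> w \<in> N v p s)"
      "\<not> (w \<in> N v p q \<and> w \<in> N v q r)" "\<not> (w \<in> N v p q \<and> w \<in> N v q s)"
      "\<not> (w \<in> N v p r \<and> w \<in> N v r s)" "\<not> (w \<in> N v p r \<and> w \<in> N p r s)"
      "\<not> (w \<in> N v q r \<and> w \<in> N v q s)" "\<not> (w \<in> N v q r \<and> w \<in> N q r s)"
      "\<not> (w \<in> N v p s \<and> w \<in> N v r s)" "\<not> (w \<in> N v p s \<and> w \<in> N v q s)"
      "\<not> (w \<in> N v p s \<and> w \<in> N p r s)" "\<not> (w \<in> N v q s \<and> w \<in> N v r s)"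
      "\<not> (w \<in> N v q s \<and> w \<in> N q r s)" "\<not> (w \<in> N v r s \<and> w \<in> N p r s)"
      "\<not> (w \<in> N v r s \<and> w \<in> N q r s)" "\<not> (w \<in> N v p r \<and> w \<in> N v q r)"
      by (auto simp: N_iff D D[symmetric])
    \<comment> \<open>The sixteen pairs are edges that share two vertices and have different
      colours. Among the eight edges exactly two triples contain no such pair, and these are the
      ones excluded by \<open>t1\<close> and \<open>t2\<close>.\<close>
    then show ?thesis unfolding g using t1[of w] t2[of w] by (rule of_bool_sum_le)
  qed
  \<comment> \<open>The five points of the pattern carry less weight than the rest: \<open>p\<close>
    can lie only in \<open>N q r s\<close>, \<open>q\<close> only in \<open>N p r s\<close>, and the
    other three lie in none of the sets.\<close>
  have 1: "g v = 0" "g r = 0" "g s = 0" "g p \<le> 1" "g q \<le> 1"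
  proof -
    have "v \<notin> N p r s" "v \<notin> N q r s" "r \<notin> N v p q" "r \<notin> N v p s" "r \<notin> N v q s"
      "s \<notin> N v p q" "s \<notin> N v p r" "s \<notin> N v q r" "p \<notin> N v q r" "p \<notin> N v r s" "p \<notin> N v q s"
      "q \<notin> N v p r" "q \<notin> N v p s" "q \<notin> N v r s"
      by (auto simp: N_iff e D D[symmetric])
    moreover have "x \<notin> N x y z" "x \<notin> N y x z" "x \<notin> N y z x" for x y z unfolding N_iff by auto
    ultimately show "g v = 0" "g r = 0" "g s = 0" "g p \<le> 1" "g q \<le> 1" unfolding g by auto
  qed
  have "8 * k = (\<Sum>i<8::nat. k)" by simp
  also have "\<dots> \<le> (\<Sum>i<8. card (?E ! i))"
  proof (rule sum_mono)
    fix i :: nat assume "i \<in> {..<8}"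
    then have "i \<in> {0, 1, 2, 3, 4, 5, 6, 7}" using less8 by blast
    then show "k \<le> card (?E ! i)" using V d by (auto intro!: card_N)
  qed
  also have "\<dots> = (\<Sum>w\<in>V. card {i \<in> {..<8}. w \<in> ?E ! i})"
  proof (rule card_sum_eq)
    fix i :: nat assume "i \<in> {..<8}"
    then have "i \<in> {0, 1, 2, 3, 4, 5, 6, 7}" using less8 by blast
    then show "?E ! i \<subseteq> V" by (auto simp: N_iff)
  qed (use finite_V in auto)
  also have "\<dots> = (\<Sum>w\<in>V. g w)"
    unfolding g_def by (intro sum.cong refl) (simp add: sum.inter_filter[symmetric] of_bool_def)
  also have "\<dots> = (\<Sum>w\<in>V - {v, p, q, r, s}. g w) + (\<Sum>w\<in>{v, p, q, r, s}. g w)"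
    using V finite_V by (rule sum.subset_diff)
  also have "(\<Sum>w\<in>{v, p, q, r, s}. g w) \<le> 2"
    using d 1 by simp
  also have "(\<Sum>w\<in>V - {v, p, q, r, s}. g w) \<le> (\<Sum>w\<in>V - {v, p, q, r, s}. 2)"
    by (intro sum_mono 2)
  also have "\<dots> = 2 * (card V - 5)"
    using V d finite_V by (simp add: card_Diff_subset)
  \<comment> \<open>The right side is 2n - 8, which is at most 8k - 2.\<close>
  finally have "8 * k \<le> 2 * (card V - 5) + 2" by simp
  moreover have "5 \<le> card V" using card_mono[OF finite_V V] d by simp
  ultimately show False using card_V by linarith
qed

section \<open>Colours seen at a pair\<close>

definition colours :: "'a \<Rightarrow> 'a \<Rightarrow> 'c set" where
  "colours v x = (\<lambda>y. c v x y) ` (V - {v, x})"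

lemma colours_mem: "\<lbrakk>y \<in> V; y \<noteq> v; y \<noteq> x\<rbrakk> \<Longrightarrow> c v x y \<in> colours v x"
  unfolding colours_def by simp

text \<open>The colours at the pair \<open>v x\<close> are those of \<open>v x p\<close>,
  \<open>v x q\<close> and a third one, of \<open>v x z\<close>. If \<open>i\<close> is one of the
  first two, then \<open>p\<close> or \<open>q\<close> is the required vertex, as the edge
  \<open>v p q\<close> gives it the colour \<open>h\<close>. For the third one a vertex in both
  \<open>N v p q\<close> and \<open>N v x z\<close> is used, and the count of four disjoint sets
  provides it.\<close>

lemma extend_colour_aux:
  assumes V: "v \<in> V" "x \<in> V" "x \<noteq> v" and i: "i \<in> colours v x" and h: "h \<notin> colours v x"
    and card: "card (colours v x) = 3"
    and pq: "p \<in> V - {v}" "q \<in> V - {v, p}" "c v p q = h" and ne: "c v x p \<noteq> c v x q"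
  shows "\<exists>w \<in> V - {v}. i \<in> colours v w \<and> h \<in> colours v w"
proof -
  have xpq: "x \<noteq> p" "x \<noteq> q"
    using h pq colours_mem[of q v p] colours_mem[of p v q] sym(2)[of v p q] by auto
  have ip: "c v x p \<in> colours v x" "c v x q \<in> colours v x"
    using pq xpq unfolding colours_def by auto
  have "\<not> colours v x \<subseteq> {c v x p, c v x q}"
  proof
    assume "colours v x \<subseteq> {c v x p, c v x q}"
    then have "card (colours v x) \<le> card {c v x p, c v x q}" by (intro card_mono) auto
    with card show False by (simp add: card_insert_if split: if_splits)
  qed
  then obtain z where z: "z \<in> V - {v, x}" "c v x z \<noteq> c v x p" "c v x z \<noteq> c v x q"
    unfolding colours_def by auto
  have "colours v x \<subseteq> {c v x p, c v x q, c v x z}"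
  proof (rule ccontr)
    assume "\<not> ?thesis"
    then obtain j where "j \<in> colours v x" "j \<notin> {c v x p, c v x q, c v x z}" by blast
    then have "{j, c v x p, c v x q, c v x z} \<subseteq> colours v x" "card {j, c v x p, c v x q, c v x z} = 4"
      using ip z ne unfolding colours_def by auto
    moreover have "finite (colours v x)" using card by (simp add: card_ge_0_finite)
    ultimately have "4 \<le> card (colours v x)" by (metis card_mono)
    then show False using card by simp
  qed
  with i have i3: "i = c v x p \<or> i = c v x q \<or> i = c v x z" by blast
  have hx: "h \<noteq> c v x p" "h \<noteq> c v x q" "h \<noteq> c v x z" using h ip z unfolding colours_def by auto
  have e: "c v p x = c v x p" "c v q x = c v x q" "c v q p = c v p q" "c v z x = c v x z"
    by (rule sym(2))+
  \<comment> \<open>This is the only pair among the four sets that no shared pair of vertices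
    separates: \<open>N v p q\<close> is disjoint from \<open>N v x p\<close> through
    \<open>v p\<close>, and from \<open>N v x q\<close> through \<open>v q\<close>.\<close>
  have "N v p q \<inter> N v x z \<noteq> {}"
  proof
    assume "N v p q \<inter> N v x z = {}"
    show False
    proof (rule four_disjoint'[of "N v x p" "{v, x, p, q}" "N v x q" "N v x z" "N v p q"])
      show "k \<le> card (N v x p)" "k \<le> card (N v x q)" "k \<le> card (N v x z)" "k \<le> card (N v p q)"
        using V pq xpq z by (auto intro!: card_N)
      show "card {v, x, p, q} = 4" using V pq xpq by auto
      show "N v x z \<inter> N v p q = {}" using \<open>N v p q \<inter> N v x z = {}\<close> by blast
    qed (use V pq xpq z ne hx in \<open>auto simp: N_iff e\<close>)
  qed
  then obtain w where w: "w \<in> N v p q" "w \<in> N v x z" by blast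
  have "h \<in> colours v p" "c v x p \<in> colours v p"
    using pq xpq V colours_mem[of q v p] colours_mem[of x v p] unfolding e by simp_all
  moreover have "h \<in> colours v q" "c v x q \<in> colours v q"
    using pq xpq V colours_mem[of p v q] colours_mem[of x v q] unfolding e by auto
  moreover have "h \<in> colours v w" "c v x z \<in> colours v w"
  proof -
    have "c v w p = h" "c v w x = c v x z"
      using w pq(3) sym(2)[of v w p] sym(2)[of v w x] unfolding N_iff by auto
    moreover have "p \<in> V - {v, w}" "x \<in> V - {v, w}" using w pq V unfolding N_iff by auto
    ultimately show "h \<in> colours v w" "c v x z \<in> colours v w"
      unfolding colours_def by (metis imageI)+
  qed
  moreover have "w \<in> V - {v}" "q \<in> V - {v}" using w pq unfolding N_iff by auto
  ultimately show ?thesis using i3 pq(1) by blast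
qed

text \<open>When \<open>p\<close> and \<open>q\<close> see the same colour from \<open>v x\<close>,
  the vertex \<open>q\<close> is replaced by another one that keeps the colour \<open>h\<close> with
  \<open>v p\<close> but sees a different colour from \<open>v x\<close>. This reduces the claim to
  \<open>extend_colour_aux\<close>.\<close>

lemma extend_colour:
  assumes V: "v \<in> V" "x \<in> V" "x \<noteq> v" and i: "i \<in> colours v x" and h: "h \<notin> colours v x"
    and card: "card (colours v x) = 3"
    and pq: "p \<in> V - {v}" "q \<in> V - {v, p}" "c v p q = h"
  shows "\<exists>w \<in> V - {v}. i \<in> colours v w \<and> h \<in> colours v w"
proof (cases "c v x p = c v x q")
  case False
  then show ?thesis using extend_colour_aux assms by blast
next
  case True
  have xpq: "x \<noteq> p" "x \<noteq> q"
    using h pq colours_mem[of q v p] colours_mem[of p v q] sym(2)[of v p q] by auto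
  have ip: "c v x p \<in> colours v x"
    using pq xpq unfolding colours_def by auto
  have fin: "finite (colours v x)" using card by (simp add: card_ge_0_finite)
  have "card (colours v x - {c v x p}) = 2" using ip card fin by simp
  then obtain l m where lm: "colours v x - {c v x p} = {l, m}" "l \<noteq> m" by (auto simp: card_2_iff)
  then have "l \<in> colours v x" "m \<in> colours v x" "l \<noteq> c v x p" "m \<noteq> c v x p" by auto
  then obtain y z where y: "y \<in> V - {v, x}" "c v x y = l" "c v x y \<noteq> c v x p"
    and z: "z \<in> V - {v, x}" "c v x z = m" "c v x z \<noteq> c v x p"
    unfolding colours_def by auto
  have yz: "c v x y \<noteq> c v x z" using y z lm by simp
  have hx: "h \<noteq> c v x p" "h \<noteq> c v x y" "h \<noteq> c v x z" using h ip y z unfolding colours_def by auto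
  have e: "c v p x = c v x p" "c v q x = c v x q" "c v q p = c v p q" "c v z x = c v x z" "c v y x = c v x y"
    by (rule sym(2))+
  \<comment> \<open>Here \<open>y\<close> and \<open>z\<close> represent the two colours at
    \<open>v x\<close> other than that of \<open>p\<close>. If \<open>N v p q\<close> met neither
    set, four disjoint sets would lie outside \<open>v\<close>, \<open>x\<close>, \<open>p\<close>,
    \<open>q\<close>.\<close>
  have "N v p q \<inter> N v x y \<noteq> {} \<or> N v p q \<inter> N v x z \<noteq> {}"
  proof (rule ccontr)
    assume "\<not> ?thesis"
    then have dd: "N v x y \<inter> N v p q = {}" "N v x z \<inter> N v p q = {}" by blast+
    show False
    proof (rule four_disjoint'[of "N v x p" "{v, x, p, q}" "N v x y" "N v x z" "N v p q"])
      show "k \<le> card (N v x p)" "k \<le> card (N v x y)" "k \<le> card (N v x z)" "k \<le> card (N v p q)"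
        using V pq xpq y z by (auto intro!: card_N)
      show "card {v, x, p, q} = 4" using V pq xpq by auto
      show "N v x y \<inter> N v p q = {}" "N v x z \<inter> N v p q = {}" by (fact dd)+
      show "N v x p \<subseteq> V - {v, x, p, q}" "N v x y \<subseteq> V - {v, x, p, q}" "N v x z \<subseteq> V - {v, x, p, q}"
        "N v p q \<subseteq> V - {v, x, p, q}"
        using hx pq(3) y(3) z(3) e True by (auto simp: N_iff)
      show "N v x p \<inter> N v x y = {}" "N v x p \<inter> N v x z = {}" "N v x p \<inter> N v p q = {}" "N v x y \<inter> N v x z = {}"
        using hx pq(3) y(3) z(3) e yz by (auto simp: N_iff)
      show "{v, x, p, q} \<subseteq> V" using V pq by auto
    qed
  qed
  then obtain w where w: "w \<in> N v p q" "w \<in> N v x y \<or> w \<in> N v x z" by blast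
  then have w2: "c v x p \<noteq> c v x w" using y(3) z(3) unfolding N_iff by auto
  show ?thesis
  proof (rule extend_colour_aux[OF V i h card pq(1)])
    show "c v x p \<noteq> c v x w" by (fact w2)
    show "w \<in> V - {v, p}" "c v p w = h" using w(1) pq unfolding N_iff by auto
  qed
qed

end

section \<open>Pairwise meeting families and the Fano plane\<close>

text \<open>The lines of the Fano plane as translates of the difference set {0, 1, 3} modulo
  7.\<close>

definition ln :: "nat \<Rightarrow> nat set" where
  "ln i = {i, (i + 1) mod 7, (i + 3) mod 7}"

text \<open>The family abstracts the sets \<open>colours v x\<close> for a fixed \<open>v\<close>;
  its elements are colours. The hypothesis \<open>extend\<close> is limited to members of size three
  because \<open>extend_colour\<close> needs all three colours at the pair. The hypothesis
  \<open>seven\<close> is the negation of the bound that is wanted for the star.\<close>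

locale meeting_family =
  fixes F :: "'c set set"
  assumes fin: "A \<in> F \<Longrightarrow> finite A" and card3: "A \<in> F \<Longrightarrow> card A \<le> 3"
    and meet: "\<lbrakk>A \<in> F; B \<in> F\<rbrakk> \<Longrightarrow> A \<inter> B \<noteq> {}"
    and nocommon: "\<exists>A \<in> F. i \<notin> A"
    and extend: "\<lbrakk>A \<in> F; card A = 3; i \<in> A; h \<in> \<Union>F\<rbrakk> \<Longrightarrow> \<exists>B \<in> F. i \<in> B \<and> h \<in> B"
    and finU: "finite (\<Union>F)" and seven: "7 \<le> card (\<Union>F)"
begin

lemma superset_eq: "\<lbrakk>A \<in> F; x \<in> A; y \<in> A; z \<in> A; x \<noteq> y; x \<noteq> z; y \<noteq> z\<rbrakk> \<Longrightarrow> A = {x, y, z}"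
  using card_seteq[of A "{x, y, z}"] fin card3 by fastforce

lemma fresh:
  assumes "finite S" "card S < 7"
  obtains h where "h \<in> \<Union>F" "h \<notin> S"
proof -
  have "\<not> \<Union>F \<subseteq> S" using assms seven card_mono[of S "\<Union>F"] by linarith
  with that show ?thesis by blast
qed

text \<open>A member that joins two elements outside \<open>{a, b}\<close> must contain
  \<open>a\<close> or \<open>b\<close> and is thereby determined. With three further elements this
  fills the family with triples through \<open>a\<close>, so that a member avoiding \<open>a\<close>
  would need four elements.\<close>

lemma no_triple:
  assumes ab: "{a, b} \<in> F" "a \<noteq> b" and T: "{a, x, y} \<in> F" "x \<noteq> y" "x \<notin> {a, b}" "y \<notin> {a, b}"
  shows False
proof -
  have small: "card {a, b, x, y} < 7" "card {a, b, x, y, h} < 7" "card {a, b, x, y, h, h'} < 7" for h h'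
    by (simp_all add: card_insert_if)
  obtain h1 where h1: "h1 \<in> \<Union>F" "h1 \<notin> {a, b, x, y}"
    using fresh[OF _ small(1)] by blast
  obtain h2 where h2: "h2 \<in> \<Union>F" "h2 \<notin> {a, b, x, y, h1}"
    using fresh[OF _ small(2)] by blast
  \<comment> \<open>Besides \<open>a\<close>, \<open>b\<close>, \<open>x\<close>, \<open>y\<close>
    there are at least three more elements, as the union has at least seven.\<close>
  obtain h3 where h3: "h3 \<in> \<Union>F" "h3 \<notin> {a, b, x, y, h1, h2}"
    using fresh[OF _ small(3)] by blast
  have pair: "{a, u, w} \<in> F \<or> {b, u, w} \<in> F"
    if B: "B \<in> F" "u \<in> B" "w \<in> B" "u \<notin> {a, b}" "w \<notin> {a, b}" "u \<noteq> w" for B u w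
  proof -
    from meet[OF B(1) ab(1)] have "a \<in> B \<or> b \<in> B" by blast
    then show ?thesis
    proof
      assume "a \<in> B"
      from superset_eq[OF B(1) this B(2,3)] B(4-6) have "B = {a, u, w}" by blast
      with B(1) show ?thesis by simp
    next
      assume "b \<in> B"
      from superset_eq[OF B(1) this B(2,3)] B(4-6) have "B = {b, u, w}" by blast
      with B(1) show ?thesis by simp
    qed
  qed
  have T3: "card {a, x, y} = 3" using T by auto
  have px: "{a, u, h} \<in> F \<or> {b, u, h} \<in> F" if h: "h \<in> \<Union>F" "h \<notin> {a, b, x, y}" "u \<in> {x, y}" for h u
  proof -
    obtain B where "B \<in> F" "u \<in> B" "h \<in> B" using extend[OF T(1) T3 _ h(1), of u] h(3) by blast
    moreover have "u \<notin> {a, b}" "h \<notin> {a, b}" "u \<noteq> h" using h T by auto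
    ultimately show ?thesis using pair by blast
  qed
  have cross: "\<not> ({a, x, h} \<in> F \<and> {b, y, h'} \<in> F)" "\<not> ({b, x, h} \<in> F \<and> {a, y, h'} \<in> F)"
    if h: "h \<noteq> h'" "h \<notin> {a, b, x, y}" "h' \<notin> {a, b, x, y}" for h h'
  proof -
    have "{a, x, h} \<inter> {b, y, h'} = {}" "{b, x, h} \<inter> {a, y, h'} = {}" using h ab(2) T by auto
    then show "\<not> ({a, x, h} \<in> F \<and> {b, y, h'} \<in> F)" "\<not> ({b, x, h} \<in> F \<and> {a, y, h'} \<in> F)"
      using meet by blast+
  qed
  have n: "h1 \<notin> {a, b, x, y}" "h2 \<notin> {a, b, x, y}" "h3 \<notin> {a, b, x, y}" and hd: "h1 \<noteq> h2" "h1 \<noteq> h3" "h2 \<noteq> h3"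
    using h1(2) h2(2) h3(2) by auto
  have xy: "x \<in> {x, y}" "y \<in> {x, y}" by auto
  \<comment> \<open>The member through \<open>y\<close> and \<open>h3\<close> decides between
    \<open>a\<close> and \<open>b\<close>; by \<open>cross\<close> the members joining
    \<open>x\<close> to \<open>h1\<close> and to \<open>h2\<close> must make the same
    choice.\<close>
  have "({a, x, h1} \<in> F \<and> {a, x, h2} \<in> F) \<or> ({b, x, h1} \<in> F \<and> {b, x, h2} \<in> F)"
    using px[OF h1(1) n(1) xy(1)] px[OF h2(1) n(2) xy(1)] px[OF h3(1) n(3) xy(2)]
      cross[OF hd(2) n(1,3)] cross[OF hd(3) n(2,3)] by argo
  then obtain d where d: "d = a \<or> d = b" "{d, x, h1} \<in> F" "{d, x, h2} \<in> F" by blast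
  have c3: "card {d, x, h1} = 3" "card {d, x, h2} = 3"
    using d(1) n T(3) by (auto simp: card_insert_if)
  have hh: "{a, u, w} \<in> F" if uw: "{d, x, u} \<in> F" "card {d, x, u} = 3" "u \<notin> {a, b, x, y}" "w \<notin> {a, b, x, y}" "w \<in> \<Union>F" "u \<noteq> w" for u w
  proof -
    obtain B where "B \<in> F" "u \<in> B" "w \<in> B" using extend[OF uw(1,2) _ uw(5), of u] by blast
    then have "{a, u, w} \<in> F \<or> {b, u, w} \<in> F" using pair uw by blast
    moreover have "{a, x, y} \<inter> {b, u, w} = {}" using uw(3,4) ab(2) T by auto
    then have "{b, u, w} \<notin> F" using meet[OF T(1), of "{b, u, w}"] by blast
    ultimately show ?thesis by blast
  qed
  have "{a, h1, h2} \<in> F" "{a, h1, h3} \<in> F" "{a, h2, h3} \<in> F"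
    by (fact hh[OF d(2) c3(1) n(1,2) h2(1) hd(1)] hh[OF d(2) c3(1) n(1,3) h3(1) hd(2)] hh[OF d(3) c3(2) n(2,3) h3(1) hd(3)])+
  moreover obtain A where A: "A \<in> F" "a \<notin> A" using nocommon by blast
  moreover have "b \<in> A" using meet[OF A(1) ab(1)] A(2) by auto
  moreover have "x \<in> A \<or> y \<in> A" using meet[OF A(1) T(1)] A(2) by auto
  \<comment> \<open>A set without \<open>a\<close> that meets all three of these triples contains
    two of the three further elements. Together with \<open>b\<close> they already exhaust it,
    leaving no room for \<open>x\<close> or \<open>y\<close>.\<close>
  ultimately have "\<exists>u w. u \<in> {h1, h2, h3} \<and> w \<in> {h1, h2, h3} \<and> u \<noteq> w \<and> u \<in> A \<and> w \<in> A"
    using meet[of A "{a, h1, h2}"] meet[of A "{a, h1, h3}"] meet[of A "{a, h2, h3}"] hd A by blast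
  then obtain u w where uw: "u \<in> {h1, h2, h3}" "w \<in> {h1, h2, h3}" "u \<noteq> w" "u \<in> A" "w \<in> A" by blast
  have "A = {b, u, w}" using superset_eq[OF A(1) \<open>b \<in> A\<close> uw(4,5)] uw n by auto
  with \<open>x \<in> A \<or> y \<in> A\<close> show False using uw n T by auto
qed

text \<open>A two-element member \<open>{a, b}\<close> would force, through
  \<open>no_triple\<close>, that the members missing \<open>b\<close> all equal
  \<open>{a, q}\<close> and those missing \<open>a\<close> all equal \<open>{b, q}\<close>. Any
  further element then lies only in the set consisting of \<open>a\<close>, \<open>b\<close> and
  itself, and \<open>extend\<close> cannot join it to \<open>q\<close>.\<close>

lemma card_eq_3:
  assumes A: "A \<in> F"
  shows "card A = 3"
proof (rule ccontr)
  assume "card A \<noteq> 3"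
  have ne: "A \<noteq> {}" using meet[OF A A] by blast
  have "card A \<noteq> 1"
  proof
    assume "card A = 1"
    then obtain a where "A = {a}" by (auto simp: card_1_singleton_iff)
    moreover obtain B where "B \<in> F" "a \<notin> B" using nocommon by blast
    ultimately show False using meet[OF A] by blast
  qed
  with \<open>card A \<noteq> 3\<close> ne have "card A = 2" using card3[OF A] fin[OF A]
    by (metis One_nat_def card_0_eq le_neq_implies_less less_2_cases less_Suc_eq numeral_2_eq_2 numeral_3_eq_3)
  then obtain a b where ab: "A = {a, b}" "a \<noteq> b" by (auto simp: card_2_iff)
  have ab2: "{b, a} \<in> F" "{a, b} \<in> F" using A ab by (auto simp: insert_commute)
  have two: "\<exists>q. B = {p, q}" if Bpr: "B \<in> F" "p \<in> B" "r \<notin> B" "{p, r} \<in> F" "p \<noteq> r" for B p r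
  proof -
    have "\<not> (\<exists>x y. x \<in> B \<and> y \<in> B \<and> x \<noteq> y \<and> x \<noteq> p \<and> y \<noteq> p)"
    proof
      assume "\<exists>x y. x \<in> B \<and> y \<in> B \<and> x \<noteq> y \<and> x \<noteq> p \<and> y \<noteq> p"
      then obtain x y where xy: "x \<in> B" "y \<in> B" "x \<noteq> y" "x \<noteq> p" "y \<noteq> p" by blast
      then have "B = {p, x, y}" using superset_eq[OF Bpr(1,2), of x y] by auto
      with Bpr xy show False using no_triple[of p r x y] by auto
    qed
    then have "\<exists>q. B \<subseteq> {p, q}" by blast
    then show ?thesis using Bpr(2) by blast
  qed
  obtain B where B: "B \<in> F" "b \<notin> B" using nocommon by blast
  then have aB: "a \<in> B" using meet[OF B(1) ab2(1)] by blast
  obtain q where q: "B = {a, q}" using two[OF B(1) aB B(2) ab2(2) ab(2)] by blast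
  have toa: "C = {b, q}" if C: "C \<in> F" "a \<notin> C" for C
  proof -
    have "b \<in> C" using meet[OF C(1) ab2(1)] C by blast
    then obtain r where r: "C = {b, r}" using two[OF C(1) _ C(2) ab2(1)] ab by blast
    then show ?thesis using meet[OF B(1) C(1)] q B C ab by auto
  qed
  obtain C where C: "C \<in> F" "a \<notin> C" using nocommon by blast
  have Cq: "C = {b, q}" using toa C by blast
  then have qn: "q \<noteq> a" "q \<noteq> b" using C B q by auto
  have tob: "D = {a, q}" if D: "D \<in> F" "b \<notin> D" for D
  proof -
    have "a \<in> D" using meet[OF D(1) ab2(1)] D by blast
    then obtain r where r: "D = {a, r}" using two[OF D(1) _ D(2) ab2(2)] ab by blast
    then show ?thesis using meet[OF C(1) D(1)] Cq C D ab by auto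
  qed
  have "card {a, b, q} < 7" by (simp add: card_insert_if)
  then obtain h where h: "h \<in> \<Union>F" "h \<notin> {a, b, q}" using fresh[of "{a, b, q}"] by blast
  have both: "a \<in> D \<and> b \<in> D" if "D \<in> F" "h \<in> D" for D using toa[OF that(1)] tob[OF that(1)] that h by blast
  from h obtain D where D: "D \<in> F" "h \<in> D" by blast
  then have "D = {a, b, h}" using superset_eq[OF D(1), of a b h] both h ab by auto
  then have "card D = 3" using h ab by auto
  then obtain E where E: "E \<in> F" "h \<in> E" "q \<in> E"
    using extend[OF D(1) _ D(2), of q] q B(1) by blast
  then have "E = {a, b, h}" using superset_eq[OF E(1), of a b h] both[OF E(1,2)] h ab by auto
  then show False using E h qn by auto
qed

text \<open>With every member of size three, the restriction in \<open>extend\<close> disappears and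
  any two elements are joined, as points are in a projective plane.\<close>

lemma pair_covered:
  assumes "u \<in> \<Union>F" "w \<in> \<Union>F"
  shows "\<exists>B \<in> F. u \<in> B \<and> w \<in> B"
proof -
  from assms(1) obtain A where "A \<in> F" "u \<in> A" by blast
  then show ?thesis using extend card_eq_3 assms(2) by blast
qed

text \<open>Four elements lie off a member \<open>T\<close>, and each pair of them is joined by a
  member with its third element in \<open>T\<close>. The three ways of splitting the four into two
  pairs yield the three points of \<open>T\<close>, and this determines the plane.\<close>

lemma fano:
  obtains a where "inj_on a {..<7::nat}" "F = (\<lambda>i. a ` ln i) ` {..<7}"
proof -
  obtain T where T: "T \<in> F" using nocommon by blast
  have "finite T" "card T = 3" using fin card_eq_3 T by blast+
  have "4 \<le> card (\<Union>F - T)" using seven \<open>card T = 3\<close> \<open>finite T\<close> by (simp add: card_Diff_subset T Sup_upper)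
  then obtain Q where Q: "Q \<subseteq> \<Union>F - T" "card Q = 4" by (meson obtain_subset_with_card_n)
  then obtain d Q3 where dQ: "Q = insert d Q3" "d \<notin> Q3" "card Q3 = 3" using card_Suc_eq[of Q 3] by auto
  then obtain e f g where "Q3 = {e, f, g}" "distinct [e, f, g]" by (auto simp: card_3_iff)
  with dQ have efg: "Q = {d, e, f, g}" "distinct [d, e, f, g]" by auto
  have Qn: "d \<notin> T" "e \<notin> T" "f \<notin> T" "g \<notin> T" and U: "d \<in> \<Union>F" "e \<in> \<Union>F" "f \<in> \<Union>F" "g \<in> \<Union>F"
    using Q efg by auto
  have ex: "\<exists>t \<in> T. {t, u, w} \<in> F" if uw: "u \<in> \<Union>F" "w \<in> \<Union>F" "u \<noteq> w" "u \<notin> T" "w \<notin> T" for u w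
  proof -
    obtain B where B: "B \<in> F" "u \<in> B" "w \<in> B" using pair_covered uw(1,2) by blast
    obtain t where t: "t \<in> B" "t \<in> T" using meet[OF B(1) T] by blast
    then have "B = {t, u, w}" using superset_eq[OF B(1) t(1) B(2,3)] uw by blast
    with B t show ?thesis by blast
  qed
  \<comment> \<open>Complementary pairs of the four outside elements determine the same element of
    \<open>T\<close>, because their joining members can meet only there.\<close>
  have same: "t = t'" if "{t, u, w} \<in> F" "{t', u', w'} \<in> F" "t \<in> T" "t' \<in> T" "distinct [u, w, u', w']"
     "u \<notin> T" "w \<notin> T" "u' \<notin> T" "w' \<notin> T" for t t' u w u' w'
    using meet[OF that(1,2)] that by auto
  obtain t1 where t1: "t1 \<in> T" "{t1, d, e} \<in> F" using ex[OF U(1,2)] efg(2) Qn by auto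
  obtain t2 where t2: "t2 \<in> T" "{t2, d, f} \<in> F" using ex[OF U(1,3)] efg(2) Qn by auto
  obtain t3 where t3: "t3 \<in> T" "{t3, d, g} \<in> F" using ex[OF U(1,4)] efg(2) Qn by auto
  have t1': "{t1, f, g} \<in> F" using ex[OF U(3,4)] same[OF t1(2) _ t1(1), of _ f g] efg Qn by auto
  have t2': "{t2, e, g} \<in> F" using ex[OF U(2,4)] same[OF t2(2) _ t2(1), of _ e g] efg Qn by auto
  have t3': "{t3, e, f} \<in> F" using ex[OF U(2,3)] same[OF t3(2) _ t3(1), of _ e f] efg Qn by auto
  note lines = t1(2) t1' t2(2) t2' t3(2) t3'
  note tT = t1(1) t2(1) t3(1)
  have hit: "(t1 \<in> A \<or> d \<in> A \<or> e \<in> A) \<and> (t1 \<in> A \<or> f \<in> A \<or> g \<in> A) \<and> (t2 \<in> A \<or> d \<in> A \<or> f \<in> A)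
      \<and> (t2 \<in> A \<or> e \<in> A \<or> g \<in> A) \<and> (t3 \<in> A \<or> d \<in> A \<or> g \<in> A) \<and> (t3 \<in> A \<or> e \<in> A \<or> f \<in> A)" if "A \<in> F" for A
    using meet[OF that lines(1)] meet[OF that lines(2)] meet[OF that lines(3)] meet[OF that lines(4)]
      meet[OF that lines(5)] meet[OF that lines(6)] by auto
  \<comment> \<open>If the three points coincided, a member avoiding that point would meet all six
    pairs of outside elements, hence contain three of them and miss \<open>T\<close>.\<close>
  have notall: "\<not> (t1 = t2 \<and> t2 = t3)"
  proof
    assume eq: "t1 = t2 \<and> t2 = t3"
    obtain A where A: "A \<in> F" "t1 \<notin> A" using nocommon by blast
    have "t2 \<notin> A" "t3 \<notin> A" using A(2) eq by auto
    with hit[OF A(1)] A(2) have "(d \<in> A \<and> e \<in> A \<and> f \<in> A) \<or> (d \<in> A \<and> e \<in> A \<and> g \<in> A) \<or>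
      (d \<in> A \<and> f \<in> A \<and> g \<in> A) \<or> (e \<in> A \<and> f \<in> A \<and> g \<in> A)" by argo
    moreover have "d \<noteq> e" "d \<noteq> f" "d \<noteq> g" "e \<noteq> f" "e \<noteq> g" "f \<noteq> g" using efg(2) by simp_all
    moreover have no3: False if x: "x \<in> A" "y \<in> A" "z \<in> A" "x \<noteq> y" "x \<noteq> z" "y \<noteq> z" "x \<notin> T" "y \<notin> T" "z \<notin> T" for x y z
      using superset_eq[OF A(1) x(1-6)] meet[OF A(1) T] x(7-9) by auto
    ultimately show False
      using no3[of d e f] no3[of d e g] no3[of d f g] no3[of e f g] Qn by argo
  qed
  \<comment> \<open>For another \<open>i\<close> in \<open>T\<close>, the member through
    \<open>i\<close> and \<open>d\<close> has a single further element \<open>s\<close>. Meeting the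
    joining members that avoid \<open>d\<close> forces \<open>s\<close> to equal \<open>t1\<close>,
    \<open>t2\<close> and \<open>t3\<close> at once, contrary to \<open>notall\<close>.\<close>
  have sub: "i \<in> {t1, t2, t3}" if i: "i \<in> T" for i
  proof (rule ccontr)
    assume ni: "i \<notin> {t1, t2, t3}"
    obtain B where B: "B \<in> F" "i \<in> B" "d \<in> B" using pair_covered[of i d] i T U by blast
    have id: "i \<noteq> d" using i Qn by blast
    have "card (B - {i, d}) = 1" using B id card_eq_3[OF B(1)] fin[OF B(1)] by (simp add: card_Diff_subset)
    then obtain s where s': "B - {i, d} = {s}" by (auto simp: card_1_singleton_iff)
    have s: "u = s" if "u \<in> B" "u \<noteq> i" "u \<noteq> d" for u using that s' by blast
    have "i \<noteq> e" "i \<noteq> f" "i \<noteq> g" "t1 \<noteq> d" "t2 \<noteq> d" "t3 \<noteq> d" "t1 \<noteq> e" "t1 \<noteq> f" "t1 \<noteq> g" "t2 \<noteq> e" "t2 \<noteq> f" "t2 \<noteq> g"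
      "t3 \<noteq> e" "t3 \<noteq> f" "t3 \<noteq> g"
      using i Qn tT by auto
    moreover have "t1 \<in> B \<or> f \<in> B \<or> g \<in> B" "t2 \<in> B \<or> e \<in> B \<or> g \<in> B" "t3 \<in> B \<or> e \<in> B \<or> f \<in> B" using hit[OF B(1)] by auto
    moreover have "t1 \<noteq> i" "t2 \<noteq> i" "t3 \<noteq> i" using ni by auto
    ultimately have "t1 = s \<or> f = s \<or> g = s" "t2 = s \<or> e = s \<or> g = s" "t3 = s \<or> e = s \<or> f = s"
      "t1 \<noteq> e" "t1 \<noteq> f" "t1 \<noteq> g" "t2 \<noteq> e" "t2 \<noteq> f" "t2 \<noteq> g" "t3 \<noteq> e" "t3 \<noteq> f" "t3 \<noteq> g"
      using s efg(2) by (simp_all, blast+)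
    then show False using notall efg(2) by auto
  qed
  then have Teq: "T = {t1, t2, t3}" using tT by blast
  have dt: "distinct [t1, t2, t3]" using \<open>card T = 3\<close> unfolding Teq by (auto simp: card_insert_if split: if_splits)
  \<comment> \<open>The order of this list is chosen so that the translates of {0, 1, 3} become
    exactly the seven members found.\<close>
  define a where "a i = [t3, t1, d, t2, e, f, g] ! i" for i :: nat
  have less7: "{..<7::nat} = {0, 1, 2, 3, 4, 5, 6}" by auto
  have "distinct [t3, t1, d, t2, e, f, g]" using dt efg(2) Qn tT by auto
  then have inj: "inj_on a {..<7}" unfolding a_def by (auto simp: inj_on_def nth_eq_iff_index_eq)
  have ln: "ln 0 = {0, 1, 3}" "ln 1 = {1, 2, 4}" "ln 2 = {2, 3, 5}" "ln 3 = {3, 4, 6}" "ln 4 = {4, 5, 0}"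
    "ln 5 = {5, 6, 1}" "ln 6 = {6, 0, 2}" by (simp_all add: ln_def, (simp add: numeral_2_eq_2)?)
  have av: "a 0 = t3" "a 1 = t1" "a 2 = d" "a 3 = t2" "a 4 = e" "a 5 = f" "a 6 = g" by (simp_all add: a_def)
  have img: "(\<lambda>i. a ` ln i) ` {..<7} = {{t3, t1, t2}, {t1, d, e}, {d, t2, f}, {t2, e, g}, {e, f, t3}, {f, g, t1}, {g, t3, d}}"
    unfolding less7 by (simp only: ln av image_insert image_empty)
  have "F \<subseteq> {{t3, t1, t2}, {t1, d, e}, {d, t2, f}, {t2, e, g}, {e, f, t3}, {f, g, t1}, {g, t3, d}}" (is "_ \<subseteq> ?L")
  proof
    fix A assume A: "A \<in> F"
    have "t1 \<in> A \<or> t2 \<in> A \<or> t3 \<in> A" using meet[OF A T] Teq by auto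
    \<comment> \<open>A set that meets every line of the Fano plane contains a line.\<close>
    with hit[OF A] have "(t3 \<in> A \<and> t1 \<in> A \<and> t2 \<in> A) \<or>
      (t1 \<in> A \<and> d \<in> A \<and> e \<in> A) \<or>
      (d \<in> A \<and> t2 \<in> A \<and> f \<in> A) \<or>
      (t2 \<in> A \<and> e \<in> A \<and> g \<in> A) \<or>
      (e \<in> A \<and> f \<in> A \<and> t3 \<in> A) \<or>
      (f \<in> A \<and> g \<in> A \<and> t1 \<in> A) \<or>
      (g \<in> A \<and> t3 \<in> A \<and> d \<in> A)" by argo
    note hits = this
    have line: "A = {x, y, z}" if "x \<in> A \<and> y \<in> A \<and> z \<in> A" "distinct [x, y, z]" for x y z
      using superset_eq[OF A, of x y z] that by simp
    have dl: "distinct [t3, t1, t2]" "distinct [t1, d, e]" "distinct [d, t2, f]" "distinct [t2, e, g]" "distinct [e, f, t3]" "distinct [f, g, t1]" "distinct [g, t3, d]"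
      using \<open>distinct [t3, t1, d, t2, e, f, g]\<close> by auto
    have "A = {t3, t1, t2} \<or> A = {t1, d, e} \<or> A = {d, t2, f} \<or> A = {t2, e, g} \<or> A = {e, f, t3} \<or> A = {f, g, t1} \<or> A = {g, t3, d}"
      using hits line[OF _ dl(1)] line[OF _ dl(2)] line[OF _ dl(3)] line[OF _ dl(4)] line[OF _ dl(5)] line[OF _ dl(6)] line[OF _ dl(7)] by argo
    then show "A \<in> ?L" by simp
  qed
  moreover have "?L \<subseteq> F"
  proof -
    have "{t3, t1, t2} = {t1, t2, t3}" "{d, t2, f} = {t2, d, f}" "{e, f, t3} = {t3, e, f}" "{f, g, t1} = {t1, f, g}"
      "{g, t3, d} = {t3, d, g}" by auto
    then show ?thesis using lines T Teq by simp
  qed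
  ultimately have "F = ?L" by (rule equalityI)
  then show ?thesis using that[OF inj] img by simp
qed

end

section \<open>Counting edges at the star of a vertex\<close>

definition ll :: "nat \<Rightarrow> nat list" where
  "ll i = [i, (i + 1) mod 7, (i + 3) mod 7]"

text \<open>Table of the intersection points of two lines; the zeros on the diagonal are
  fillers.\<close>

definition pt_of :: "nat \<Rightarrow> nat \<Rightarrow> nat" where
  "pt_of i j = [[0, 1, 3, 3, 0, 1, 0],
    [1, 0, 2, 4, 4, 1, 2],
    [3, 2, 0, 3, 5, 5, 2],
    [3, 4, 3, 0, 4, 6, 6],
    [0, 4, 5, 4, 0, 5, 0],
    [1, 1, 5, 6, 5, 0, 6],
    [0, 2, 2, 6, 0, 6, 0]] ! i ! j"

text \<open>The index of the colour of the edge through \<open>v\<close>, the representative of line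
  \<open>i\<close> and a vertex of line \<open>m\<close>. For different lines it is their common
  point; for \<open>i = m\<close> it is some point \<open>r\<close> of the line.\<close>

definition col_of :: "nat \<Rightarrow> nat \<Rightarrow> nat \<Rightarrow> nat" where
  "col_of m r i = (if i = m then r else pt_of i m)"

lemma ln_ll: "ln i = set (ll i)"
  unfolding ln_def ll_def by simp

lemma pt_of_unique: "\<lbrakk>i < 7; j < 7; i \<noteq> j; p \<in> ln i; p \<in> ln j\<rbrakk> \<Longrightarrow> p = pt_of i j"
proof -
  assume a: "i < 7" "j < 7" "i \<noteq> j" "p \<in> ln i" "p \<in> ln j"
  have "list_all (\<lambda>i. list_all (\<lambda>j. i = j \<or> list_all (\<lambda>p. p \<notin> set (ll j) \<or> p = pt_of i j) (ll i)) [0..<7]) [0..<7]"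
    by code_simp
  then have "i = j \<or> (\<forall>p \<in> set (ll i). p \<notin> set (ll j) \<or> p = pt_of i j)"
    unfolding list_all_iff using a(1,2) by (metis atLeastLessThan_iff atLeastLessThan_upt le0)
  with a(3-5) show ?thesis unfolding ln_ll by blast
qed

lemma ln_inj: "\<lbrakk>i < 7; j < 7; ln i = ln j\<rbrakk> \<Longrightarrow> i = j"
proof -
  assume a: "i < 7" "j < 7" "ln i = ln j"
  have "list_all (\<lambda>i. list_all (\<lambda>j. i = j \<or> \<not> list_all (\<lambda>p. p \<in> set (ll j)) (ll i)) [0..<7]) [0..<7]"
    by code_simp
  then have "i = j \<or> \<not> (\<forall>p \<in> set (ll i). p \<in> set (ll j))"
    unfolding list_all_iff using a(1,2) by (metis atLeastLessThan_iff atLeastLessThan_upt le0)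
  with a(3) show ?thesis unfolding ln_ll by blast
qed

text \<open>Each of the three points of line \<open>m\<close> lies on two of the other six lines,
  giving 3 * 2 = 6 ordered pairs of equal index. Line \<open>m\<close> itself, with index
  \<open>r\<close>, joins one of these classes and adds 2 + 2 pairs.\<close>

lemma card_col_of:
  assumes "m < 7" "r \<in> ln m"
  shows "card {(i, j). i < 7 \<and> j < 7 \<and> i \<noteq> j \<and> col_of m r i = col_of m r j} \<le> 10"
    and "card {(i, j). i < 7 \<and> j < 7 \<and> i \<noteq> j \<and> i \<noteq> m \<and> j \<noteq> m \<and> col_of m r i = col_of m r j} \<le> 6"
proof -
  let ?P = "List.product [0..<7] [0..<7]"
  have le: "card {(i, j). i < 7 \<and> j < 7 \<and> P i j} \<le> length (filter (\<lambda>(i, j). P i j) ?P)" for P :: "nat \<Rightarrow> nat \<Rightarrow> bool"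
  proof -
    have "{(i, j). i < 7 \<and> j < 7 \<and> P i j} = set (filter (\<lambda>(i, j). P i j) ?P)" by auto
    then show ?thesis using card_length by metis
  qed
  have "list_all (\<lambda>m. list_all (\<lambda>r. length (filter (\<lambda>(i, j). i \<noteq> j \<and> col_of m r i = col_of m r j) ?P) \<le> 10
      \<and> length (filter (\<lambda>(i, j). i \<noteq> j \<and> i \<noteq> m \<and> j \<noteq> m \<and> col_of m r i = col_of m r j) ?P) \<le> 6) (ll m)) [0..<7]"
    by code_simp
  then have c: "length (filter (\<lambda>(i, j). i \<noteq> j \<and> col_of m r i = col_of m r j) ?P) \<le> 10"
    "length (filter (\<lambda>(i, j). i \<noteq> j \<and> i \<noteq> m \<and> j \<noteq> m \<and> col_of m r i = col_of m r j) ?P) \<le> 6"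
    using assms unfolding list_all_iff ln_ll by auto
  show "card {(i, j). i < 7 \<and> j < 7 \<and> i \<noteq> j \<and> col_of m r i = col_of m r j} \<le> 10"
    by (rule order_trans[OF le c(1)])
  show "card {(i, j). i < 7 \<and> j < 7 \<and> i \<noteq> j \<and> i \<noteq> m \<and> j \<noteq> m \<and> col_of m r i = col_of m r j} \<le> 6"
    by (rule order_trans[OF le c(2)])
qed

context rich_colouring
begin

lemma card_colours:
  assumes "v \<in> V" "x \<in> V" "x \<noteq> v"
  shows "card (colours v x) \<le> 3"
proof (rule ccontr)
  assume "\<not> ?thesis"
  then have "4 \<le> card (colours v x)" by simp
  then obtain I where I: "I \<subseteq> colours v x" "card I = 4" by (meson obtain_subset_with_card_n)
  then obtain i I3 where "I = insert i I3" "i \<notin> I3" "card I3 = 3" using card_Suc_eq[of I 3] by auto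
  moreover from this obtain j l m where "I3 = {j, l, m}" "distinct [j, l, m]" by (auto simp: card_3_iff)
  ultimately have ijlm: "distinct [i, j, l, m]" "i \<in> colours v x" "j \<in> colours v x" "l \<in> colours v x" "m \<in> colours v x"
    using I(1) by auto
  then obtain p q r s where p: "p \<in> V - {v, x}" "i = c v x p" and q: "q \<in> V - {v, x}" "j = c v x q"
    and r: "r \<in> V - {v, x}" "l = c v x r" and s: "s \<in> V - {v, x}" "m = c v x s"
    unfolding colours_def by blast
  have "distinct [v, x, p, q, r, s]" "{v, x, p, q, r, s} \<subseteq> V"
    using p q r s ijlm(1) assms by auto
  with card_colours_le ijlm(1) show False unfolding p q r s by blast
qed

text \<open>A vertex \<open>w\<close> in \<open>N v x y\<close> gives \<open>v x w\<close> and
  \<open>v y w\<close> one colour, and the plane dictates which representatives can have that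
  property. Hence few of the edges spanned by \<open>v\<close> and the representatives can have
  \<open>w\<close> in their set \<open>N\<close>, too few for the lower bound \<open>k\<close> on
  the size of each.\<close>

lemma star_not_fano:
  assumes v: "v \<in> V" and inj: "inj_on a {..<7::nat}"
    and fano: "colours v ` (V - {v}) = (\<lambda>i. a ` ln i) ` {..<7}"
  shows False
proof -
  have ln7: "ln i \<subseteq> {..<7}" if "i < 7" for i using that unfolding ln_def by auto
  define \<rho> where "\<rho> i = (SOME x. x \<in> V - {v} \<and> colours v x = a ` ln i)" for i
  have \<rho>12: "\<rho> i \<in> V - {v} \<and> colours v (\<rho> i) = a ` ln i" if "i < 7" for i
  proof -
    have "a ` ln i \<in> (\<lambda>i. a ` ln i) ` {..<7}" using that by simp
    then have "a ` ln i \<in> colours v ` (V - {v})" unfolding fano .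
    then have "\<exists>x. x \<in> V - {v} \<and> colours v x = a ` ln i" by blast
    then show ?thesis unfolding \<rho>_def by (rule someI_ex)
  qed
  have \<rho>: "\<rho> i \<in> V - {v}" "colours v (\<rho> i) = a ` ln i" if "i < 7" for i
    using \<rho>12[OF that] by auto
  have line_inj: "i = j" if "i < 7" "j < 7" "a ` ln i = a ` ln j" for i j
    using that(3) ln_inj[OF that(1,2)] inj_on_image_eq_iff[OF inj ln7[OF that(1)] ln7[OF that(2)]] by simp
  have \<rho>_inj: "inj_on \<rho> {..<7}" 
  proof (rule inj_onI)
    fix i j :: nat assume "i \<in> {..<7}" "j \<in> {..<7}" "\<rho> i = \<rho> j"
    then show "i = j" using line_inj[of i j] \<rho>(2)[of i] \<rho>(2)[of j] by simp
  qed
  \<comment> \<open>Ordered pairs count each of the 21 edges twice, which leaves both sides of the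
    comparison with the same factor.\<close>
  define I where "I = {(i, j). i < (7::nat) \<and> j < 7 \<and> i \<noteq> j}"
  define f where "f = (\<lambda>(i, j). N v (\<rho> i) (\<rho> j))"
  define M where "M w = {e \<in> I. w \<in> f e}" for w
  have finI: "finite I" unfolding I_def by (rule finite_subset[of _ "{..<7} \<times> {..<7}"]) auto
  have "I = set (filter (\<lambda>(i, j). i \<noteq> j) (List.product [0..<7] [0..<7]))" unfolding I_def by auto
  also have "card \<dots> = length (filter (\<lambda>(i, j). i \<noteq> j) (List.product [0..<7] [0..<7::nat]))"
    by (rule distinct_card) (simp add: distinct_product)
  also have "\<dots> = 42" by code_simp
  finally have cI: "card I = 42" .
  have bound: "card (M w) \<le> (if w \<in> \<rho> ` {..<7} then 6 else 10)" if w: "w \<in> V - {v}" for w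
  proof -
    from w have "colours v w \<in> colours v ` (V - {v})" by (rule imageI)
    then have "colours v w \<in> (\<lambda>i. a ` ln i) ` {..<7}" unfolding fano .
    then obtain m where m: "m < 7" "colours v w = a ` ln m" by auto
    have "\<exists>p \<in> ln i \<inter> ln m. c v (\<rho> i) w = a p" if i: "i < 7" "w \<noteq> \<rho> i" for i
    proof -
      have "c v (\<rho> i) w \<in> a ` ln i" using colours_mem[of w v "\<rho> i"] w i \<rho>[OF i(1)] by auto
      moreover have "c v (\<rho> i) w \<in> a ` ln m"
        using colours_mem[of "\<rho> i" v w] w i \<rho>[OF i(1)] m sym(2)[of v w "\<rho> i"] by auto
      ultimately have "c v (\<rho> i) w \<in> a ` (ln i \<inter> ln m)"
        using inj_on_image_Int[OF inj ln7[OF i(1)] ln7[OF m(1)]] by simp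
      then show ?thesis by (simp add: image_iff)
    qed
    then have "\<forall>i. \<exists>p. i < 7 \<longrightarrow> w \<noteq> \<rho> i \<longrightarrow> p \<in> ln i \<inter> ln m \<and> c v (\<rho> i) w = a p" by blast
    from choice[OF this] obtain \<phi> where \<phi>': "\<forall>i. i < 7 \<longrightarrow> w \<noteq> \<rho> i \<longrightarrow> \<phi> i \<in> ln i \<inter> ln m \<and> c v (\<rho> i) w = a (\<phi> i)"
      by blast
    have \<phi>: "\<phi> i \<in> ln i \<inter> ln m \<and> c v (\<rho> i) w = a (\<phi> i)" if "i < 7" "w \<noteq> \<rho> i" for i
      using \<phi>' that by blast
    \<comment> \<open>If \<open>w\<close> is itself the representative of its line there is no edge
      to read a colour from; the index \<open>m\<close> serves as a default because it lies on
      \<open>ln m\<close>.\<close>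
    define r where "r = (if w = \<rho> m then m else \<phi> m)"
    have r: "r \<in> ln m" unfolding r_def using \<phi>[OF m(1)] by (auto simp: ln_def)
    have col: "\<phi> i = col_of m r i" if "i < 7" "w \<noteq> \<rho> i" for i
      using pt_of_unique[of i m "\<phi> i"] \<phi>[OF that] that m(1) unfolding col_of_def r_def by auto
    have sub: "i < 7 \<and> j < 7 \<and> i \<noteq> j \<and> w \<noteq> \<rho> i \<and> w \<noteq> \<rho> j \<and> col_of m r i = col_of m r j" if "(i, j) \<in> M w" for i j
    proof -
      from that have ij: "i < 7" "j < 7" "i \<noteq> j" and wN: "w \<in> N v (\<rho> i) (\<rho> j)" unfolding M_def I_def f_def by auto
      then have ne: "w \<noteq> \<rho> i" "w \<noteq> \<rho> j" "c v (\<rho> i) w = c v (\<rho> j) w" unfolding N_iff by auto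
      then have "a (\<phi> i) = a (\<phi> j)" using \<phi>[of i] \<phi>[of j] ij by simp
      moreover have "\<phi> i \<in> {..<7}" "\<phi> j \<in> {..<7}" using \<phi>[of i] \<phi>[of j] ij ne ln7[OF m(1)] by auto
      ultimately have "\<phi> i = \<phi> j" using inj by (meson inj_onD)
      then show ?thesis using ij ne col[of i] col[of j] by simp
    qed
    have fin: "finite {(i, j). i < (7::nat) \<and> j < (7::nat) \<and> P i j}" for P
      by (rule finite_subset[of _ "{..<7} \<times> {..<7}"]) auto
    show ?thesis
    proof (cases "w \<in> \<rho> ` {..<7}")
      case True
      then obtain l where l: "l < 7" "w = \<rho> l" by auto
      \<comment> \<open>A representative lies in no set \<open>N\<close> of an edge through itself,
        so the pairs containing its own line drop out and the bound ten improves to six.\<close>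
      then have "l = m" using line_inj m \<rho>(2)[of l] by auto
      with l sub have "M w \<subseteq> {(i, j). i < 7 \<and> j < 7 \<and> i \<noteq> j \<and> i \<noteq> m \<and> j \<noteq> m \<and> col_of m r i = col_of m r j}" by auto
      from card_mono[OF fin this] card_col_of(2)[OF m(1) r] True show ?thesis by simp
    next
      case False
      have "M w \<subseteq> {(i, j). i < 7 \<and> j < 7 \<and> i \<noteq> j \<and> col_of m r i = col_of m r j}" using sub by auto
      from card_mono[OF fin this] card_col_of(1)[OF m(1) r] False show ?thesis by simp
    qed
  qed
  have "42 * k = (\<Sum>e\<in>I. k)" using cI by simp
  also have "\<dots> \<le> (\<Sum>e\<in>I. card (f e))"
  proof (rule sum_mono)
    fix e assume "e \<in> I"
    then obtain i j where "e = (i, j)" "i < 7" "j < 7" "i \<noteq> j" unfolding I_def by auto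
    moreover from this have "\<rho> i \<noteq> \<rho> j" using \<rho>_inj by (auto dest: inj_onD)
    ultimately show "k \<le> card (f e)" unfolding f_def using v \<rho>(1)[of i] \<rho>(1)[of j] by (auto intro!: card_N)
  qed
  also have "\<dots> = (\<Sum>w\<in>V. card (M w))"
    unfolding M_def by (rule card_sum_eq[OF finite_V _ finI]) (auto simp: f_def N_iff)
  also have "\<dots> = (\<Sum>w\<in>V - {v}. card (M w))"
  proof -
    have "M v = {}" unfolding M_def f_def by (auto simp: N_iff)
    then show ?thesis using v finite_V by (simp add: sum.remove)
  qed
  also have "\<dots> \<le> (\<Sum>w\<in>V - {v}. if w \<in> \<rho> ` {..<7} then 6 else 10)"
    by (rule sum_mono) (use bound in blast)
  also have "\<dots> = (\<Sum>w\<in>(V - {v}) - \<rho> ` {..<7}. 10) + (\<Sum>w\<in>\<rho> ` {..<7}. 6)"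
  proof -
    have "\<rho> ` {..<7} \<subseteq> V - {v}" using \<rho>(1) by auto
    then have "(\<Sum>w\<in>V - {v}. if w \<in> \<rho> ` {..<7} then 6 else 10::nat)
      = (\<Sum>w\<in>(V - {v}) - \<rho> ` {..<7}. if w \<in> \<rho> ` {..<7} then 6 else 10) + (\<Sum>w\<in>\<rho> ` {..<7}. if w \<in> \<rho> ` {..<7} then 6 else 10)"
      using finite_V by (intro sum.subset_diff) auto
    also have "(\<Sum>w\<in>(V - {v}) - \<rho> ` {..<7}. if w \<in> \<rho> ` {..<7} then 6 else 10::nat) = (\<Sum>w\<in>(V - {v}) - \<rho> ` {..<7}. 10)"
      by (rule sum.cong) auto
    also have "(\<Sum>w\<in>\<rho> ` {..<7}. if w \<in> \<rho> ` {..<7} then 6 else 10::nat) = (\<Sum>w\<in>\<rho> ` {..<7}. 6)"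
      by (rule sum.cong) auto
    finally show ?thesis .
  qed
  \<comment> \<open>Apart from \<open>v\<close> there are n - 8 vertices that are not
    representatives. The right side is 10n - 38, at most 40k - 8, and this is less than 42k.\<close>
  finally have "42 * k \<le> 10 * card ((V - {v}) - \<rho> ` {..<7}) + 6 * card (\<rho> ` {..<7})" by simp
  moreover have R: "card (\<rho> ` {..<7}) = 7" "\<rho> ` {..<7} \<subseteq> V - {v}" using card_image[OF \<rho>_inj] \<rho>(1) by auto
  moreover have "card ((V - {v}) - \<rho> ` {..<7}) = card (V - {v}) - 7"
    using R finite_V by (metis card_Diff_subset finite_imageI finite_lessThan)
  moreover have "7 \<le> card (V - {v})" using R finite_V by (metis card_mono finite_Diff)
  moreover have "card (V - {v}) = card V - 1" using v finite_V by simp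
  ultimately show False using card_V by linarith
qed

text \<open>The sets \<open>colours v x\<close> form a meeting family as soon as seven colours
  occur: \<open>colours v x\<close> and \<open>colours v y\<close> share the colour of
  \<open>v x y\<close>, and \<open>extend_colour\<close> supplies the joining property. The Fano
  structure that results is impossible by \<open>star_not_fano\<close>.\<close>

lemma card_star_le:
  assumes v: "v \<in> V" and V3: "3 \<le> card V" and nc: "\<And>i. \<exists>x \<in> V - {v}. i \<notin> colours v x"
  shows "card (\<Union>x\<in>V - {v}. colours v x) \<le> 6"
proof (rule ccontr)
  assume big: "\<not> ?thesis"
  have fin: "finite (colours v x)" for x unfolding colours_def using finite_V by simp
  interpret meeting_family "colours v ` (V - {v})"
  proof
    fix M assume "M \<in> colours v ` (V - {v})"
    then show "finite M" "card M \<le> 3" using fin card_colours v by auto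
  next
    fix M L assume "M \<in> colours v ` (V - {v})" "L \<in> colours v ` (V - {v})"
    then obtain x y where xy: "x \<in> V - {v}" "y \<in> V - {v}" "M = colours v x" "L = colours v y" by auto
    show "M \<inter> L \<noteq> {}"
    proof (cases "x = y")
      case True
      have "\<not> V \<subseteq> {v, x}" using V3 card_mono[of "{v, x}" V] by (auto simp: card_insert_if split: if_splits)
      then show ?thesis unfolding xy True by (auto simp: colours_def True)
    next
      case False
      then show ?thesis using colours_mem[of y v x] colours_mem[of x v y] xy sym(2)[of v x y] by auto
    qed
  next
    fix M i h assume M: "M \<in> colours v ` (V - {v})" "card M = 3" "i \<in> M" "h \<in> \<Union> (colours v ` (V - {v}))"
    then obtain x where x: "x \<in> V - {v}" "M = colours v x" by auto
    from M(4) obtain p q where pq: "p \<in> V - {v}" "q \<in> V - {v, p}" "c v p q = h" unfolding colours_def by auto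
    show "\<exists>L \<in> colours v ` (V - {v}). i \<in> L \<and> h \<in> L"
    \<comment> \<open>If the set already contains \<open>h\<close>, it is its own witness;
      \<open>extend_colour\<close> is needed only for a colour from elsewhere.\<close>
    proof (cases "h \<in> M")
      case False
      then show ?thesis using extend_colour[OF v _ _ _ _ _ pq, of x i] x M by auto
    qed (use M in blast)
  qed (use nc big fin finite_V in auto)
  show False using fano star_not_fano[OF v] by metis
qed

end

section \<open>Seven-point colourings and their symmetry\<close>

text \<open>Points and colours share one type: a triple is coloured by a point that its colour
  misses, hence the clause that the colour lies outside the triple. The last three clauses are the
  local exclusions.\<close>

definition admissible :: "('p \<Rightarrow> 'p \<Rightarrow> 'p \<Rightarrow> 'p) \<Rightarrow> bool" where
  "admissible d \<longleftrightarrow>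
    (\<forall>x y z. d x y z = d y x z \<and> d x y z = d x z y) \<and>
    (\<forall>x y z. distinct [x, y, z] \<longrightarrow> d x y z \<notin> {x, y, z}) \<and>
    (\<forall>x y z w. distinct [x, y, z, w] \<longrightarrow> \<not> distinct [d x y z, d x y w, d x z w, d y z w]) \<and>
    (\<forall>x y p q r s. distinct [x, y, p, q, r, s] \<longrightarrow> \<not> distinct [d x y p, d x y q, d x y r, d x y s]) \<and>
    (\<forall>v p q r s. distinct [v, p, q, r, s] \<longrightarrow>
      \<not> (\<forall>i \<in> {d v p q}. \<forall>j \<in> {d v p r, d v p s}. \<forall>k \<in> {d v q r, d v r s}.
         \<forall>l \<in> {d v q s}. \<forall>m \<in> {d p r s, d q r s}. distinct [i, j, k, l, m]))"

lemma admissible_sym: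
  assumes "admissible d"
  shows "d x y z = d y x z" "d x y z = d x z y"
  using assms[unfolded admissible_def, THEN conjunct1, rule_format, of x y z] by auto

text \<open>A permutation acts on triples and colours simultaneously, so every refuted list of
  literals refutes its whole orbit. All clauses speak only of equality, which a bijection
  preserves.\<close>

lemma admissible_conj:
  fixes p :: "'p \<Rightarrow> 'p"
  assumes d: "admissible d" and p: "bij p"
  shows "admissible (\<lambda>x y z. inv p (d (p x) (p y) (p z)))"
proof -
  have i: "inv p u = inv p w \<longleftrightarrow> u = w" for u w
    using p by (metis bij_def surj_f_inv_f)
  have j: "p x = p y \<longleftrightarrow> x = y" for x y
    using p by (metis bij_def inj_eq)
  have k: "inv p u = x \<longleftrightarrow> u = p x" for u x
    using p by (metis bij_inv_eq_iff)
  have ds: "distinct (map p us) = distinct us" for us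
    using j by (auto simp: distinct_map inj_on_def)
  note D = d[unfolded admissible_def]
  note sym = admissible_sym[OF d]
  show ?thesis unfolding admissible_def
  proof (intro conjI allI impI)
    fix x y z :: 'p
    show "inv p (d (p x) (p y) (p z)) = inv p (d (p y) (p x) (p z))"
      "inv p (d (p x) (p y) (p z)) = inv p (d (p x) (p z) (p y))"
      unfolding i by (fact sym)+
  next
    fix x y z :: 'p assume "distinct [x, y, z]"
    then have "distinct [p x, p y, p z]" using ds[of "[x,y,z]"] by simp
    with D have "d (p x) (p y) (p z) \<notin> {p x, p y, p z}" by blast
    then show "inv p (d (p x) (p y) (p z)) \<notin> {x, y, z}" using k by auto
  next
    fix x y z w :: 'p assume "distinct [x, y, z, w]"
    then have "distinct [p x, p y, p z, p w]" using ds[of "[x,y,z,w]"] by simp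
    with D have "\<not> distinct [d (p x) (p y) (p z), d (p x) (p y) (p w), d (p x) (p z) (p w), d (p y) (p z) (p w)]"
      by blast
    then show "\<not> distinct [inv p (d (p x) (p y) (p z)), inv p (d (p x) (p y) (p w)),
        inv p (d (p x) (p z) (p w)), inv p (d (p y) (p z) (p w))]"
      by (simp add: i)
  next
    fix x y q r s t :: 'p assume "distinct [x, y, q, r, s, t]"
    then have "distinct [p x, p y, p q, p r, p s, p t]" using ds[of "[x,y,q,r,s,t]"] by simp
    with D have "\<not> distinct [d (p x) (p y) (p q), d (p x) (p y) (p r), d (p x) (p y) (p s), d (p x) (p y) (p t)]"
      by blast
    then show "\<not> distinct [inv p (d (p x) (p y) (p q)), inv p (d (p x) (p y) (p r)),
        inv p (d (p x) (p y) (p s)), inv p (d (p x) (p y) (p t))]"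
      by (simp add: i)
  next
    fix v q r s t :: 'p assume "distinct [v, q, r, s, t]"
    then have "distinct [p v, p q, p r, p s, p t]" using ds[of "[v,q,r,s,t]"] by simp
    then have "\<not> (\<forall>i \<in> {d (p v) (p q) (p r)}. \<forall>j \<in> {d (p v) (p q) (p s), d (p v) (p q) (p t)}.
         \<forall>k \<in> {d (p v) (p r) (p s), d (p v) (p s) (p t)}.
         \<forall>l \<in> {d (p v) (p r) (p t)}. \<forall>m \<in> {d (p q) (p s) (p t), d (p r) (p s) (p t)}. distinct [i, j, k, l, m])"
      using D by blast
    then show "\<not> (\<forall>i \<in> {inv p (d (p v) (p q) (p r))}. \<forall>j \<in> {inv p (d (p v) (p q) (p s)), inv p (d (p v) (p q) (p t))}.
         \<forall>k \<in> {inv p (d (p v) (p r) (p s)), inv p (d (p v) (p s) (p t))}.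
         \<forall>l \<in> {inv p (d (p v) (p r) (p t))}. \<forall>m \<in> {inv p (d (p q) (p s) (p t)), inv p (d (p r) (p s) (p t))}. distinct [i, j, k, l, m])"
      by (simp add: i)
  qed
qed

section \<open>A checker for refutation trees\<close>

datatype pt = A | B | C | D | E | F | G

type_synonym lit = "pt \<times> pt \<times> pt \<times> pt"

lemma UNIV_pt: "UNIV = {A, B, C, D, E, F, G}"
proof -
  have "x \<in> {A, B, C, D, E, F, G}" for x by (cases x) auto
  then show ?thesis by blast
qed

text \<open>A literal \<open>(x, y, z, w)\<close> says that the triple \<open>xyz\<close>, listed in increasing order, has colour \<open>w\<close>.\<close>

definition nogood :: "lit list \<Rightarrow> bool" where
  "nogood ls \<longleftrightarrow> (\<forall>d. admissible d \<longrightarrow> \<not> (\<forall>(x, y, z, w) \<in> set ls. d x y z = w))"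

text \<open>
  \<open>Sp\<close> branches on the four possible colours of a triple, in increasing order.  The leaves cite an
  earlier refuted literal list moved by a permutation of the points (\<open>Us\<close>), a rainbow four-set (\<open>Qd\<close>),
  a pair with four colours (\<open>Hx\<close>) or the five-point pattern (\<open>Xx\<close>).
\<close>

datatype tree =
    Sp pt pt pt tree tree tree tree
  | Us pt pt pt pt pt pt pt pt pt pt
  | Qd pt pt pt pt
  | Hx pt pt pt pt pt pt
  | Xx pt pt pt pt pt

fun lt :: "pt \<Rightarrow> pt \<Rightarrow> bool" where
  "lt A x = (case x of A \<Rightarrow> False | _ \<Rightarrow> True)"
| "lt B x = (case x of A \<Rightarrow> False | B \<Rightarrow> False | _ \<Rightarrow> True)"
| "lt C x = (case x of D \<Rightarrow> True | E \<Rightarrow> True | F \<Rightarrow> True | G \<Rightarrow> True | _ \<Rightarrow> False)"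
| "lt D x = (case x of E \<Rightarrow> True | F \<Rightarrow> True | G \<Rightarrow> True | _ \<Rightarrow> False)"
| "lt E x = (case x of F \<Rightarrow> True | G \<Rightarrow> True | _ \<Rightarrow> False)"
| "lt F x = (case x of G \<Rightarrow> True | _ \<Rightarrow> False)"
| "lt G x = False"

primrec sel :: "bool \<Rightarrow> 'b \<Rightarrow> 'b \<Rightarrow> 'b" where
  "sel True x y = x"
| "sel False x y = y"

definition srt :: "pt \<Rightarrow> pt \<Rightarrow> pt \<Rightarrow> pt \<times> pt \<times> pt" where
  "srt x y z = sel (lt x y)
     (sel (lt y z) (x, y, z) (sel (lt x z) (x, z, y) (z, x, y)))
     (sel (lt x z) (y, x, z) (sel (lt y z) (y, z, x) (z, y, x)))"

fun look3 :: "lit list \<Rightarrow> pt \<times> pt \<times> pt \<Rightarrow> pt option" where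
  "look3 [] t = None"
| "look3 ((x, y, z, w) # st) t = sel ((x, y, z) = t) (Some w) (look3 st t)"

definition look :: "lit list \<Rightarrow> pt \<Rightarrow> pt \<Rightarrow> pt \<Rightarrow> pt option" where
  "look st x y z = look3 st (srt x y z)"

text \<open>Colours not yet fixed on the branch count as possibly equal, so a leaf is accepted only
  on the evidence of known colours.\<close>

fun ne :: "pt option \<Rightarrow> pt option \<Rightarrow> bool" where
  "ne (Some x) (Some y) = (x \<noteq> y)"
| "ne _ _ = False"

fun nes :: "pt option list \<Rightarrow> pt option list \<Rightarrow> bool" where
  "nes xs ys = list_all (\<lambda>x. list_all (ne x) ys) xs"

primrec pairs :: "pt option list \<Rightarrow> bool" where
  "pairs [] = True"
| "pairs (x # xs) = (list_all (ne x) xs \<and> pairs xs)"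

primrec perm :: "pt \<Rightarrow> pt \<Rightarrow> pt \<Rightarrow> pt \<Rightarrow> pt \<Rightarrow> pt \<Rightarrow> pt \<Rightarrow> pt \<Rightarrow> pt" where
  "perm a b c d e f g A = a"
| "perm a b c d e f g B = b"
| "perm a b c d e f g C = c"
| "perm a b c d e f g D = d"
| "perm a b c d e f g E = e"
| "perm a b c d e f g F = f"
| "perm a b c d e f g G = g"

text \<open>The possible colours of a triple: exactly four of the seven points remain, which is why
  \<open>Sp\<close> has four subtrees.\<close>

definition cols :: "pt \<Rightarrow> pt \<Rightarrow> pt \<Rightarrow> pt list" where
  "cols x y z = filter (\<lambda>w. w \<noteq> x \<and> w \<noteq> y \<and> w \<noteq> z) [A, B, C, D, E, F, G]"

text \<open>The permutation carries the cited list into the names of the current branch, moving the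
  triple and its colour alike; \<open>look\<close> restores the increasing order.\<close>

fun lit_in :: "(pt \<Rightarrow> pt) \<Rightarrow> lit list \<Rightarrow> lit \<Rightarrow> bool" where
  "lit_in p st (x, y, z, w) = (look st (p x) (p y) (p z) = Some (p w))"

fun nth1 :: "'b list \<Rightarrow> 'b" where "nth1 (a # _) = a"
fun nth2 :: "'b list \<Rightarrow> 'b" where "nth2 (_ # a # _) = a"
fun nth3 :: "'b list \<Rightarrow> 'b" where "nth3 (_ # _ # a # _) = a"
fun nth4 :: "'b list \<Rightarrow> 'b" where "nth4 (_ # _ # _ # a # _) = a"

text \<open>Refuted lists are named by three points. A tree may cite only lists with a
  lexicographically smaller name, which excludes circular refutations.\<close>

definition lex :: "pt \<Rightarrow> pt \<Rightarrow> pt \<Rightarrow> pt \<Rightarrow> pt \<Rightarrow> pt \<Rightarrow> bool" where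
  "lex x y z x' y' z' \<longleftrightarrow> lt x x' \<or> x = x' \<and> (lt y y' \<or> y = y' \<and> lt z z')"

context
  fixes rule :: "pt \<Rightarrow> pt \<Rightarrow> pt \<Rightarrow> lit list"
begin

text \<open>The points \<open>i j k\<close> name the list under refutation. For \<open>Xx\<close>
  each use of \<open>nes\<close> separates one colour class of the pattern from all later classes;
  colours within a class may agree.\<close>

primrec ok :: "pt \<Rightarrow> pt \<Rightarrow> pt \<Rightarrow> tree \<Rightarrow> lit list \<Rightarrow> bool" where
  "ok i j k (Sp x y z t1 t2 t3 t4) st \<longleftrightarrow> lt x y \<and> lt y z
     \<and> ok i j k t1 ((x, y, z, nth1 (cols x y z)) # st)
     \<and> ok i j k t2 ((x, y, z, nth2 (cols x y z)) # st)
     \<and> ok i j k t3 ((x, y, z, nth3 (cols x y z)) # st)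
     \<and> ok i j k t4 ((x, y, z, nth4 (cols x y z)) # st)"
| "ok i j k (Us x y z a b c d e f g) st \<longleftrightarrow> lex x y z i j k \<and> distinct [a, b, c, d, e, f, g]
     \<and> list_all (lit_in (perm a b c d e f g) st) (rule x y z)"
| "ok i j k (Qd x y z w) st \<longleftrightarrow> distinct [x, y, z, w]
     \<and> pairs [look st x y z, look st x y w, look st x z w, look st y z w]"
| "ok i j k (Hx x y p q r s) st \<longleftrightarrow> distinct [x, y, p, q, r, s]
     \<and> pairs [look st x y p, look st x y q, look st x y r, look st x y s]"
| "ok i j k (Xx v p q r s) st \<longleftrightarrow> distinct [v, p, q, r, s]
     \<and> nes [look st v p q] [look st v p r, look st v p s, look st v q r, look st v r s,
          look st v q s, look st p r s, look st q r s]
     \<and> nes [look st v p r, look st v p s] [look st v q r, look st v r s,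
          look st v q s, look st p r s, look st q r s]
     \<and> nes [look st v q r, look st v r s] [look st v q s, look st p r s, look st q r s]
     \<and> nes [look st v q s] [look st p r s, look st q r s]"

end

lemma sel_if: "sel b x y = (if b then x else y)"
  by (cases b) simp_all

lemma look3_Some:
  assumes "look3 st (x, y, z) = Some w"
  shows "(x, y, z, w) \<in> set st"
  using assms
proof (induction st)
  case (Cons l st)
  obtain x' y' z' w' where l: "l = (x', y', z', w')" by (cases l) auto
  show ?case using Cons unfolding l by (simp add: sel_if split: if_splits)
qed simp

text \<open>Literals are stored for increasing triples only; the symmetry of \<open>d\<close> makes
  the value found after sorting valid for the triple in any order.\<close>

lemma look_Some:
  assumes d: "admissible d" and st: "\<forall>(x, y, z, w) \<in> set st. d x y z = w"
    and l: "look st x y z = Some w"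
  shows "d x y z = w"
proof -
  note sym = admissible_sym[OF d]
  have s: "d x z y = d x y z" "d y x z = d x y z" "d y z x = d x y z" "d z x y = d x y z" "d z y x = d x y z"
    for x y z
    by (rule sym(2)[of x z y] sym(1)[of y x z] trans[OF sym(2)[of y z x] sym(1)[of y x z]]
        trans[OF sym(1)[of z x y] sym(2)[of x z y]]
        trans[OF sym(2)[of z y x] trans[OF sym(1)[of z x y] sym(2)[of x z y]]])+
  obtain x' y' z' where e: "srt x y z = (x', y', z')" by (cases "srt x y z") auto
  from l e have "look3 st (x', y', z') = Some w" unfolding look_def by simp
  from bspec[OF st look3_Some[OF this]] have "d x' y' z' = w" by simp
  moreover have "d x y z = d x' y' z'"
    using e unfolding srt_def sel_if
    by (auto split: if_splits intro: s)
  ultimately show ?thesis by simp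
qed

lemma ne_iff: "ne a b \<longleftrightarrow> (\<exists>x y. a = Some x \<and> b = Some y \<and> x \<noteq> y)"
  by (cases a; cases b) auto

lemma ne_look:
  assumes "admissible d" "\<forall>(x, y, z, w) \<in> set st. d x y z = w"
    and "ne (look st x y z) (look st x' y' z')"
  shows "d x y z \<noteq> d x' y' z'"
  using look_Some[OF assms(1,2)] assms(3) unfolding ne_iff by metis

text \<open>Every node is a sound inference about an arbitrary admissible \<open>d\<close> that
  agrees with the literals of the branch; the cited lists are assumed refuted, to be discharged
  later by induction on names.\<close>

lemma ok_nogood:
  assumes "ok rule i j k t st"
    and "\<And>x y z. lex x y z i j k \<Longrightarrow> nogood (rule x y z)"
  shows "nogood st"
  using assms(1)
proof (induction t arbitrary: st)
  case (Sp x y z t1 t2 t3 t4)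
  show ?case unfolding nogood_def
  proof (intro allI impI notI)
    fix d assume d: "admissible d" and h: "\<forall>(x, y, z, w) \<in> set st. d x y z = w"
    have "lt x y" "lt y z" using Sp.prems by auto
    then have dis: "distinct [x, y, z]" and len: "length (cols x y z) = 4"
      by (cases x; cases y; cases z; simp add: cols_def)+
    then have "d x y z \<in> set (cols x y z)"
    proof -
      have "d x y z \<notin> {x, y, z}" using d dis unfolding admissible_def by blast
      moreover have "d x y z \<in> {A, B, C, D, E, F, G}" using UNIV_pt by blast
      ultimately show ?thesis unfolding cols_def by auto
    qed
    moreover obtain a b e f where c: "cols x y z = [a, b, e, f]"
      using len by (auto simp: length_Suc_conv eval_nat_numeral)
    ultimately have "d x y z \<in> {a, b, e, f}" by simp
    moreover have "\<And>w. w \<in> {a, b, e, f} \<Longrightarrow> nogood ((x, y, z, w) # st)"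
      using Sp.IH Sp.prems unfolding c ok.simps nth1.simps nth2.simps nth3.simps nth4.simps by blast
    \<comment> \<open>One of the four subtrees belongs to the colour that \<open>d\<close> really
      assigns, and \<open>d\<close> agrees with the branch extended by it.\<close>
    ultimately have "nogood ((x, y, z, d x y z) # st)" by blast
    moreover have "\<forall>(x', y', z', w) \<in> set ((x, y, z, d x y z) # st). d x' y' z' = w" using h by simp
    ultimately show False using d unfolding nogood_def by blast
  qed
next
  case (Us x y z a b c d e f g)
  let ?p = "perm a b c d e f g"
  have dis: "distinct [a, b, c, d, e, f, g]" and lx: "lex x y z i j k"
    and al: "list_all (lit_in ?p st) (rule x y z)" using Us by auto
  have "inj ?p"
  proof (rule injI)
    fix u v assume "?p u = ?p v" then show "u = v"
      using dis by (cases u; cases v; simp)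
  qed
  then have bij: "bij ?p"
    using UNIV_pt by (metis bijI finite.simps finite_UNIV_inj_surj)
  show ?case unfolding nogood_def
  proof (intro allI impI notI)
    fix dd assume d: "admissible dd" and h: "\<forall>(x, y, z, w) \<in> set st. dd x y z = w"
    \<comment> \<open>The conjugate of the given colouring satisfies the cited list literally, and
      it is again admissible.\<close>
    have "inv ?p (dd (?p x1) (?p x2) (?p x3)) = x4" if "(x1, x2, x3, x4) \<in> set (rule x y z)" for x1 x2 x3 x4
    proof -
      have "lit_in ?p st (x1, x2, x3, x4)" using al that by (auto simp: list_all_iff)
      then have "dd (?p x1) (?p x2) (?p x3) = ?p x4" using look_Some[OF d h] by simp
      then show ?thesis using \<open>inj ?p\<close> by simp
    qed
    moreover have "nogood (rule x y z)" using assms(2) lx by blast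
    ultimately show False
      using admissible_conj[OF d bij] unfolding nogood_def by fastforce
  qed
next
  case (Qd x y z w)
  show ?case unfolding nogood_def
  proof (intro allI impI notI)
    fix d assume d: "admissible d" and h: "\<forall>(x, y, z, w) \<in> set st. d x y z = w"
    note l = ne_look[OF d h]
    have dis: "distinct [x, y, z, w]" using Qd by simp
    have "pairs [look st x y z, look st x y w, look st x z w, look st y z w]" using Qd by simp
    then have "distinct [d x y z, d x y w, d x z w, d y z w]"
      by (simp add: l)
    then show False using d dis unfolding admissible_def by blast
  qed
next
  case (Hx x y p q r s)
  show ?case unfolding nogood_def
  proof (intro allI impI notI)
    fix d assume d: "admissible d" and h: "\<forall>(x, y, z, w) \<in> set st. d x y z = w"
    note l = ne_look[OF d h]
    have dis: "distinct [x, y, p, q, r, s]" using Hx by simp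
    have "pairs [look st x y p, look st x y q, look st x y r, look st x y s]" using Hx by simp
    then have "distinct [d x y p, d x y q, d x y r, d x y s]"
      by (simp add: l)
    then show False using d dis unfolding admissible_def by blast
  qed
next
  case (Xx v p q r s)
  show ?case unfolding nogood_def
  proof (intro allI impI notI)
    fix d assume d: "admissible d" and h: "\<forall>(x, y, z, w) \<in> set st. d x y z = w"
    note l = ne_look[OF d h]
    have dis: "distinct [v, p, q, r, s]" using Xx by simp
    have 1: "nes [look st v p q] [look st v p r, look st v p s, look st v q r, look st v r s,
          look st v q s, look st p r s, look st q r s]"
      and 2: "nes [look st v p r, look st v p s] [look st v q r, look st v r s,
          look st v q s, look st p r s, look st q r s]"
      and 3: "nes [look st v q r, look st v r s] [look st v q s, look st p r s, look st q r s]"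
      and 4: "nes [look st v q s] [look st p r s, look st q r s]" using Xx by simp_all
    have "\<forall>i \<in> {d v p q}. \<forall>j \<in> {d v p r, d v p s}. \<forall>k \<in> {d v q r, d v r s}.
         \<forall>l \<in> {d v q s}. \<forall>m \<in> {d p r s, d q r s}. distinct [i, j, k, l, m]"
      using 1 2 3 4 by (simp add: l)
    then show False using d dis unfolding admissible_def by blast
  qed
qed

section \<open>The refuted partial colourings\<close>

text \<open>The three letters are only digits of a serial number: 4 * 7 * 7 = 196 lists, named from
  A A A to D G G in the order in which they may cite each other.\<close>

primrec ruleAA :: "pt \<Rightarrow> lit list" where
"ruleAA A = [(A,B,C,D), (A,B,D,C), (A,C,D,B)]"
| "ruleAA B = [(B,C,D,E), (B,C,E,D), (C,D,E,G), (B,D,G,C), (C,D,G,B), (C,E,G,B), (D,E,G,C)]"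
| "ruleAA C = [(B,C,D,E), (B,C,E,D), (B,D,E,G), (C,D,E,G), (B,D,G,E), (C,E,G,B), (D,E,G,C)]"
| "ruleAA D = [(A,B,D,C), (B,C,D,E), (B,C,E,D), (B,D,E,G), (C,D,E,G), (C,E,G,B), (D,E,G,C)]"
| "ruleAA E = [(B,C,D,E), (B,C,E,D), (B,D,E,G), (B,D,G,C), (C,E,G,B), (D,E,G,B)]"
| "ruleAA F = [(A,B,D,C), (B,C,D,E), (B,C,E,D), (B,D,E,G), (C,E,G,B), (D,E,G,B)]"
| "ruleAA G = [(B,C,D,E), (B,C,E,G), (B,D,E,G), (B,C,G,D), (B,D,G,C), (B,E,G,D), (C,E,G,B)]"

primrec ruleAB :: "pt \<Rightarrow> lit list" where
"ruleAB A = [(A,B,D,C), (B,C,D,E), (B,C,E,G), (B,D,E,G), (B,C,G,D), (B,E,G,D), (C,E,G,B)]"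
| "ruleAB B = [(B,C,D,E), (B,C,E,G), (B,C,G,D), (A,D,G,B), (B,D,G,C), (B,E,G,D), (C,E,G,B)]"
| "ruleAB C = [(D,E,F,G), (A,E,G,B), (B,E,G,D), (D,E,G,F), (D,F,G,C)]"
| "ruleAB D = [(D,E,F,G), (A,D,G,E), (B,D,G,C), (A,E,G,B), (B,E,G,D), (C,E,G,B), (D,E,G,F)]"
| "ruleAB E = [(A,C,E,G), (A,D,E,F), (A,D,F,E), (D,E,F,C), (A,E,G,B)]"
| "ruleAB F = [(A,B,D,C), (A,B,E,D), (A,C,E,G), (B,D,E,A), (A,E,G,B)]"
| "ruleAB G = [(A,C,D,E), (C,D,E,F), (A,C,F,D), (A,D,F,C), (D,E,F,C)]"

primrec ruleAC :: "pt \<Rightarrow> lit list" where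
"ruleAC A = [(A,B,D,C), (A,C,D,E), (A,C,E,G), (A,D,E,F), (C,D,E,F), (A,C,F,D), (D,E,F,C), (A,E,G,B)]"
| "ruleAC B = [(A,B,C,D), (A,B,D,C), (A,C,D,E), (B,C,D,E), (A,C,E,G), (B,C,E,F), (B,D,E,A), (C,E,F,B)]"
| "ruleAC C = [(A,B,C,D), (A,B,D,C), (A,C,D,E), (B,C,D,E), (A,C,E,G), (B,C,E,F), (B,D,E,C)]"
| "ruleAC D = [(B,C,D,E), (B,D,E,G), (B,C,G,F), (B,D,G,C), (B,E,G,D), (C,E,G,B), (D,E,G,C)]"
| "ruleAC E = [(B,C,D,E), (B,C,E,F), (B,D,E,G), (A,C,G,E), (B,D,G,C), (B,E,G,D), (C,E,G,B)]"
| "ruleAC F = [(A,B,D,C), (B,C,D,E), (B,C,E,F), (B,D,E,G), (A,C,G,E), (B,E,G,D), (C,E,G,B)]"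
| "ruleAC G = [(A,B,D,C), (B,C,D,E), (B,C,E,F), (B,D,E,G), (B,C,F,D), (B,E,F,D), (C,E,F,B), (D,E,F,A)]"

primrec ruleAD :: "pt \<Rightarrow> lit list" where
"ruleAD A = [(B,C,D,E), (B,C,E,F), (B,D,E,G), (B,C,F,D), (B,E,F,D), (C,E,F,B), (D,E,F,B)]"
| "ruleAD B = [(B,D,E,G), (D,E,F,G), (B,D,G,C), (A,E,G,B), (B,E,G,F), (E,F,G,D)]"
| "ruleAD C = [(B,D,E,G), (D,E,F,G), (B,D,G,C), (B,E,G,F), (D,F,G,A), (E,F,G,B)]"
| "ruleAD D = [(B,D,E,G), (C,D,E,G), (B,D,G,C), (C,D,G,E), (B,E,G,F), (C,E,G,B)]"
| "ruleAD E = [(B,C,E,F), (B,C,F,E), (B,E,F,G), (C,E,F,G), (C,E,G,B), (C,F,G,E)]"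
| "ruleAD F = [(B,C,E,F), (B,C,F,E), (C,E,F,G), (B,C,G,E), (C,E,G,B)]"
| "ruleAD G = [(A,B,C,D), (A,B,D,C), (A,C,D,E), (B,C,D,E), (A,C,E,G), (B,C,E,F), (B,D,E,A), (C,E,G,B)]"

primrec ruleAE :: "pt \<Rightarrow> lit list" where
"ruleAE A = [(B,C,E,F), (B,C,F,E), (B,D,F,C), (B,E,F,G), (C,E,F,G), (B,E,G,D), (C,E,G,B)]"
| "ruleAE B = [(B,C,E,F), (B,C,F,E), (B,E,F,G), (C,E,F,G), (B,E,G,D), (C,E,G,B), (B,F,G,A), (C,F,G,D)]"
| "ruleAE C = [(A,B,E,F), (B,D,E,G), (B,E,F,D), (D,E,F,G), (D,F,G,E), (E,F,G,B)]"
| "ruleAE D = [(B,D,E,G), (C,E,F,G), (B,C,G,D), (B,D,G,E), (B,E,G,F), (D,E,G,F), (E,F,G,B)]"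
| "ruleAE E = [(B,D,E,G), (B,E,F,D), (D,E,F,G), (B,D,G,E), (B,E,G,F), (E,F,G,B)]"
| "ruleAE F = [(A,B,E,F), (A,D,E,F), (A,C,F,D), (A,D,F,E), (A,E,F,B)]"
| "ruleAE G = [(A,D,E,F), (A,D,F,E), (A,E,F,G), (D,E,F,G), (D,E,G,F), (A,F,G,D)]"

primrec ruleAF :: "pt \<Rightarrow> lit list" where
"ruleAF A = [(A,B,D,C), (A,D,E,F), (B,D,E,G), (A,B,F,D), (A,D,F,E), (B,E,F,D), (D,E,F,G)]"
| "ruleAF B = [(B,C,D,E), (B,D,E,G), (B,D,G,C), (C,E,G,B), (D,E,G,B)]"
| "ruleAF C = [(A,B,D,C), (B,C,D,E), (B,D,E,G), (C,E,G,B), (D,E,G,B)]"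
| "ruleAF D = [(A,B,D,C), (B,C,D,E), (A,D,E,G), (B,D,E,G), (A,D,G,E), (A,E,G,B), (C,E,G,B)]"
| "ruleAF E = [(A,B,D,C), (B,C,D,E), (B,D,E,G), (C,D,E,G), (C,D,G,B), (C,E,G,B), (D,E,G,C)]"
| "ruleAF F = [(B,D,E,F), (B,D,F,C), (B,E,F,G), (B,E,G,D), (C,F,G,E), (E,F,G,B)]"
| "ruleAF G = [(B,D,E,F), (B,D,F,C), (B,E,F,G), (C,E,F,G), (A,E,G,B), (C,E,G,B), (C,F,G,E)]"

primrec ruleAG :: "pt \<Rightarrow> lit list" where
"ruleAG A = [(B,E,F,G), (C,E,F,G), (D,E,F,G), (C,E,G,B), (C,F,G,D), (D,F,G,E)]"
| "ruleAG B = [(B,C,E,F), (C,D,F,E), (B,E,F,G), (C,E,F,G), (D,E,F,G), (C,E,G,B), (C,F,G,D), (D,F,G,C)]"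
| "ruleAG C = [(B,C,E,F), (B,D,F,C), (C,D,F,E), (B,E,F,G), (C,E,F,G), (D,E,F,G), (C,E,G,B), (C,F,G,D)]"
| "ruleAG D = [(A,B,E,F), (A,C,E,G), (B,D,F,E), (B,E,F,G), (D,E,F,G), (A,E,G,B), (B,E,G,A), (B,F,G,D)]"
| "ruleAG E = [(B,C,D,E), (B,C,E,D), (B,D,E,G), (C,D,E,G), (B,D,G,C), (C,E,G,B)]"
| "ruleAG F = [(A,B,D,C), (B,C,D,E), (B,C,E,D), (B,D,E,G), (C,E,G,B)]"
| "ruleAG G = [(A,B,D,C), (B,C,D,E), (A,C,E,G), (B,C,E,D), (C,E,G,B)]"

primrec ruleA :: "pt \<Rightarrow> pt \<Rightarrow> lit list" where
"ruleA A = ruleAA"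
| "ruleA B = ruleAB"
| "ruleA C = ruleAC"
| "ruleA D = ruleAD"
| "ruleA E = ruleAE"
| "ruleA F = ruleAF"
| "ruleA G = ruleAG"

primrec ruleBA :: "pt \<Rightarrow> lit list" where
"ruleBA A = [(A,B,D,C), (B,C,D,E), (B,D,E,F), (C,D,E,F), (B,E,F,G), (B,E,G,D), (C,E,G,B), (D,E,G,F)]"
| "ruleBA B = [(A,B,C,D), (A,B,D,C), (A,C,D,E), (B,C,D,E), (A,C,E,G), (B,C,E,A), (A,D,E,F), (C,E,G,B)]"
| "ruleBA C = [(A,B,C,D), (A,B,D,C), (A,B,E,G), (A,C,E,G), (B,D,E,A), (A,C,G,E), (A,E,G,B)]"
| "ruleBA D = [(A,B,C,D), (A,B,D,C), (A,C,E,G), (B,C,E,A), (B,D,E,A), (A,C,G,E), (A,E,G,B)]"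
| "ruleBA E = [(A,B,D,C), (B,C,D,E), (B,C,E,F), (B,D,E,G), (B,C,F,D), (C,D,F,E), (C,E,F,B), (A,E,G,B)]"
| "ruleBA F = [(A,B,D,C), (B,C,D,E), (B,C,E,F), (B,D,E,G), (A,C,F,E), (B,C,F,D), (C,E,F,B), (A,E,G,B)]"
| "ruleBA G = [(A,B,D,C), (B,C,D,E), (B,C,F,E), (B,E,F,G), (B,C,G,D), (B,E,G,F), (C,E,G,B), (B,F,G,D)]"

primrec ruleBB :: "pt \<Rightarrow> lit list" where
"ruleBB A = [(A,C,D,E), (B,D,E,F), (B,D,F,E), (B,E,F,G), (B,C,G,D), (B,E,G,D), (C,E,G,B), (B,F,G,D)]"
| "ruleBB B = [(B,D,E,F), (B,E,F,G), (B,E,G,D), (C,F,G,E), (E,F,G,B)]"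
| "ruleBB C = [(A,B,D,C), (B,C,D,E), (B,C,E,F), (B,D,E,F), (B,C,F,D), (C,E,F,G), (B,E,G,F), (C,E,G,B)]"
| "ruleBB D = [(B,C,E,F), (B,C,F,D), (C,E,F,G), (B,D,G,E), (B,E,G,F), (E,F,G,B)]"
| "ruleBB E = [(B,D,E,G), (C,E,F,G), (B,D,G,E), (D,E,G,F), (E,F,G,D)]"
| "ruleBB F = [(B,C,E,F), (B,D,E,G), (B,C,F,D), (C,E,F,G), (B,D,G,E), (B,E,G,F), (C,E,G,B), (C,F,G,D)]"
| "ruleBB G = [(B,C,D,E), (B,C,E,F), (B,D,E,F), (B,C,F,D), (B,D,F,C), (C,E,F,G), (C,E,G,B), (C,F,G,D)]"

primrec ruleBC :: "pt \<Rightarrow> lit list" where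
"ruleBC A = [(A,B,D,C), (B,C,D,E), (B,C,E,G), (B,D,E,F), (B,C,G,D), (C,D,G,E), (C,E,G,B)]"
| "ruleBC B = [(A,B,D,C), (A,C,D,E), (B,C,D,E), (B,C,E,G), (B,C,G,D), (C,D,G,E), (C,E,G,B)]"
| "ruleBC C = [(A,B,D,C), (A,C,D,E), (B,C,D,E), (B,C,E,G), (A,C,G,E), (B,C,G,D), (C,E,G,B)]"
| "ruleBC D = [(A,B,C,D), (A,B,D,C), (A,C,D,E), (B,C,D,E), (B,C,E,G), (A,C,G,E), (C,E,G,B)]"
| "ruleBC E = [(A,B,D,C), (B,C,D,E), (B,D,E,G), (C,D,E,G), (C,E,G,B), (D,E,G,C)]"
| "ruleBC F = [(A,B,C,D), (A,B,D,C), (A,B,E,G), (A,E,G,B), (B,E,G,F)]"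
| "ruleBC G = [(B,D,E,G), (C,E,F,G), (B,E,G,F), (C,E,G,B), (C,F,G,E)]"

primrec ruleBD :: "pt \<Rightarrow> lit list" where
"ruleBD A = [(A,B,E,F), (A,C,E,G), (A,C,F,G), (B,E,F,D), (A,C,G,E), (A,E,G,B), (C,F,G,A)]"
| "ruleBD B = [(B,C,E,F), (B,D,E,F), (B,D,F,E), (B,E,F,G), (B,C,G,D), (C,E,G,B), (B,F,G,D)]"
| "ruleBD C = [(B,C,D,E), (B,C,E,F), (B,D,E,F), (B,C,F,D), (B,D,F,C), (C,E,F,G), (A,E,G,B), (C,E,G,B)]"
| "ruleBD D = [(B,D,E,F), (B,C,F,D), (B,D,F,E), (B,E,F,G), (A,E,G,B), (B,E,G,D), (D,E,G,C)]"
| "ruleBD E = [(A,C,D,E), (B,D,E,F), (B,C,F,D), (B,D,F,E), (B,E,F,G), (A,E,G,B), (B,E,G,D), (C,E,G,B)]"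
| "ruleBD F = [(A,B,C,D), (A,B,D,C), (A,C,D,E), (B,C,D,E), (A,C,E,G), (A,C,G,E), (A,E,G,B), (C,E,G,B)]"
| "ruleBD G = [(A,B,C,D), (A,B,D,C), (A,C,D,E), (B,C,D,E), (A,C,E,G), (A,C,G,E), (A,E,G,B)]"

primrec ruleBE :: "pt \<Rightarrow> lit list" where
"ruleBE A = [(A,D,E,F), (A,D,F,E), (D,E,F,G), (A,D,G,C), (A,E,G,D), (C,E,G,D), (D,E,G,F)]"
| "ruleBE B = [(A,D,E,F), (A,D,F,E), (D,E,F,G), (A,C,G,E), (A,D,G,C), (A,E,G,D), (C,E,G,D)]"
| "ruleBE C = [(A,B,D,C), (A,C,E,G), (A,D,E,F), (A,D,F,E), (A,C,G,E), (A,E,G,D), (C,E,G,D)]"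
| "ruleBE D = [(C,D,E,G), (C,D,F,G), (A,C,G,E), (C,E,G,D), (D,E,G,F)]"
| "ruleBE E = [(A,C,E,G), (A,D,F,C), (A,E,F,G), (D,E,F,G), (A,C,G,E), (A,D,G,F), (A,E,G,D), (C,E,G,D)]"
| "ruleBE F = [(A,B,D,C), (A,C,D,E), (B,C,D,E), (A,C,E,G), (A,D,E,F), (A,C,G,E), (A,E,G,D), (C,E,G,D)]"
| "ruleBE G = [(A,B,C,D), (A,B,D,C), (A,C,D,E), (B,C,D,E), (A,C,E,G), (A,C,G,E), (A,E,G,D)]"

primrec ruleBF :: "pt \<Rightarrow> lit list" where
"ruleBF A = [(B,D,E,A), (B,D,G,C), (A,E,G,F), (B,E,G,D), (E,F,G,B)]"
| "ruleBF B = [(A,B,D,C), (B,C,D,E), (B,D,E,A), (A,B,G,D), (A,C,G,E), (A,E,G,F), (B,E,G,D), (E,F,G,B)]"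
| "ruleBF C = [(A,C,E,G), (A,C,F,E), (A,E,F,G), (C,E,F,B), (A,C,G,E), (A,E,G,F), (C,E,G,F), (A,F,G,D)]"
| "ruleBF D = [(A,C,E,G), (A,C,F,E), (A,E,F,G), (C,E,F,B), (A,C,G,E), (A,E,G,F), (C,E,G,F), (C,F,G,D)]"
| "ruleBF E = [(A,B,C,D), (A,B,D,C), (A,C,D,E), (A,B,E,F), (A,B,F,D), (A,E,F,B)]"
| "ruleBF F = [(A,B,C,D), (A,B,D,C), (A,C,D,E), (A,B,E,F), (A,E,F,B)]"
| "ruleBF G = [(A,B,D,C), (B,C,D,E), (B,D,E,F), (A,E,F,B), (B,E,G,F), (B,F,G,D), (E,F,G,B)]"

primrec ruleBG :: "pt \<Rightarrow> lit list" where
"ruleBG A = [(A,B,D,C), (B,C,D,E), (A,B,E,G), (B,D,E,F), (A,E,F,B), (B,E,G,D), (A,F,G,E), (E,F,G,B)]"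
| "ruleBG B = [(B,C,E,G), (A,D,F,B), (B,D,F,C), (C,D,F,E), (C,E,F,B), (B,C,G,D), (C,E,G,F), (C,F,G,D)]"
| "ruleBG C = [(A,B,D,C), (A,B,E,G), (A,D,E,B), (B,D,E,G), (A,B,F,D), (A,D,F,E), (A,E,F,B), (B,E,F,D)]"
| "ruleBG D = [(C,D,E,G), (C,D,F,E), (C,E,F,G), (A,C,G,E), (C,E,G,F), (C,F,G,D)]"
| "ruleBG E = [(A,C,D,E), (B,C,D,E), (C,D,F,E), (C,E,F,G), (A,C,G,E), (C,E,G,F), (C,F,G,D)]"
| "ruleBG F = [(A,C,E,G), (A,B,F,G), (A,C,G,E), (C,E,G,F), (A,F,G,E), (B,F,G,C), (E,F,G,B)]"
| "ruleBG G = [(A,B,C,D), (B,C,D,E), (A,B,E,G), (B,D,E,C), (A,B,G,D), (B,E,G,D), (B,F,G,D)]"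

primrec ruleB :: "pt \<Rightarrow> pt \<Rightarrow> lit list" where
"ruleB A = ruleBA"
| "ruleB B = ruleBB"
| "ruleB C = ruleBC"
| "ruleB D = ruleBD"
| "ruleB E = ruleBE"
| "ruleB F = ruleBF"
| "ruleB G = ruleBG"

primrec ruleCA :: "pt \<Rightarrow> lit list" where
"ruleCA A = [(A,C,E,G), (A,D,F,G), (A,E,F,D), (A,C,G,E), (A,E,G,F), (C,E,G,F), (A,F,G,E), (D,F,G,C)]"
| "ruleCA B = [(B,C,D,E), (A,B,F,D), (A,C,F,G), (B,D,F,C), (A,C,G,E), (C,E,G,F), (B,F,G,D), (C,F,G,B)]"
| "ruleCA C = [(A,B,D,C), (A,B,F,D), (A,D,F,G), (B,D,F,G), (A,B,G,F), (A,D,G,E), (A,F,G,B), (B,F,G,D)]"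
| "ruleCA D = [(A,B,E,C), (A,C,E,G), (B,C,E,D), (B,D,E,G), (A,B,G,E), (A,C,G,E), (A,E,G,F), (C,E,G,F)]"
| "ruleCA E = [(A,B,E,D), (A,C,E,G), (A,B,F,E), (A,C,F,G), (A,E,G,F), (B,E,G,F), (A,F,G,B)]"
| "ruleCA F = [(A,B,E,D), (A,D,E,F), (A,D,F,E), (D,E,F,G), (A,B,G,E), (A,E,G,F), (A,F,G,B)]"
| "ruleCA G = [(A,B,D,C), (A,C,E,G), (B,D,E,A), (C,D,E,G), (A,D,G,E), (A,E,G,F), (D,E,G,B)]"

primrec ruleCB :: "pt \<Rightarrow> lit list" where
"ruleCB A = [(A,B,D,C), (A,C,D,E), (A,C,E,G), (A,C,G,E), (A,D,G,F), (A,E,G,F), (C,E,G,F), (A,F,G,D)]"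
| "ruleCB B = [(A,D,E,F), (A,C,F,G), (A,D,F,E), (A,E,G,F), (A,F,G,D)]"
| "ruleCB C = [(A,D,E,G), (A,C,F,G), (A,D,F,E), (A,D,G,E), (A,E,G,F), (A,F,G,D)]"
| "ruleCB D = [(A,C,D,E), (A,C,E,G), (A,C,F,G), (A,D,F,C), (C,D,G,E), (C,E,G,F), (C,F,G,D)]"
| "ruleCB E = [(A,D,E,B), (B,D,E,G), (A,D,F,B), (B,D,F,G), (A,D,G,E), (D,E,G,F), (A,F,G,D)]"
| "ruleCB F = [(A,D,E,G), (A,C,F,G), (A,D,F,C), (A,D,G,E), (A,E,G,F), (A,F,G,D), (C,F,G,D)]"
| "ruleCB G = [(C,D,E,G), (A,E,F,G), (C,D,G,E), (A,E,G,F), (C,E,G,F), (A,F,G,D)]"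

primrec ruleCC :: "pt \<Rightarrow> lit list" where
"ruleCC A = [(A,C,D,E), (A,C,E,G), (A,D,E,C), (C,D,G,E), (C,E,G,F), (C,F,G,D)]"
| "ruleCC B = [(A,D,E,C), (C,D,E,G), (A,E,F,C), (C,E,F,G), (A,D,G,E), (A,E,G,F), (C,E,G,F), (A,F,G,D)]"
| "ruleCC C = [(C,D,E,G), (C,D,F,E), (A,E,F,C), (C,E,F,D), (E,F,G,B)]"
| "ruleCC D = [(B,C,D,E), (C,D,E,F), (A,E,F,C), (C,E,F,D), (C,F,G,D)]"
| "ruleCC E = [(A,B,C,D), (A,B,D,C), (A,C,D,E), (B,C,D,E), (A,B,E,G), (A,D,E,B), (A,D,G,E), (D,E,G,B)]"
| "ruleCC F = [(A,B,E,C), (B,C,E,G), (A,E,F,C), (C,E,F,B), (A,C,G,E), (B,E,G,F), (C,E,G,F), (C,F,G,D)]"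
| "ruleCC G = [(A,C,E,G), (A,D,F,G), (A,E,F,C), (A,C,G,E), (A,E,G,F), (C,E,G,F), (A,F,G,D)]"

primrec ruleCD :: "pt \<Rightarrow> lit list" where
"ruleCD A = [(A,C,E,G), (A,D,E,C), (A,D,F,G), (A,C,G,E), (A,E,G,F), (C,E,G,F), (A,F,G,D)]"
| "ruleCD B = [(A,C,E,G), (A,C,F,D), (A,E,F,D), (C,E,F,B), (A,C,G,E), (A,E,G,F), (C,E,G,F), (A,F,G,C)]"
| "ruleCD C = [(A,C,E,G), (A,C,F,D), (A,D,F,G), (C,E,F,B), (A,C,G,E), (A,E,G,F), (C,E,G,F), (A,F,G,C)]"
| "ruleCD D = [(A,C,D,E), (A,C,E,G), (A,C,F,D), (A,D,F,G), (A,C,G,E), (A,E,G,F), (C,E,G,F), (A,F,G,C)]"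
| "ruleCD E = [(B,C,D,E), (B,C,E,D), (C,D,E,G), (B,C,F,G), (B,C,G,E), (C,F,G,B)]"
| "ruleCD F = [(B,C,D,E), (B,C,E,D), (C,D,E,G), (B,C,F,G), (C,F,G,B)]"
| "ruleCD G = [(A,C,D,E), (A,C,E,G), (A,D,E,B), (C,D,G,E), (C,E,G,F), (D,E,G,A)]"

primrec ruleCE :: "pt \<Rightarrow> lit list" where
"ruleCE A = [(B,C,F,D), (A,D,F,E), (B,D,F,G), (B,F,G,E), (D,F,G,B), (E,F,G,D)]"
| "ruleCE B = [(B,D,F,G), (A,E,G,F), (C,E,G,F), (D,F,G,E), (E,F,G,D)]"
| "ruleCE C = [(A,C,E,G), (B,C,F,D), (A,D,F,E), (B,D,F,G), (A,E,G,F), (C,E,G,F), (B,F,G,E), (C,F,G,B)]"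
| "ruleCE D = [(A,B,D,C), (A,C,D,E), (A,C,E,G), (A,D,F,E), (A,E,F,D), (A,C,G,E), (A,E,G,F), (C,E,G,F)]"
| "ruleCE E = [(B,C,D,E), (A,C,E,G), (A,C,F,D), (B,D,F,E), (A,E,F,B), (B,E,F,D), (D,E,F,C), (C,E,G,F)]"
| "ruleCE F = [(B,D,F,E), (A,E,F,B), (B,E,F,D), (D,E,F,G), (A,E,G,F), (B,E,G,D), (C,E,G,F)]"
| "ruleCE G = [(A,C,D,E), (A,B,F,D), (B,D,F,E), (A,E,F,B), (B,E,F,G), (A,C,G,E), (A,E,G,F), (C,E,G,F)]"

primrec ruleCF :: "pt \<Rightarrow> lit list" where
"ruleCF A = [(A,D,E,G), (A,C,F,D), (A,D,F,E), (C,D,F,E), (A,E,F,B), (A,D,G,E), (A,E,G,F)]"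
| "ruleCF B = [(A,B,C,D), (A,B,D,C), (A,C,D,E), (B,C,D,E), (A,C,E,G), (A,C,G,E), (A,E,G,F), (C,E,G,F)]"
| "ruleCF C = [(A,B,C,D), (A,B,D,C), (A,C,D,E), (B,C,D,E), (A,C,E,G), (A,C,G,E)]"
| "ruleCF D = [(A,B,C,D), (A,C,D,E), (B,C,D,E), (A,C,E,G), (A,D,E,C), (C,D,E,G), (D,E,G,B)]"
| "ruleCF E = [(A,C,D,E), (A,C,E,G), (A,D,E,C), (C,D,E,G), (A,C,F,D), (D,E,F,C), (C,D,G,F), (D,E,G,F)]"
| "ruleCF F = [(A,C,D,E), (A,C,E,G), (C,D,E,G), (D,E,F,C), (A,C,G,D), (C,D,G,A), (D,E,G,F)]"
| "ruleCF G = [(A,C,D,E), (A,C,E,G), (A,D,E,F), (A,C,F,D), (A,D,F,C), (C,D,F,E), (C,E,F,B)]"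

primrec ruleCG :: "pt \<Rightarrow> lit list" where
"ruleCG A = [(A,D,E,F), (B,D,E,G), (C,D,E,G), (C,E,F,G), (D,E,F,B), (A,C,G,D), (B,D,G,C), (C,D,G,E)]"
| "ruleCG B = [(A,D,E,F), (C,D,F,E), (C,E,F,G), (D,E,F,G), (C,F,G,D), (D,F,G,C)]"
| "ruleCG C = [(A,C,D,E), (A,D,E,F), (A,C,F,D), (A,D,F,C), (C,D,F,E), (C,E,F,G), (D,E,F,G), (C,F,G,D)]"
| "ruleCG D = [(A,B,C,D), (A,B,D,C), (A,C,D,E), (B,C,D,E), (A,C,E,G), (A,D,E,F), (A,C,F,D), (A,C,G,D)]"
| "ruleCG E = [(A,C,D,E), (A,C,E,G), (A,D,E,G), (A,C,G,D), (A,D,G,C), (C,D,G,E), (C,E,G,B)]"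
| "ruleCG F = [(A,C,D,E), (A,C,E,G), (A,D,E,G), (A,C,G,D), (A,D,G,C)]"
| "ruleCG G = [(A,B,C,D), (A,B,D,C), (A,C,D,E), (B,C,D,E), (A,C,E,G), (A,D,E,G), (A,C,G,D)]"

primrec ruleC :: "pt \<Rightarrow> pt \<Rightarrow> lit list" where
"ruleC A = ruleCA"
| "ruleC B = ruleCB"
| "ruleC C = ruleCC"
| "ruleC D = ruleCD"
| "ruleC E = ruleCE"
| "ruleC F = ruleCF"
| "ruleC G = ruleCG"

primrec ruleDA :: "pt \<Rightarrow> lit list" where
"ruleDA A = [(A,B,C,D), (A,C,D,E), (A,C,E,G), (A,D,E,B), (A,C,F,D), (A,D,F,C), (A,C,G,D)]"
| "ruleDA B = [(A,B,C,D), (A,B,D,C), (A,C,D,E), (B,C,D,E), (A,C,E,G), (A,C,F,D), (A,C,G,D)]"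
| "ruleDA C = [(A,B,C,D), (A,B,D,C), (A,C,D,E), (B,C,D,E), (A,C,E,G), (A,D,E,B), (A,C,F,E), (A,C,G,D)]"
| "ruleDA D = [(A,B,C,D), (A,B,D,C), (A,C,D,E), (B,C,D,E), (A,C,E,G), (B,D,E,C), (C,D,E,F)]"
| "ruleDA E = [(B,D,E,G), (C,D,E,F), (B,C,F,D), (A,D,F,C), (C,D,F,G), (A,D,G,F), (B,D,G,C), (C,D,G,E)]"
| "ruleDA F = [(A,C,E,G), (B,C,E,A), (A,C,F,E), (A,D,F,C), (C,D,F,G), (A,C,G,D), (C,D,G,E), (C,E,G,F)]"
| "ruleDA G = [(A,C,E,G), (C,D,E,F), (C,D,F,G), (C,D,G,E), (C,E,G,D)]"

primrec ruleDB :: "pt \<Rightarrow> lit list" where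
"ruleDB A = [(B,C,E,G), (A,D,F,C), (C,D,F,G), (C,E,F,B), (A,C,G,D), (C,D,G,E), (C,E,G,F)]"
| "ruleDB B = [(A,C,F,E), (B,C,F,D), (C,D,F,G), (C,E,F,G), (A,C,G,D), (C,D,G,F)]"
| "ruleDB C = [(C,D,E,F), (A,C,F,E), (B,C,F,D), (C,D,F,G), (A,C,G,D), (C,D,G,F)]"
| "ruleDB D = [(B,C,E,G), (A,D,F,C), (C,D,F,G), (C,E,F,B), (A,C,G,D), (C,D,G,F), (C,F,G,E)]"
| "ruleDB E = [(B,C,E,G), (A,C,F,E), (A,D,F,C), (B,D,F,C), (C,D,F,G), (C,E,F,B), (A,C,G,D), (C,D,G,F)]"
| "ruleDB F = [(A,D,E,F), (B,D,E,F), (C,D,E,F), (A,D,F,C), (C,D,F,E)]"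
| "ruleDB G = [(A,D,E,F), (B,D,E,G), (C,D,E,F), (A,D,F,C), (C,D,F,E), (A,C,G,D), (A,D,G,E), (D,E,G,A)]"

primrec ruleDC :: "pt \<Rightarrow> lit list" where
"ruleDC A = [(B,C,D,E), (B,C,E,G), (A,C,G,D), (C,D,G,E), (C,E,G,B)]"
| "ruleDC B = [(A,D,E,F), (C,D,E,G), (D,E,F,G), (C,D,G,F), (D,F,G,E)]"
| "ruleDC C = [(A,D,E,F), (C,D,E,G), (A,D,F,C), (C,D,F,E), (D,E,F,G), (C,D,G,F)]"
| "ruleDC D = [(A,B,C,D), (A,B,D,C), (A,C,D,E), (B,C,D,E), (A,C,E,G), (A,D,E,F), (A,C,F,E), (A,C,G,D)]"
| "ruleDC E = [(A,B,C,D), (A,B,D,C), (A,C,D,E), (B,C,D,E), (A,C,E,G), (A,C,F,E), (A,C,G,D)]"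
| "ruleDC F = [(A,B,C,D), (A,B,D,C), (A,C,D,E), (B,C,D,E), (B,D,E,G), (A,D,F,C), (C,D,F,E), (D,E,F,B)]"
| "ruleDC G = [(A,D,E,F), (D,E,F,G), (A,D,G,F), (D,E,G,B), (D,F,G,E)]"

text \<open>Say that a pair of points swaps two others if it gives each of them the other as colour.
  \<open>rule D D F\<close> states that AB swaps C and D; \<open>rule D D E\<close> and
  \<open>rule D D D\<close> add the literals of the cases into which its refutation falls.\<close>

primrec ruleDD :: "pt \<Rightarrow> lit list" where
"ruleDD A = [(A,D,E,F), (D,E,F,G), (A,D,G,F), (D,F,G,E)]"
| "ruleDD B = [(A,C,D,E), (A,D,E,F), (A,D,F,C), (C,D,F,E), (D,E,F,G), (A,C,G,D), (A,D,G,F)]"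
| "ruleDD C = [(A,B,C,D), (A,B,D,C), (A,C,D,E), (B,C,D,E), (A,C,E,G), (A,C,F,G), (A,C,G,D)]"
| "ruleDD D = [(A,B,C,D), (A,B,D,C), (A,C,D,E), (B,C,D,E), (A,C,E,G)]"
| "ruleDD E = [(A,B,C,D), (A,B,D,C), (A,C,D,E)]"
| "ruleDD F = [(A,B,C,D), (A,B,D,C)]"
| "ruleDD G = [(A,C,D,F), (A,C,F,G), (A,D,F,E), (D,E,F,G), (A,C,G,D), (A,D,G,E), (A,F,G,D), (D,F,G,C)]"

primrec ruleDE :: "pt \<Rightarrow> lit list" where
"ruleDE A = [(A,C,D,F), (A,D,E,C), (C,D,F,G), (D,E,F,C), (C,D,G,E)]"
| "ruleDE B = [(A,C,D,F), (A,D,E,C), (C,D,F,G), (D,E,F,C), (A,C,G,D), (A,D,G,E)]"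
| "ruleDE C = [(A,C,D,F), (A,D,E,C), (A,C,F,G), (D,E,F,C), (A,C,G,D), (A,D,G,E)]"
| "ruleDE D = [(A,B,C,D), (A,B,D,E), (A,C,D,F), (A,B,E,F), (A,D,E,C), (A,B,F,D)]"
| "ruleDE E = [(A,C,D,G), (B,C,D,E), (A,D,E,C), (B,D,E,F), (C,D,E,G), (B,C,G,D), (A,D,G,E)]"
| "ruleDE F = [(B,D,E,F), (A,D,F,E), (B,D,F,G), (D,E,G,F), (D,F,G,C)]"
| "ruleDE G = [(A,C,D,G), (B,C,D,G), (A,D,E,C), (B,D,E,C), (A,D,G,E), (B,D,G,E), (C,D,G,E)]"

primrec ruleDF :: "pt \<Rightarrow> lit list" where
"ruleDF A = [(A,B,C,D), (A,C,D,G), (A,D,E,C), (C,D,E,F), (A,C,G,E)]"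
| "ruleDF B = [(A,B,C,D), (A,B,D,E), (A,C,D,G), (B,C,D,G), (A,D,E,C), (B,D,E,C), (A,D,G,E)]"
| "ruleDF C = [(A,B,C,D), (A,B,D,E), (A,C,D,G), (A,B,E,F), (A,D,E,C), (A,B,F,D), (A,D,G,E)]"
| "ruleDF D = [(A,B,C,D), (A,B,D,E), (A,B,E,F), (A,D,E,C), (A,B,F,D)]"
| "ruleDF E = [(A,C,E,G), (A,B,G,E), (A,E,G,F), (A,F,G,C)]"
| "ruleDF F = [(A,B,E,F), (A,D,E,G), (A,B,F,D), (A,E,F,C), (A,B,G,E)]"
| "ruleDF G = [(A,B,C,D), (A,B,D,E), (A,B,E,F), (A,D,E,G), (A,B,F,D), (A,B,G,E)]"

text \<open>Sending x to the colour of ABx maps the five other points to each other unless a colour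
  is A or B, and neither can occur. Under this map \<open>rule D G F\<close>,
  \<open>rule D G E\<close> and \<open>rule D G D\<close> are the paths from C to D, on to E, and on
  to F. The empty list is the goal.\<close>

primrec ruleDG :: "pt \<Rightarrow> lit list" where
"ruleDG A = [(A,B,E,F), (A,B,F,D), (A,D,F,E), (B,D,F,E), (A,E,F,C)]"
| "ruleDG B = [(A,B,E,F), (A,B,F,D), (A,D,F,E), (B,D,F,E)]"
| "ruleDG C = [(A,B,C,D), (A,B,D,E), (A,B,E,F), (A,D,E,G), (A,B,F,D)]"
| "ruleDG D = [(A,B,C,D), (A,B,D,E), (A,B,E,F)]"
| "ruleDG E = [(A,B,C,D), (A,B,D,E)]"
| "ruleDG F = [(A,B,C,D)]"
| "ruleDG G = []"

primrec ruleD :: "pt \<Rightarrow> pt \<Rightarrow> lit list" where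
"ruleD A = ruleDA"
| "ruleD B = ruleDB"
| "ruleD C = ruleDC"
| "ruleD D = ruleDD"
| "ruleD E = ruleDE"
| "ruleD F = ruleDF"
| "ruleD G = ruleDG"

text \<open>Names beginning with E, F or G are filled with the empty list, so that the function is
  total and every value is refutable.\<close>

primrec rule :: "pt \<Rightarrow> pt \<Rightarrow> pt \<Rightarrow> lit list" where
"rule A = ruleA"
| "rule B = ruleB"
| "rule C = ruleC"
| "rule D = ruleD"
| "rule E = (\<lambda>_ _. [])"
| "rule F = (\<lambda>_ _. [])"
| "rule G = (\<lambda>_ _. [])"

section \<open>The refutation trees\<close>

definition block :: "pt \<Rightarrow> pt \<Rightarrow> tree \<Rightarrow> tree \<Rightarrow> tree \<Rightarrow> tree \<Rightarrow> tree \<Rightarrow> tree \<Rightarrow> tree \<Rightarrow> bool" where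
  "block x y a b c d e f g \<longleftrightarrow>
    ok rule x y A a (rule x y A) \<and> ok rule x y B b (rule x y B) \<and> ok rule x y C c (rule x y C) \<and>
    ok rule x y D d (rule x y D) \<and> ok rule x y E e (rule x y E) \<and> ok rule x y F f (rule x y F) \<and>
    ok rule x y G g (rule x y G)"

text \<open>\<open>rule A A A\<close> has three triples of a four-set coloured by the respective
  missing points. The fourth triple must take a colour among the other four points, and the four-set
  becomes rainbow in every case. Later trees cite this list constantly.\<close>

lemma blockAA: "block A A
(Sp B C D (Qd B C D A) (Qd B C D A) (Qd B C D A) (Qd B C D A))
(Sp B C G (Qd B C G D) (Us A A A G B C D A E F) (Xx C B E G D) (Qd B C G D))
(Sp B E G (Qd B E G D) (Us A A B A G E B C F D) (Us A A A B D E G A C F) (Qd B E G D))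
(Sp C D G (Qd C D G E) (Sp B D G (Hx B D G C E A) (Us A A B A B C D E F G) (Us A A C A B C D E F G) (Hx B D G A C E))
   (Us A A A D C E G A B F) (Qd C D G E))
(Sp B E G (Qd B E G D) (Us A A B A C B E D F G) (Us A A A E B D G A C F) (Qd B E G D))
(Sp B D G (Hx B D G C E A) (Us A A E A B C D E F G) (Us A A A D B E G A C F) (Hx B D G A C E))
(Sp C D G (Qd C D G B) (Us A A A G B C D A E F) (Us A A C A E C B G F D) (Qd C D G B))"
  by code_simp

lemma blockAB: "block A B
(Sp B D G (Hx B D G C E A) (Us A A G A B C D E F G) (Us A A A B D E G A C F) (Hx B D G A C E))
(Sp C D G (Qd C D G B) (Us A A A G B C D A E F) (Sp D E G (Hx G D E A B C) (Us A A G A G C D E F B) (Us A A E A C E B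
   G F D) (Hx G D E A B C)) (Qd C D G B))
(Sp E F G (Qd E F G D) (Qd E F G D) (Hx G E F D A B) (Us A A A E D F G A B C))
(Sp D F G (Us A B C C B A D E F G) (Hx G D F E B A) (Us A B C A B C D E F G) (Us A A A D E F G A B C))
(Sp A E F (Qd A E F D) (Hx A E F D G C) (Us A A A A D E F B C G) (Qd A E F D))
(Sp A D E (Us A A A E A B D C F G) (Hx E A D B G C) (Hx E A D G B C) (Qd A D E B))
(Sp C D F (Us A A A F A C D B E G) (Qd C D F A) (Us A A A D C E F A B G) (Qd C D F A))"
  by code_simp

lemma blockAC: "block A C
(Sp A D F (Hx A D F C B E) (Us A B G A B C D E F G) (Us A B E A B C D E F G) (Hx A D F B C E))
(Sp C D E (Hx E C D F B A) (Qd C D E B) (Xx C E A D B) (Qd C D E B))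
(Sp C D E (Qd C D E B) (Us A A A D B C E A F G) (Xx C E A D B) (Qd C D E B))
(Sp C D G (Qd C D G B) (Qd C D G B) (Us A A E A E B G D F C) (Xx G C E D B))
(Sp D E G (Qd D E G B) (Us A A A E B D G A C F) (Sp B C G (Us A C D F B C D E A G) (Us A B A A G E C B F D) (Qd B C G
   E) (Us A C D A B C D E F G)) (Qd D E G B))
(Sp B D G (Hx B D G C E A) (Us A C E A B C D E F G) (Us A A A B D E G A C F) (Hx B D G A C E))
(Sp B D F (Hx B D F A C E) (Qd B D F E) (Qd B D F E) (Xx B D C F E))"
  by code_simp

lemma blockAD: "block A D
(Sp B D F (Qd B D F E) (Qd B D F E) (Us A A A F B D E A C G) (Xx B D C F E))
(Sp D E G (Qd D E G B) (Qd D E G B) (Hx E G D B A F) (Us A A A E D F G A B C))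
(Sp D E G (Qd D E G B) (Qd D E G B) (Qd D E G F) (Qd D E G F))
(Sp D E G (Qd D E G B) (Qd D E G B) (Us A A A D C E G A B F) (Qd D E G C))
(Sp E F G (Qd E F G C) (Sp B E G (Xx E G B F C) (Us A A E A E G B C D F) (Xx E G B F C) (Us A A A E B F G A C D)) (Us A
   A A F C E G A B D) (Qd E F G C))
(Sp B E G (Qd B E G C) (Us A A A G B C E A D F) (Qd B E G C) (Us A D E A G C D E B F))
(Sp C D E (Hx E C D G B A) (Qd C D E B) (Xx C E A D B) (Qd C D E B))"
  by code_simp

lemma blockAE: "block A E
(Sp B F G (Hx B F G D C E) (Us A C D A B G F C D E) (Hx B F G D C E) (Us A D A A E C G B F D))
(Sp E F G (Qd E F G C) (Qd E F G B) (Qd E F G B) (Xx E G C F B))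
(Sp D E G (Qd D E G F) (Us A B A A E F B D C G) (Qd D E G F) (Us A A A D E F G A B C))
(Sp B F G (Hx G B F C D E) (Hx G B F C D E) (Us A B B C G B F D A E) (Us A A A G B E F A C D))
(Sp D E G (Qd D E G B) (Us A A A D B E G A C F) (Qd D E G B) (Us A D F A G E C F B D))
(Sp A B F (Hx F A B E C D) (Us A D F C E A G F B D) (Us A A A A B E F C D G) (Hx F A B E C D))
(Sp D F G (Us A D F B E D C F G A) (Us A D A C F A G D E B) (Us A D A B F A G D E C) (Us A A A D E F G A B C))"
  by code_simp

lemma blockAF: "block A F
(Sp B D F (Qd B D F A) (Xx D E A B F) (Xx D E A F B) (Qd B D F A))
(Sp B E G (Qd B E G D) (Us A E G D A F E G B C) (Us A A A E B D G A C F) (Qd B E G D))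
(Sp B D G (Hx B D G C E A) (Us A F B A B C D E F G) (Us A A A D B E G A C F) (Hx B D G A C E))
(Sp D E G (Us A A A D A E G B C F) (Us A F C A B C D E F G) (Qd D E G A) (Qd D E G A))
(Sp B D G (Hx B D G A C E) (Us A F B A B E D G F C) (Us A D F A E D F G C B) (Hx B D G A C E))
(Sp B F G (Qd B F G E) (Qd B F G E) (Us A E A A F E C B G D) (Us A A A F B E G A C D))
(Sp E F G (Qd E F G C) (Sp B E G (Us A E F E A D F G B C) (Us A E F E C D F G B A) (Us A F F A B C D E F G) (Us A A A
   E B F G A C D)) (Us A A A F C E G A B D) (Qd E F G C))"
  by code_simp

lemma blockAG: "block A G
(Sp E F G (Qd E F G C) (Us A E F F B C D E G A) (Qd E F G C) (Us A A A F D E G A B C))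
(Sp E F G (Qd E F G C) (Sp B C G (Us A B E G A E F C D B) (Sp D E G (Qd D E G F) (Us A G A A D C F G E B) (Us A F B A C
   E F G B D) (Qd D E G F)) (Us A B G C A B E F G D) (Us A B F C F E D G A B)) (Qd E F G C) (Us A D F A G F B D C
   E))
(Sp D F G (Hx D F G C E B) (Hx D F G B C E) (Us A G B A B C D E F G) (Us A G A A B C D E F G))
(Sp A E F (Us A D F C A E D B F G) (Hx A E F G B C) (Hx A E F G B C) (Us A G B C D B A F E G))
(Sp C D G (Us A C D F C G E B A D) (Us A F B A B E D G F C) (Us A D F A D C F E G B) (Us A C D A C G E B F D))
(Sp C D E (Qd C D E B) (Us A A A C B D E A F G) (Qd C D E B) (Sp B D G (Hx B D G C E A) (Us A G E A B C D E F G) (Us A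
   F B A E G C B F D) (Hx B D G A C E)))
(Sp B D E (Us A B F E B A D C F G) (Us A A A B C D E A F G) (Us A B C A G F B C D E) (Us A G F A B C D E F G))"
  by code_simp

lemma blockBA: "block B A
(Sp B D F (Hx B D F A C E) (Us A G C A C B G D E F) (Us A E C C G A D E B F) (Hx B D F A C E))
(Sp C D E (Qd C D E A) (Qd C D E A) (Hx E C D A B G) (Xx C E B D A))
(Sp A B G (Us A D F D E A F G B C) (Us A G F C A E G B F D) (Us A A A A B E G C D F) (Hx A B G E D C))
(Sp A B E (Qd A B E C) (Us A B F A B C D E F G) (Qd A B E C) (Us B A C A B C D E F G))
(Sp D E F (Us A D C A B G D C F E) (Us A F B A B D C E G F) (Us A E E A F G D C B E) (Sp B E G (Us A B E E A D C B F
   G) (Us A B F B C D F E A G) (Us A G G A E B G D F C) (Sp C D E (Qd C D E B) (Qd C D E B) (Qd C D E F) (Sp B E F (Qd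
   B E F C) (Us A A A E B C F A D G) (Us B A A A B C D E G F) (Qd B E F C)))))
(Sp C D F (Hx F C D E B A) (Us A D F A F C G B D E) (Us B A E A B C D E F G) (Hx F C D E B A))
(Sp E F G (Qd E F G B) (Us A A A E B F G A C D) (Qd E F G B) (Sp B D F (Hx F B D G E C) (Hx F B D G C E) (Us A G F C E
   B G F A D) (Sp B D G (Hx B D G A C F) (Us A G F F B G D C A E) (Us A D F A F B C G D E) (Us A A A B D F G A C
   E))))"
  by code_simp

lemma blockBB: "block B B
(Sp D E G (Us B A E C E B G D F A) (Us A E E A E C G B F D) (Us A G B A C E F G B D) (Us A F B A F G B D C E))
(Sp B F G (Qd B F G E) (Qd B F G E) (Us A G F C F E G B A D) (Us A A A F B E G A C D))
(Sp B D F (Hx B D F A C E) (Us A G B A G C D E B F) (Us A G A A G C D E B F) (Hx B D F A C E))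
(Sp B E F (Qd B E F C) (Qd B E F C) (Us A G F C E G F B A D) (Us A A A E B F G A C D))
(Sp D E F (Sp A E F (Hx E F A D G C) (Hx E F A D G C) (Us A E F E A B G F D C) (Us B B B C F B A E G D)) (Us A G F C E
   G F D A B) (Us B B B A F B C E G D) (Us A A A E D F G A B C))
(Sp D E G (Qd D E G B) (Us A A A D B E G A C F) (Qd D E G B) (Sp E F G (Qd E F G C) (Us B B D A B C D E F G) (Qd E F G
   C) (Us B B E A B C D E F G)))
(Sp D E F (Us A D C A C G E B D F) (Us A E E A D G E B C F) (Us A F B A C E B F G D) (Sp C D F (Qd C D F B) (Us A A A
   F B C D A E G) (Sp B E F (Qd B E F C) (Qd B E F C) (Qd B E F D) (Us A G C A B C D E F G)) (Qd C D F B)))"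
  by code_simp

lemma blockBC: "block B C
(Sp C D E (Qd C D E B) (Qd C D E B) (Sp D E G (Qd D E G C) (Us A F B A B D C E F G) (Qd D E G C) (Sp B E G (Qd B E G C)
   (Us A A A E B C G A D F) (Sp B E F (Hx B E F D C G) (Hx B E F G D C) (Sp D E F (Us A B F D E A F B G C) (Us A A A E
   B D F A C G) (Us B A D E C B G D A F) (Us A B C A C G E B F D)) (Us B A A A B C D E F G)) (Qd B E G C))) (Us A D
   F A E C F G B D))
(Sp B D E (Us A G B F A B G D C E) (Us A E E A B F D C G E) (Us B C A A B C D E F G) (Us A F B A G D C E F B))
(Sp C D G (Hx G C D E B A) (Us A D F A G C F B D E) (Us B C B A B C D E F G) (Hx G C D E B A))
(Sp B C G (Hx B C G D E A) (Us B C C A B C D E F G) (Us A A A C B E G A D F) (Hx B C G A D E))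
(Sp C D G (Qd C D G E) (Us A F E A B C D E F G) (Us A A A D C E G A B F) (Qd C D G E))
(Sp A B G (Qd A B G E) (Qd A B G E) (Us A A A A B E G C D F) (Hx A B G E D C))
(Sp E F G (Qd E F G C) (Us B B E A C D F E B G) (Us A A A F C E G A B D) (Qd E F G C))"
  by code_simp

text \<open>The long tree refutes \<open>rule B D F\<close>, where AB swaps C and D, AC swaps E and
  G, and AEG and CEG both have colour B. A split on CEG then removes its literal and gives
  \<open>rule B D G\<close>.\<close>

lemma blockBD: "block B D
(Sp A F G (Qd A F G C) (Us A A A F A C G B D E) (Qd A F G C) (Sp A E F (Us A B C C G D E A B F) (Hx A E F B G C) (Hx A
   E F G B C) (Us B B B D E C B A F G)))
(Sp B E G (Qd B E G C) (Qd B E G C) (Us B C B C E B G D A F) (Us A D F A E B C F G D))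
(Sp B E F (Qd B E F C) (Qd B E F C) (Us A D F A F B G D C E) (Sp C F G (Us A B E F A E B C D G) (Us A B F C B E D F A
   G) (Us B B G A B C D E F G) (Us A F G A B C D E F G)))
(Sp B F G (Hx B F G C D E) (Hx B F G C D E) (Us B C A A E B G D C F) (Us A D F A F B C E G D))
(Sp D E G (Us B A F C E B G D F A) (Us A G F C B D F E A G) (Us B D D A B C D E F G) (Us A E C A G C D E B F))
(Sp A C F (Hx A C F B G E) (Sp B C E (Sp A B E (Qd A B E C) (Sp A D E (Us A D F F B A G D C E) (Hx E A D G B C) (Hx E A
   D G B C) (Sp B D E (Qd B D E A) (Us A F B F E A B D G C) (Qd B D E A) (Sp A D G (Hx A D G B C E) (Us A F F F E D B
   C A G) (Us A E C C B F D E A G) (Hx A D G B C E)))) (Qd A B E C) (Sp B E G (Us A A A E A B G C D F) (Us A D F D G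
   E F B C A) (Sp B D E (Us A F F F B C D E A G) (Hx E B D C G A) (Hx E B D C G A) (Sp A D E (Us A C D F B E C A G D)
   (Us A F B F C E B A G D) (Us A E B F A B G C D E) (Sp A D G (Hx A D G B C E) (Us A B F G E D B A F C) (Us A B G A
   C G E B D F) (Hx A D G B C E)))) (Xx E G B A C))) (Sp C D E (Hx E C D G B A) (Us A A A C B D E A F G) (Hx E C D G
   B A) (Sp B D E (Qd B D E C) (Us A A A B C D E A F G) (Qd B D E C) (Sp A D E (Xx D E A C B) (Sp D E G (Xx E G D C A)
   (Us A A F A B C D E F G) (Us A A D A B C D E F G) (Xx E G D C A)) (Xx D E A C B) (Sp A D G (Hx A D G B E C) (Sp D E
   G (Qd D E G A) (Us A A F A B C D E F G) (Us A A D A B C D E F G) (Qd D E G A)) (Sp D E G (Us A A A D A E G B C F)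
   (Us A A F A B C D E F G) (Qd D E G A) (Qd D E G A)) (Hx A D G B C E))))) (Sp C E F (Hx C E F G B A) (Sp B C F (Hx B
   C F A D E) (Sp B E F (Qd B E F C) (Us A A A E B C F A D G) (Sp B D E (Us A C B A B C D E F G) (Us A C C A B C D E
   F G) (Us A B A A B C D E G F) (Sp B E G (Hx B E G F C D) (Hx B E G F C D) (Us A C F A B C D E F G) (Sp B D G (Hx B
   D G A C E) (Sp D E F (Us A C G A B C D E F G) (Us A D A A B C D E F G) (Us A C D A E D F C G B) (Sp E F G (Hx E F
   G C B D) (Sp B C G (Hx B C G F D E) (Us A C E A B E D G F C) (Us A B F B E D F G A C) (Sp B F G (Qd B F G E) (Qd B
   F G E) (Sp D F G (Us A D C A B C D E F G) (Us A D A A B E D G F C) (Sp C F G (Hx F G C D B E) (Sp C D F (Us A D C A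
   B E D G F C) (Us A B F D C E B F A G) (Sp C D E (Qd C D E B) (Qd C D E B) (Qd C D E F) (Sp C D G (Qd C D G B) (Qd C
   D G B) (Us A D D A B C D E F G) (Us A B F C G B F D A E))) (Us A C D A C D F G E B)) (Hx G C F E B A) (Hx F G C E
   D B)) (Us A C D A G D F E C B)) (Us A A A G B E F A C D))) (Hx E F G C B D) (Us A D B A B C D E F G))) (Sp D E G
   (Qd D E G B) (Us A A A D B E G A C F) (Qd D E G B) (Sp D E F (Us A C G A B C D E F G) (Us A D A A B C D E F G) (Us
   A C D A E D F C G B) (Us A B A C E B F D A G))) (Hx B D G A C E)))) (Qd B E F C)) (Us A A A C B E F A D G) (Hx B
   C F A D E)) (Hx C E F G B A) (Sp B C F (Hx B C F A D E) (Sp B D E (Us A D G A B C D E F G) (Us A C C A B C D E F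
   G) (Sp B D F (Hx B D F A C E) (Sp B E F (Qd B E F C) (Qd B E F C) (Us A D F A F B G D C E) (Sp D E F (Qd D E F B) (Qd
   D E F B) (Us A F B A C E B F G D) (Sp C D F (Qd C D F B) (Us A A A F B C D A E G) (Sp C F G (Hx C F G D E A) (Hx C
   F G A D E) (Us A G C A B C D E F G) (Us A F G A B C D E F G)) (Qd C D F B)))) (Sp B E F (Qd B E F C) (Qd B E F C)
   (Us A A A B D E F A C G) (Sp D E F (Qd D E F B) (Us A A A D B E F A C G) (Qd D E F B) (Sp B F G (Hx B F G D E C) (Hx
   B F G C D E) (Sp B E G (Sp A B E (Hx B E A G F C) (Hx B E A G C F) (Us A G D A B C D E F G) (Us A A A E A B G C D
   F)) (Us A G D C B A D E F G) (Sp B D G (Hx B D G F E A) (Sp D E G (Qd D E G B) (Qd D E G B) (Sp C D E (Hx D E C G B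
   F) (Hx D E C G B F) (Sp D F G (Qd D F G B) (Qd D F G B) (Us A G C A B E F G D C) (Xx D F E G B)) (Us A C E A E B G
   D F C)) (Us A F B A F G B D C E)) (Us A D F A D B C E F G) (Us A D F A D B C F E G)) (Us A D F A E B C F G D))
   (Sp B E G (Sp E F G (Us A E D D B C F G A E) (Us A A A F B E G A C D) (Qd E F G B) (Qd E F G B)) (Us A E E A B D F
   E C G) (Us A D F A F B C E G D) (Us A A A B E F G A C D))))) (Hx B D F A C E)) (Sp A D E (Us A E B F B A G D C E)
   (Us A C C B A C D E G F) (Sp A B E (Qd A B E C) (Qd A B E D) (Sp A D F (Hx A D F B C E) (Sp C D F (Us A A A F A C D
   B E G) (Qd C D F A) (Sp C F G (Hx C F G B D E) (Hx C F G B D E) (Sp B C G (Hx C G B E F A) (Sp B E G (Qd B E G C) (Qd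
   B E G C) (Us A C F A B C D E F G) (Sp B D G (Hx B D G C E A) (Us A C E A B E D G F C) (Sp D E G (Qd D E G B) (Us A
   A A D B E G A C F) (Qd D E G B) (Sp E F G (Qd E F G C) (Us A E D A B C D E F G) (Qd E F G C) (Sp C D E (Qd C D E B)
   (Qd C D E B) (Us A B G C A F E G D B) (Sp C D G (Qd C D G E) (Xx G C B E D) (Qd C D G E) (Hx G C D E B A))))) (Hx B
   D G A C E))) (Sp B E G (Qd B E G C) (Us A A A G B C E A D F) (Qd B E G C) (Sp E F G (Qd E F G C) (Sp B E F (Qd B E F
   C) (Qd B E F C) (Sp D E F (Hx E F D G B C) (Us A D F A F E C B D G) (Hx E F D G B C) (Sp B D G (Hx B D G E A C) (Us
   A B F B E D F G A C) (Us A E E A B C D E F G) (Hx B D G A C E))) (Us A A A E B F G A C D)) (Qd E F G C) (Sp D E G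
   (Hx E G D C F B) (Us A B C A C F E D G B) (Hx E G D C F B) (Sp B D G (Hx B D G C E A) (Us A E A A G C D E B F) (Sp
   C D E (Hx E C D G F B) (Qd C D E B) (Us A B G C A F E G D B) (Sp C D G (Qd C D G E) (Us A E D A D C B E F G) (Qd C
   D G E) (Hx G C D E F A))) (Hx B D G A C E))))) (Hx C G B E F A)) (Sp E F G (Qd E F G C) (Sp B E F (Qd B E F C) (Qd B
   E F C) (Sp D E F (Hx E F D G B C) (Us A B C A C G E F B D) (Hx E F D G B C) (Sp D F G (Hx D F G E A C) (Hx D F G A
   C E) (Us A E A A F C D E G B) (Us A E C A B C D E F G))) (Sp B E G (Us A D F C G E D B A F) (Us A D F A G E D B C
   F) (Us A C F A B C D E F G) (Us A A A E B F G A C D))) (Us A A A F C E G A B D) (Qd E F G C))) (Qd C D F A)) (Sp A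
   E F (Us A E F A B C D E F G) (Hx A E F G D C) (Us A A A A D E F B C G) (Sp A B F (Hx F A B D E C) (Sp D E F (Us A A
   A D A E F B C G) (Qd D E F A) (Qd D E F A) (Sp A F G (Hx A F G B D E) (Hx A F G B D E) (Sp A B G (Hx G A B E F C)
   (Sp A D G (Hx A D G B F E) (Hx G A D E F C) (Sp B E G (Us A B F A E F B G C D) (Qd B E G A) (Us A C F A B C D E F
   G) (Sp D E G (Us A D F B A D C E F G) (Us A B C A C F E D G B) (Qd D E G A) (Us A E G A B C D E F G))) (Hx G A D E
   F C)) (Hx A B G D E C) (Hx G A B E F C)) (Sp E F G (Us A B F A E B G F C D) (Sp B E F (Us A B F F B D A E C G) (Qd
   B E F A) (Us A F A A B C D E F G) (Sp B E G (Us A D F C G E D B A F) (Us A E F E C A F G B D) (Us A C F A B C D E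
   F G) (Us A A A E B F G A C D))) (Qd E F G A) (Qd E F G A)))) (Hx A B F D C E) (Hx A B F D C E))) (Hx A D F B C E))
   (Sp A B G (Us A D F D E A F G B C) (Sp B E G (Us A A A E A B G C D F) (Qd B E G A) (Us A C F A B C D E F G) (Qd B E
   G A)) (Us A A A A B E G C D F) (Hx A B G D E C))) (Sp A D G (Hx A D G B C E) (Sp D E G (Qd D E G A) (Us A F C A B C
   D E F G) (Sp C D G (Xx G D C E A) (Sp C D E (Qd C D E B) (Qd C D E B) (Xx C A E G D) (Us A F E A B C D E F G)) (Us A
   D D A B G D C F E) (Xx G D C E A)) (Qd D E G A)) (Us A F D A B C D E F G) (Hx A D G B C E)))) (Sp B E F (Qd B E F
   C) (Us A A A B C E F A D G) (Qd B E F C) (Sp C F G (Hx C F G B E A) (Hx C F G A B E) (Sp B C G (Hx C G B E F A) (Sp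
   B E G (Qd B E G C) (Qd B E G C) (Sp B D E (Hx E B D G C F) (Hx E B D G C F) (Sp B D F (Hx B D F A C E) (Us A E A A B
   C D E F G) (Sp D E F (Qd D E F B) (Us A A A D B E F A C G) (Qd D E F B) (Sp B D G (Hx B D G F E A) (Sp C D E (Hx E C
   D G B A) (Xx B G D E C) (Sp D E G (Qd D E G B) (Qd D E G B) (Us A D B A E F D G B C) (Us A B A C E B G D A F)) (Xx
   B G D E C)) (Us A D F A D B C E F G) (Sp B F G (Us A E B A B C D E F G) (Us A C D A B G F C D E) (Us A D F A D B
   C F E G) (Us A D F A F B C E G D)))) (Hx B D F A C E)) (Us A C F A B C D E F G)) (Sp B F G (Us A C C C B F E G A
   D) (Us A D F A E B D F G C) (Sp B D F (Hx F B D G E C) (Hx F B D G C E) (Sp B D E (Us A D G A B C D E F G) (Us A C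
   C A B C D E F G) (Us A D F A E B C F G D) (Sp B D G (Hx B D G A C E) (Us A C E A B E D G F C) (Us A D F A E B C G
   F D) (Hx B D G A C E))) (Sp B D E (Hx B D E A C F) (Us A C C A B C D E F G) (Hx B D E A C F) (Sp B D G (Hx B D G A
   C E) (Us A C E A B E D G F C) (Us A D F A D B C G E F) (Us A A A B D F G A C E)))) (Us A A A B E F G A C D))) (Us
   A D F A B C D E F G) (Hx C G B E F A)) (Us A D E A B C D E F G))) (Hx B C F A D E))) (Sp B C G (Hx B C G D E A)
   (Sp B E G (Qd B E G C) (Us A A A E B C G A D F) (Sp A B G (Xx G B A E C) (Sp A D G (Sp B D G (Us A A A G A B D C E
   F) (Us A B B A B C D E F G) (Qd B D G A) (Qd B D G A)) (Hx G A D E B C) (Sp B D G (Qd B D G A) (Sp C D G (Qd C D G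
   B) (Us A A A G B C D A E F) (Sp D E G (Sp A D E (Sp B D E (Us A B A C E G B D F A) (Us A A E A C E G B F D) (Qd B D
   E G) (Qd B D E G)) (Qd A D E G) (Qd A D E G) (Us A A A D A E G B C F)) (Us A A C A E C G B F D) (Us A A E A C E B
   G F D) (Sp B D E (Qd B D E G) (Us A A E A C E G B F D) (Sp A D E (Xx D E A B G) (Qd A D E G) (Sp A B E (Hx B E A G D
   C) (Hx E A B G D C) (Sp C D E (Qd C D E A) (Qd C D E A) (Sp A D F (Hx A D F B G E) (Sp C D F (Us A A A F A C D B E
   G) (Qd C D F A) (Sp D E F (Xx D E F C A) (Xx D E F C A) (Us A A A D C E F A B G) (Us A B D A B C D E F G)) (Qd C D
   F A)) (Sp D E F (Us A A A D A E F B C G) (Sp B E F (Hx B E F G A C) (Hx B E F G A C) (Us A A A E B D F A C G) (Us A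
   B C A C G E D F B)) (Us A B E A B C D E F G) (Us A B D A B C D E F G)) (Hx A D F B G E)) (Qd C D E G)) (Xx B D E
   G A)) (Qd A D E G)) (Qd B D E G))) (Qd C D G B)) (Sp B D E (Sp A B E (Hx B E A D G C) (Us A B F A B C D E F G) (Hx B
   E A D G C) (Us A A E C E A B G F D)) (Us A A D A C E G B F D) (Sp D E G (Qd D E G B) (Us A A A G B D E A C F) (Qd
   D E G B) (Sp A D E (Xx D E A G B) (Qd A D E G) (Sp A B E (Hx B E A G D C) (Hx E A B G D C) (Sp C D E (Qd C D E A) (Qd
   C D E A) (Sp B E F (Hx B E F G D C) (Hx B E F G D C) (Sp D E F (Us A B F D E A F B G C) (Us A A A E B D F A C G)
   (Us A C A A B C D E F G) (Us A B C A C G E B F D)) (Sp A E F (Us A B E A C G E B F D) (Hx A E F G D C) (Hx A E F G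
   D C) (Sp D E F (Us A B C B C G E D F A) (Us A B C A C G E D F B) (Us A C A A B C D E F G) (Sp D F G (Us A B C C B
   A D E F G) (Us A A E A G B D E C F) (Us A B F G D C F E A B) (Us A A A D E F G A B C))))) (Xx E C G D B)) (Xx G D
   E B A)) (Qd A D E G))) (Us A A A B D E G A C F)) (Qd B D G A)) (Hx G A D E B C)) (Sp A B E (Qd A B E G) (Sp A D E
   (Sp B D E (Us A A A E A B D C F G) (Sp C D E (Qd C D E A) (Us A A A D B C E A F G) (Qd C D E A) (Us A A D A D B E C
   F G)) (Qd B D E A) (Qd B D E A)) (Hx E A D G B C) (Hx E A D G B C) (Sp B D E (Qd B D E A) (Sp B D G (Xx B D G E A)
   (Us A A F A C E G B F D) (Us A A D A C E G B F D) (Xx B D G E A)) (Qd B D E A) (Us A B A A B C D E F G))) (Qd A B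
   E G) (Us A A A A B E G C D F)) (Xx G B A E C)) (Qd B E G C)) (Us A A A C B E G A D F) (Hx B C G A D E))) (Sp B C E
   (Sp A D E (Us A G E F A B D C G E) (Us A F B F C E B A G D) (Us B A B A B C D E F G) (Sp A D G (Hx A D G B C E) (Us
   A G F D A C G E F B) (Sp D E G (Us A B F A E B G D F C) (Sp B D E (Us B A D A B C D E F G) (Us A D F F D B G C E
   A) (Us A D G A B D C E F G) (Us A F C A B C D E F G)) (Qd D E G A) (Qd D E G A)) (Hx A D G B C E))) (Us A G G A B
   C D E F G) (Sp C E F (Hx C E F G B A) (Sp B C F (Hx B C F A D E) (Sp B D E (Us A C B A B C D E F G) (Us A G F A C E
   F B G D) (Us A E C A D G E B C F) (Us B A F A B C D E F G)) (Us A A A C B E F A D G) (Hx B C F A D E)) (Hx C E F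
   G B A) (Sp B C F (Hx B C F A D E) (Sp C F G (Hx C F G B E A) (Hx C F G B A E) (Sp B C G (Hx B C G F D E) (Sp B D E
   (Us A D G A B C D E F G) (Us A C C A B C D E F G) (Sp B E G (Qd B E G C) (Qd B E G C) (Sp B D F (Hx B D F C E A) (Us
   B B G A B C D E F G) (Sp B E F (Qd B E F C) (Qd B E F C) (Us A A A B D E F A C G) (Sp B F G (Hx B F G C D E) (Hx B
   F G C D E) (Us B B A A B C D E F G) (Us A D F A F B C E G D))) (Hx B D F A C E)) (Us B B C A B C D E F G)) (Sp B
   E G (Qd B E G C) (Qd B E G C) (Us A G G A E B G D F C) (Sp B D G (Hx B D G A C E) (Us A C E A B E D G F C) (Us B B
   F A B C D E F G) (Hx B D G A C E)))) (Sp B E G (Qd B E G C) (Us A A A G B C E A D F) (Qd B E G C) (Sp B D E (Us A D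
   G A B C D E F G) (Us A C C A B C D E F G) (Us B B C A B C D E F G) (Sp B D G (Hx B D G E A C) (Us A G F D G C B E
   A F) (Us B B F A B C D E F G) (Hx B D G A C E)))) (Hx C G B E F A)) (Sp E F G (Qd E F G C) (Sp B E F (Qd B E F C)
   (Qd B E F C) (Sp B D E (Us A D G A B C D E F G) (Us A C C A B C D E F G) (Us A G G C B E D F A G) (Sp B E G (Hx B E
   G F C D) (Hx B E G F C D) (Us A G G A E B G D F C) (Us B B B A B C D E G F))) (Sp B E G (Us A E F E A C F G B D)
   (Us A D F A G E D B C F) (Sp B D E (Hx E B D G F C) (Hx E B D G C F) (Us B B B A B C D E F G) (Us A G G A E B G D
   F C)) (Us A A A E B F G A C D))) (Us A A A F C E G A B D) (Qd E F G C))) (Sp B E F (Qd B E F C) (Us A A A B C E F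
   A D G) (Qd B E F C) (Sp B C G (Hx B C G F E A) (Sp B E G (Qd B E G C) (Qd B E G C) (Sp B D E (Hx E B D G C F) (Hx E B
   D G C F) (Sp B D F (Hx B D F E A C) (Us A G F D B C F E A G) (Sp B F G (Sp C F G (Hx G C F E B A) (Qd C F G B) (Us A
   E B A B C D E F G) (Us A D F A F C D E G B)) (Us A G E A B C F E D G) (Us B B A A B C D E F G) (Us A D F A F B C
   E G D)) (Hx B D F A C E)) (Us A C F A B C D E F G)) (Sp B F G (Us A G F C B E F G D A) (Us A D F A E B D F G C)
   (Us B A G A B C D E F G) (Us A A A B E F G A C D))) (Us A D F A B C D E F G) (Us A F E A G E C B D F))) (Hx B C F
   A D E))) (Sp B C G (Us A D F D E C F G B A) (Sp C D G (Hx G C D E B A) (Us A D F A G C F B D E) (Sp B D E (Us A G B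
   F A B G D C E) (Us A E E A B F D C G E) (Sp C D E (Qd C D E B) (Qd C D E B) (Sp D E G (Qd D E G C) (Us A F B A B D
   C E F G) (Qd D E G C) (Sp B E G (Qd B E G C) (Us A A A E B C G A D F) (Sp B E F (Hx B E F G D C) (Hx B E F G D C)
   (Sp C E F (Hx C E F D G A) (Us A C F A B C D E G F) (Hx C E F G D B) (Sp D E F (Us A B F D E A F B G C) (Us A A A E
   B D F A C G) (Us A G F B E D F C A G) (Us A B C A C G E B F D))) (Us B A A A B C D E F G)) (Qd B E G C))) (Us A D
   F A E C F G B D)) (Us A F B A G D C E F B)) (Hx G C D E B A)) (Us A A A C B E G A D F) (Hx B C G D E A))) (Sp B C
   E (Sp A D E (Us A G E F A B D C G E) (Us A F B F C E B A G D) (Us B A B A B C D E F G) (Sp A D G (Us A B F D B E C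
   A F G) (Us A G F D A C G E F B) (Sp A B E (Us A B F A B D C E F G) (Sp B D E (Qd B D E A) (Us A D F F D B G C E A)
   (Qd B D E A) (Us A E C C B F D E A G)) (Qd A B E C) (Us B A C A B D C E F G)) (Us A B E A F E B D C G))) (Us A G G
   A B C D E F G) (Sp B D E (Us A D G A B C D E F G) (Us A C C A B C D E F G) (Sp B C F (Hx B C F A D E) (Sp C E F (Hx
   C E F G B A) (Us A E C A D G E B C F) (Hx C E F G B A) (Sp B D F (Hx B D F C E A) (Us B D C A B C D E F G) (Sp B E
   F (Qd B E F C) (Qd B E F C) (Us A A A B D E F A C G) (Sp B E G (Us A G G C G E A B D F) (Us B B B D B A F E G C)
   (Us B D E A B C D E F G) (Us A E F B G C D E F A))) (Hx B D F A C E))) (Sp B E F (Us A B F E B A F C D G) (Us A A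
   A B C E F A D G) (Us A B C A G D B C F E) (Sp B D F (Hx B D F E A C) (Us A G F D B C F E A G) (Sp B C G (Hx B C G
   F E A) (Sp C E F (Qd C E F B) (Us A A A C B E F A D G) (Qd C E F B) (Sp B F G (Sp B E G (Qd B E G C) (Qd B E G C) (Sp
   C F G (Hx G C F E B A) (Qd C F G B) (Us A E B A B C D E F G) (Us A D F A F C D E G B)) (Us A G F C B E F G D A))
   (Us A G E A B C F E D G) (Us B D B A B C D E F G) (Us A F B A E G C B D F))) (Us B C G A F C D B G E) (Us B C E A
   G E C B D F)) (Hx B D F A C E))) (Hx B C F A D E)) (Sp B E G (Us B B E F C D A E B G) (Us B B E F A D C E B G) (Us
   A G G A E B G D F C) (Sp A D E (Us A E B F B A G D C E) (Us A C C B A C D E G F) (Sp A B E (Qd A B E C) (Qd A B E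
   D) (Sp B C F (Hx B C F A D E) (Sp C E F (Hx C E F G B A) (Sp B E F (Qd B E F C) (Us A A A E B C F A D G) (Sp D E F
   (Us A C G A B C D E F G) (Us A F B A B D C E G F) (Us A G E A C E B F G D) (Sp B D G (Hx B D G C E A) (Sp E F G (Hx
   E F G B D C) (Sp B C G (Hx B C G A D E) (Us A C E A B E D G F C) (Us A E F G F D C E B A) (Us B B G A E B F D G
   C)) (Hx E F G C B D) (Us A D B A B C D E F G)) (Us A E C C F A D E B G) (Hx B D G A C E))) (Qd B E F C)) (Hx C E F
   G B A) (Sp B D G (Hx B D G C E A) (Sp B C G (Hx B C G F D E) (Us A C E A B E D G F C) (Us A G F D G C B E A F) (Sp
   C F G (Hx G C F E A B) (Us A G F E C G F B A D) (Hx G C F E A B) (Us B C G A B C D E F G))) (Sp B E F (Qd B E F C)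
   (Qd B E F C) (Sp C F G (Us B D A A B C D E F G) (Sp B F G (Sp B C G (Hx B C G A D E) (Hx G B C F D E) (Qd B C G F)
   (Qd B C G F)) (Us A B F B F D C G A E) (Us B C B C G B F D A E) (Us A D F A G B C E F D)) (Us B B F A B C D E F
   G) (Us B C G A B C D E F G)) (Sp B F G (Us B C E C A G E B D F) (Us B C E A C G E B D F) (Us A D F A E B C G F D)
   (Us A A A B E F G A C D))) (Hx B D G A C E))) (Sp B E F (Us A B F E B A F C D G) (Us A A A B C E F A D G) (Us A B
   C A G D B C F E) (Sp B C G (Hx B C G D A E) (Sp B D G (Hx B D G A C E) (Us A C E A B E D G F C) (Us A E F B F C D
   E G A) (Hx B D G A C E)) (Us A E F C F A G B E D) (Us B C E A G E C B D F))) (Hx B C F A D E)) (Us B C F A B C D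
   E F G)) (Sp A D G (Hx A D G B C E) (Sp D E G (Us A B F A E B G D F C) (Us A F C A B C D E F G) (Sp C D E (Qd C D E
   B) (Qd C D E B) (Xx E G D A C) (Us B C E A B C D E F G)) (Qd D E G A)) (Us A F D A B C D E F G) (Hx A D G B C
   E))))) (Us B C D A B C D E F G)))
(Sp C E G (Us A A A C A E G B D F) (Us B D F A B C D E F G) (Qd C E G A) (Qd C E G A))"
  by code_simp

lemma blockBE: "block B E
(Sp A E F (Qd A E F D) (Qd A E F D) (Us A A A A D E F B C G) (Sp E F G (Us A D F B F E C G A D) (Xx E F G D A) (Us B B
   B B G A C E D F) (Us A A A E D F G A B C)))
(Sp D E G (Qd D E G A) (Qd D E G A) (Us A G G A G E C D B F) (Us B E A A B C D E F G))
(Sp D E F (Us A A A D A E F B C G) (Us A B C C G B D A F E) (Us A B F E D C F A B G) (Sp A D G (Hx A D G F E B) (Us B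
   E B A B C D E F G) (Us A E F A F C G D E B) (Us B C E C G E A D B F)))
(Sp C D G (Qd C D G E) (Qd C D G E) (Us A A A C D E G A B F) (Us A E F C F A E D G B))
(Sp A F G (Hx G A F E C D) (Hx G A F E C D) (Us B D G A C G E D B F) (Us A F B B G D A F C E))
(Sp A D F (Hx A D F B C E) (Sp A E F (Hx A E F G D C) (Hx A E F G D C) (Us B D G A C E G D B F) (Sp C D E (Qd C D E A)
   (Qd C D E A) (Sp D E F (Qd D E F A) (Qd D E F A) (Sp C E F (Us B E D B G D F E A C) (Hx C E F G D A) (Us A A A E C D
   F A B G) (Sp C D G (Us A B F C E G F D B A) (Us A B F C E G F D A B) (Sp C D F (Qd C D F E) (Qd C D F E) (Us A A A
   D C E F A B G) (Sp D F G (Sp E F G (Us A F B B A D E F C G) (Us A D C A E B F C D G) (Us A E E A E B F C D G) (Us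
   A F B A D F C G B E)) (Us B C A A D C F G B E) (Us A E E A D B F C E G) (Us A F B A E F C G B D))) (Us A E C A G
   B D C E F))) (Sp D E G (Us A G G C G E A D B F) (Sp A D G (Hx A D G F C E) (Qd A D G E) (Qd A D G E) (Us B E E A B
   C D E F G)) (Us A G G A G E C D B F) (Sp D F G (Us B E D C B E F D A G) (Sp E F G (Us A D F B F E C G A D) (Sp A D
   G (Hx A D G B C E) (Xx E F G D A) (Xx E F G D A) (Us B E E A B C D E F G)) (Qd E F G D) (Us A A A E D F G A B C))
   (Us B C E A C G E D B F) (Us A A A D E F G A B C)))) (Sp D E G (Xx E G D C A) (Xx E G D C A) (Us A A A E C D G A B
   F) (Sp D E F (Qd D E F A) (Qd D E F A) (Us A G G A C E G D B F) (Sp C D F (Us A B F D E F G C B A) (Us A B F D E F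
   G C A B) (Us A G G A E D G F B C) (Us B E D A B C D E F G)))))) (Us B E C A B C D E F G) (Hx A D F B C E))
(Sp C E G (Us A A A C A E G B D F) (Qd C E G A) (Sp A D E (Sp C D E (Qd C D E A) (Us A G G A D C B E F G) (Qd C D E A)
   (Sp B C E (Us A G E F A B D C G E) (Us A F B F D E A B G C) (Xx C E B D A) (Sp D E G (Us B C E B A D C E F G) (Us B
   C E A B D C E F G) (Us A A A E C D G A B F) (Xx E G D C A)))) (Us A D F B C A F E G D) (Us B E F A B C D E F G)
   (Us A F C B D C A E F G)) (Qd C E G A))"
  by code_simp

lemma blockBF: "block B F
(Sp D E G (Hx E G D F B A) (Qd D E G B) (Hx E G D F B A) (Qd D E G B))
(Sp B D G (Us A B E G F C B A D E) (Us B F A A B C D E F G) (Us A B F E B A D G C F) (Hx B D G E A C))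
(Sp E F G (Us A A A E A F G B C D) (Qd E F G A) (Qd E F G A) (Xx E G F A C))
(Sp A F G (Us A C C C A G E F B D) (Us A D F B E A D G F C) (Us B F C A B C D E F G) (Us A A A A E F G B C D))
(Sp B E F (Us A A A E A B F C D G) (Qd B E F A) (Us B D G A E B F D G C) (Qd B E F A))
(Sp A B F (Us B F E A B D C E F G) (Us B F E A B C D E F G) (Us A A A A B E F C D G) (Hx A B F D C E))
(Sp B E F (Qd B E F G) (Qd B E F G) (Us A G G A E B F D G C) (Us A A A E B F G A C D))"
  by code_simp

lemma blockBG: "block B G
(Sp B E F (Hx B E F G D A) (Hx B E F G D A) (Us A G G A E B F D G C) (Us B B B C B A D E F G))
(Sp B C F (Hx C F B E D G) (Sp D E F (Hx F D E A B C) (Us B B G A F C D E B G) (Us A D F A D F G C E B) (Hx F D E A B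
   C)) (Us B B B A E D G C F B) (Hx C F B E G D))
(Sp B D F (Qd B D F A) (Sp D E F (Qd D E F B) (Qd D E F B) (Xx F D A B E) (Xx D E A B F)) (Xx B F D E A) (Qd B D F A))
(Sp C D G (Hx G C D F A E) (Hx G C D F A E) (Us A D F A E C B G F D) (Us A D F A G C B F D E))
(Sp C D E (Us B F F C E F G D A B) (Us B F F C E F G D B A) (Us A D F A E C B F G D) (Us B G D A B C D E F G))
(Sp C F G (Hx F G C E B A) (Us A G G A F G B C D E) (Hx F G C E B A) (Us B B B D F A B G C E))
(Sp B C E (Hx E B C D G A) (Us A A A B C D E A F G) (Hx E B C D G A) (Us B G E A F B G D E C))"
  by code_simp

lemma blockCA: "block C A
(Sp E F G (Us A A A G A E F B C D) (Qd E F G A) (Qd E F G A) (Us B G F A D C B E F G))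
(Sp B C F (Us B F A A F D B C E G) (Us A B C A G E B F D C) (Sp C E F (Hx F C E G B A) (Us A G G G C F E B A D) (Hx F
   C E G B A) (Sp B E F (Hx F B E D A C) (Us B B E D B A F C G E) (Us A G D G F A D C B E) (Hx F B E D A C))) (Us A B
   C A E D F C B G))
(Sp D F G (Qd D F G A) (Us A A A F B D G A C E) (Qd D F G A) (Xx F D G B A))
(Sp B E G (Qd B E G A) (Xx E B C G A) (Qd B E G A) (Hx B E G A C D))
(Sp A E F (Hx A E F B G C) (Hx A E F B G C) (Hx F A E G B C) (Us A F B C F B A E D G))
(Sp A E F (Qd A E F D) (Qd A E F D) (Us A A A A D E F B C G) (Sp A B F (Hx F A B G D E) (Hx F A B G D E) (Sp B E G (Qd B
   E G A) (Qd B E G A) (Us C A A A C D B F G E) (Us A F B C F B A E D G)) (Us A D F C F A D G B E)))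
(Sp A D E (Us A B E E F C D A B G) (Qd A D E G) (Hx D E A B G C) (Qd A D E G))"
  by code_simp

lemma blockCB: "block C B
(Sp A D F (Hx A D F B C G) (Us B F F A G D F C E B) (Us B E G A C G E F B D) (Us A A A A D F G B C E))
(Sp A E F (Hx F A E G D C) (Hx F A E G D C) (Us A A A A D E F B C G) (Us A D F B E A C F G D))
(Sp A E F (Hx F A E G D C) (Hx F A E G D C) (Us A D F B D A C E G F) (Us A D F B E A C G F D))
(Sp C D F (Qd C D F A) (Qd C D F A) (Sp C E F (Hx F C E G D A) (Hx F C E G D A) (Us A G G A F C D E B G) (Us B C B A F
   C D E B G)) (Us B B B B G A E C F D))
(Sp D F G (Qd D F G A) (Us C B B D C A F B G E) (Qd D F G A) (Us A G G A G D F E C B))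
(Sp D E G (Us A A A D A E G B C F) (Qd D E G A) (Qd D E G A) (Us B E B A B C D G E F))
(Sp E F G (Us A A A E A F G B C D) (Qd E F G A) (Qd E F G A) (Us B C G B F C A E D G))"
  by code_simp

lemma blockCC: "block C C
(Sp C D E (Us A A A D A C E B F G) (Qd C D E A) (Qd C D E A) (Us B B B B G A F C D E))
(Sp E F G (Qd E F G A) (Qd E F G A) (Us A A A E C F G A B D) (Us C B E A C B E F D G))
(Sp D E F (Qd D E F C) (Qd D E F C) (Us A A A F C D E A B G) (Hx E F D C G A))
(Sp C D F (Us A G F B C E D F G A) (Us B B B G D A B C E F) (Us A A A C D E F A B G) (Us A E F C G B E F D A))
(Sp B D E (Qd B D E A) (Us B E A A F G B D C E) (Qd B D E A) (Us B C D A B D C E F G))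
(Sp B E F (Hx B E F A G C) (Us B C A A C E G F D B) (Hx B E F A G C) (Us C B B E D A B G F C))
(Sp A D G (Hx G A D F C E) (Hx G A D F C E) (Us C B F A B C F D E G) (Us A A A A D F G B C E))"
  by code_simp

lemma blockCD: "block C D
(Sp A E F (Hx A E F G C D) (Us C C G A B C D E F G) (Hx A E F D G C) (Us A E F A D C E F G B))
(Sp C F G (Qd C F G A) (Qd C F G A) (Us A E B B C A D G E F) (Us A C C A C E G F B D))
(Sp A E F (Hx F A E G C D) (Qd A E F C) (Us C D B A B C D E F G) (Us A D F B E A D G F C))
(Sp C E F (Us A G E B A C G E D F) (Us C D C A B C D E F G) (Sp C D E (Hx E C D F G A) (Hx E C D F G A) (Us C C B A B
   E G C D F) (Us C B D A B C F D G E)) (Us A F B B G F A C D E))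
(Sp B F G (Qd B F G C) (Us A A A F B C G A D E) (Qd B F G C) (Us B E G C F B G E A D))
(Sp B C G (Hx B C G E D F) (Us C D E A B C E D F G) (Us C D E A B C D E F G) (Us A A A C B F G A D E))
(Sp C D E (Qd C D E A) (Qd C D E G) (Qd C D E A) (Qd C D E G))"
  by code_simp

lemma blockCE: "block C E
(Sp D E F (Hx F D E G A B) (Us B G D C A F E D G B) (Hx F D E G A B) (Us A D F A D F C G B E))
(Sp D E F (Us A G F B F G D E C A) (Us B B B C D A B F G E) (Us A G F B F G D E A C) (Us A A A F D E G A B C))
(Sp E F G (Us A G G C E G A F D B) (Us A G G C G F E B A D) (Us B B B D F A B G E C) (Sp D F G (Hx F G D E B C) (Us C
   E A A B C D E F G) (Hx F G D C E B) (Us C E B A B C D E F G)))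
(Sp A D E (Hx E A D F G C) (Hx E A D F G C) (Us A A A A D E F B C G) (Sp A D G (Hx A D G B C E) (Us C D A A B C D G F
   E) (Us A D F B D A C E G F) (Hx A D G B F E)))
(Sp C E F (Qd C E F A) (Us A F B A E C F B G D) (Us C C D G B F D E C A) (Hx E F C A D B))
(Sp E F G (Hx E F G A B D) (Us A E C A G C B E F D) (Hx E F G A B D) (Us C E B A B C D G F E))
(Sp E F G (Us B B B D F C B E G A) (Us A G G A E F G B C D) (Us A G G A G E C F D B) (Sp D E F (Hx E F D A G B) (Us B
   D E C F A D E B G) (Hx E F D A G B) (Us C E B A B C D G F E)))"
  by code_simp

text \<open>\<open>rule C F C\<close> combines two swaps, of C and D at AB and of E and G at AC,
  with ACD and BCD both of colour E. The colour of AEG splits it into \<open>rule B D G\<close>,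
  \<open>rule A A A\<close>, \<open>rule B E G\<close> and \<open>rule C F B\<close>; the last of
  these has the longest tree of this block.\<close>

lemma blockCF: "block C F
(Sp D E G (Us A A A D A E G B C F) (Qd D E G A) (Qd D E G A) (Us B E F A C D F E B G))
(Sp A C F (Hx A C F B G E) (Sp A D F (Sp A D E (Sp C D E (Qd C D E A) (Sp B D E (Us A B E E F C D A B G) (Us A A A D B C
   E A F G) (Xx D E B C A) (Sp A B E (Hx E A B D G C) (Qd A B E D) (Qd A B E D) (Sp B C E (Qd B C E D) (Us A A A C B D
   E A F G) (Qd B C E D) (Sp B C G (Hx B C G A D E) (Sp B D G (Us C B B B F E A C D G) (Us B C B A D B E G F C) (Sp A
   B G (Us A G G A D B E G F C) (Sp B F G (Us C B B B C F D E G A) (Us C B B B A F D E G C) (Us C C D A F B G D E C)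
   (Sp B E G (Us A G F D E B A G C F) (Qd B E G A) (Us A A A B D E G A C F) (Sp B E F (Us A E C D A C G E B F) (Us C B
   G B D A C G F E) (Us A D F A G B C E F D) (Us A A A B E F G A C D)))) (Hx A B G E D C) (Hx A B G D C E)) (Hx B D
   G A C E)) (Sp B E G (Qd B E G C) (Us A A A B C E G A D F) (Qd B E G C) (Sp C E F (Hx C E F D G B) (Sp A B G (Us A G
   F A B C G E D F) (Sp B D G (Hx G B D A C E) (Hx G B D A C E) (Sp B F G (Hx G B F A C E) (Hx G B F A C E) (Us B B B
   C G A F B D E) (Us A F B A E F C B D G)) (Hx B D G E A C)) (Hx A B G D C E) (Hx A B G D C E)) (Hx C E F D G B) (Sp
   C F G (Us A D F B E C D G F A) (Us A D F A E C D G F B) (Us B F F C E F G D B A) (Us A A A C E F G A B D)))) (Hx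
   B C G A D E))))) (Qd C D E A) (Sp B C E (Us A G F F A B D C G E) (Us A F B F D E A B G C) (Xx C E B D A) (Sp A B E
   (Hx E A B D G C) (Hx E A B D G C) (Sp A E F (Us B F F A B C D E F G) (Hx A E F D B C) (Hx A E F D B C) (Sp B D E (Qd
   B D E A) (Xx D C E B A) (Sp A B F (Hx F A B D C E) (Sp B D F (Us A A A F A B D C E G) (Us C B D A G D C E F B) (Qd
   B D F A) (Qd B D F A)) (Hx F A B D C E) (Hx A B F D C E)) (Qd B D E A))) (Sp A B G (Sp B C G (Qd B C G A) (Us C B D
   A F B E G D C) (Sp A E F (Sp A F G (Hx G A F B C E) (Sp C E F (Qd C E F A) (Us B B B D E A F C B G) (Us C B D A B C
   F D G E) (Us A F B B G F A C D E)) (Hx G A F B C E) (Us C B G A D C B G F E)) (Hx A E F G C D) (Hx A E F D G C)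
   (Us A E F A F B C E G D)) (Qd B C G A)) (Sp A D G (Hx G A D B C E) (Hx G A D B C E) (Sp D E G (Qd D E G A) (Us C C E
   A B C D E F G) (Qd D E G A) (Sp B D E (Us A B E E F C D A B G) (Us C C C A F B C E D G) (Qd B D E A) (Sp B D G (Qd
   B D G A) (Us C C F A C D F B G E) (Sp D E F (Hx D E F G B A) (Us B B B C E A F D B G) (Hx D E F A G B) (Sp D F G
   (Us A E C B A C E G D F) (Us A D F A E D C G F B) (Us C B G D B A C E F G) (Us A A A D E F G A B C))) (Qd B D G
   A)))) (Hx A D G E B C)) (Hx A B G D C E) (Hx A B G D C E))))) (Sp C D E (Us A A A D A C E B F G) (Qd C D E A) (Qd C
   D E A) (Sp A F G (Sp A E F (Hx A E F D G C) (Sp E F G (Qd E F G A) (Sp C E F (Qd C E F A) (Qd C E F A) (Sp C D F (Qd C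
   D F A) (Xx C F D E A) (Us C C C A B C D E F G) (Qd C D F A)) (Xx E G F C A)) (Us C A C A G B F D E C) (Qd E F G
   A)) (Hx A E F D G C) (Sp A B F (Hx F A B G C E) (Sp E F G (Us A A A E A F G B C D) (Sp B D F (Us A A A F A B D C E
   G) (Sp C D F (Us A B E C G B F D A E) (Sp B C F (Qd B C F D) (Us A A A F B C D A E G) (Sp B E F (Hx F B E D C A) (Us
   A E F F E A D B C G) (Sp C E F (Hx E F C G B A) (Us A B C A G D F C B E) (Us B D C A F C B E D G) (Hx F C E D B
   A)) (Hx F B E D A C)) (Qd B C F D)) (Us C A B A E F G B C D) (Qd C D F A)) (Qd B D F A) (Qd B D F A)) (Us A B E A B
   C E F G D) (Qd E F G A)) (Hx F A B G C E) (Us A E F A B C E F G D))) (Us C A F A F B D C E G) (Sp A E F (Hx A E F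
   D G C) (Sp A D G (Hx G A D F E C) (Hx G A D F C E) (Sp C E F (Us A B F C F D A E B G) (Qd C E F A) (Us C B D A B E
   G F D C) (Us C C B A B C D E F G)) (Us B F F A D C E G F B)) (Hx A E F D G C) (Us B F F A E F G D C B)) (Us A E F
   A F D C G E B))) (Hx A D E F B C) (Hx A D E F B C)) (Us B F F A C E G F D B) (Sp C D F (Us B F F C A E G F D B)
   (Sp A E F (Sp A B E (Hx E A B F G C) (Hx E A B F G C) (Us B F F A B C D E F G) (Sp A B F (Hx F A B E C D) (Sp B D F
   (Qd B D F A) (Sp B E F (Us A B F B D E C F G A) (Qd B E F A) (Sp D E F (Hx F D E C B A) (Us B C G G C F A B E D) (Us
   B C E A E B F D G C) (Hx F D E C B A)) (Us C C C A G D C B F E)) (Sp B E F (Qd B E F A) (Qd B E F A) (Sp D E F (Us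
   B G D C G F A B E D) (Us A A A F B D E A C G) (Us C E E A B C D E F G) (Sp B E G (Us A B E B C F E A G D) (Sp E F
   G (Hx E F G A B D) (Us B D D A F C B E D G) (Hx E F G A B D) (Us A E F F G C B E D A)) (Us C E F A B C D E F G)
   (Us A G F C F B D E A G))) (Us C E G A B C D E F G)) (Qd B D F A)) (Hx A B F D C E) (Hx F A B E C D))) (Sp C F G
   (Us A G E B A C E G D F) (Us C D C A B C D G F E) (Sp A D E (Hx E A D F C G) (Sp C D G (Hx G C D F A E) (Hx G C D F
   A E) (Us C C A A B C D E F G) (Us A B E D B G A C E F)) (Us C D F G D A E F B C) (Sp C D E (Xx A E F D C) (Xx A E
   F D C) (Xx A E F D C) (Sp C D G (Hx G C D F A E) (Hx G C D F A E) (Us B D B B C A D E G F) (Hx C D G E F A)))) (Us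
   A F B B E F A C D G)) (Us C E D A B C D E F G) (Sp A F G (Hx A F G D E C) (Hx A F G C D E) (Sp A D G (Hx G A D F E
   C) (Hx G A D F C E) (Sp A D E (Sp D E F (Qd D E F A) (Sp A B E (Hx E A B D G F) (Hx E A B D G F) (Us C C E A B C D E
   G F) (Sp D E G (Qd D E G A) (Us C C E A B C D E F G) (Qd D E G A) (Us A F B B F D A E C G))) (Qd D E F A) (Us A F B
   B G D A E C F)) (Us B F F A E F G D C B) (Us A D F B E A C F G D) (Us A D F B E A C G F D)) (Us A D F B G A C F
   D E)) (Us A A A A E F G B C D))) (Sp A E F (Sp A B E (Hx E A B F G C) (Hx E A B F G C) (Us B F F A B C D E F G) (Sp
   A B F (Hx F A B E C D) (Sp C E F (Qd C E F A) (Sp B C F (Hx C F B E A D) (Sp B C E (Hx C E B F G A) (Hx C E B F G A)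
   (Us B C B A B C D E G F) (Sp A B G (Sp B C G (Qd B C G A) (Sp E F G (Us A B F A E B F G D C) (Sp B E G (Qd B E G A)
   (Us A B C A F D B E C G) (Qd B E G A) (Sp A F G (Hx G A F B C E) (Hx A F G E B D) (Hx G A F B C E) (Us B E A A D C
   G E F B))) (Us C C C A D E F C G B) (Us B F A B E D F A C G)) (Us B B B D E A F C B G) (Qd B C G A)) (Sp A F G (Hx
   G A F B C E) (Hx G A F B C E) (Sp A D G (Hx G A D F E C) (Hx G A D F C E) (Sp A D E (Sp D E G (Qd D E G A) (Us C C E
   A B C D E F G) (Qd D E G A) (Sp B D E (Qd B D E A) (Us C C C A F B C E D G) (Qd B D E A) (Sp B E F (Qd B E F A) (Qd
   B E F A) (Us B G C A B C D E F G) (Sp E F G (Qd E F G A) (Us A G A C D A F B E G) (Qd E F G A) (Us A G G A G E D F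
   C B))))) (Hx E A D F G B) (Us B F F A D E F B C G) (Us C F A A B C D E F G)) (Us C D F B G A D F C E)) (Sp E F G
   (Us A A A G A E F B C D) (Sp B C G (Hx B C G D E A) (Sp B F G (Us A G E C A G E F D B) (Us C D B A C G D F B E) (Sp
   B E G (Qd B E G A) (Qd B E G A) (Sp B D E (Us B F B A B C D E F G) (Us B C B F E B G D A C) (Us B G A A B C D E F
   G) (Us C B B B F A E G D C)) (Sp B D E (Us A B F B G D F E C A) (Us C C C A C G F B E D) (Us B F G A B C D E F G)
   (Us A G F A G E F B C D))) (Us A F B C E B A G D F)) (Us B C G D F C A G B E) (Hx B C G A D E)) (Qd E F G A) (Qd E
   F G A))) (Hx A B G D F E) (Hx A B G D F E))) (Sp B E F (Qd B E F A) (Qd B E F A) (Us A B C A G D F C B E) (Sp B D F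
   (Hx F B D A E C) (Hx F B D A C E) (Us C E G A B C D E F G) (Qd B D F A))) (Hx C F B E A D)) (Sp D E F (Us A B F E F
   A D C B G) (Us A B C A G B F C D E) (Us A A A F C D E A B G) (Sp B D F (Qd B D F A) (Us A G F B F C D E A G) (Sp E
   F G (Hx E F G A C D) (Sp B E F (Qd B E F A) (Qd B E F A) (Sp B D E (Us C D G A C F B D G E) (Qd B D E F) (Us A A A B
   D E F A C G) (Sp A D E (Us B G C A B C D E F G) (Qd A D E F) (Qd A D E F) (Sp B E G (Us A B E B C F E A G D) (Us B
   G B A C E D G B F) (Us A G G C B E D G A F) (Us B C B A F E D G C B)))) (Us A G G A E F G B C D)) (Hx E F G A C
   D) (Us C E B A C B G D E F)) (Qd B D F A))) (Us B G G A C G E F B D)) (Hx A B F D C E) (Hx F A B E C D))) (Sp C E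
   F (Qd C E F A) (Qd C E F A) (Sp C D E (Hx E C D F G A) (Hx E C D F G A) (Us A A A C D E F A B G) (Sp C F G (Us A G E
   B A C E G D F) (Us C D C A B C D G F E) (Us C B C C B A F D G E) (Us A D F A F C B E D G))) (Us B G G A C G E F
   B D)) (Us C E D A B C D E F G) (Sp A F G (Hx A F G D E C) (Hx A F G C D E) (Sp A D G (Hx G A D F C E) (Hx G A D F C
   E) (Sp D E F (Us A E E B F C D A G E) (Sp A D E (Sp A B E (Hx E A B D G F) (Hx E A B D G F) (Us C C E A B C D E G
   F) (Sp D E G (Qd D E G A) (Us C C E A B C D E F G) (Qd D E G A) (Us A F B B F D A E C G))) (Qd A D E F) (Qd A D E
   F) (Us A D F B E A C G F D)) (Us C A A A B C D G F E) (Us A F B B G D A E C F)) (Us A D F B G A C F D E)) (Us A A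
   A A E F G B C D))) (Sp C F G (Us C D D C B A D E F G) (Sp B C F (Hx C F B G A D) (Sp B C G (Hx C G B F A E) (Hx C G
   B F A E) (Sp B D F (Qd B D F C) (Qd B D F C) (Sp B F G (Us B F A A G E B F D C) (Us A B C A D E G F B C) (Sp A E F
   (Sp A B F (Hx F A B E C D) (Sp B E F (Us A G G G E F A B C D) (Us B F A C F D B E G A) (Sp A B E (Hx E A B F G C)
   (Hx E A B F G C) (Us B F F A B C D E F G) (Sp D E F (Us A D F C D F G E A B) (Us A A A F B D E A C G) (Us C E E A
   B C D E F G) (Sp B E G (Us B B B D A C F E B G) (Us C C C A D G C E B F) (Us C E F A B C D E F G) (Us B C E C G E
   B F A D)))) (Us C E C C B A D G F E)) (Us C D F G B A C D F E) (Hx F A B E C D)) (Us C D C A B C D G F E) (Us C E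
   D A B C D E F G) (Sp A F G (Hx A F G C D E) (Hx A F G C D E) (Us A C C C A G E F D B) (Us A A A A E F G B C D)))
   (Sp E F G (Us A G G C E G A F D B) (Sp A E F (Sp B E G (Us A E C C A D F E G B) (Us A E F G C A F B E D) (Sp D E G
   (Hx E G D F B A) (Sp A B E (Hx E A B G F C) (Hx E A B F G C) (Us B F F A B C D E F G) (Sp B D G (Us C A G A D C B G
   F E) (Us B C G F C G A B E D) (Us A A A G B D E A C F) (Us A D F A E G C B D F))) (Hx E G D F B A) (Us A F B A E
   D G F C B)) (Us A A A G B E F A C D)) (Us C D C A B C D G F E) (Sp D E F (Us A A A F A D E B C G) (Us A B C C G B
   F A D E) (Us A B F E F C D A B G) (Us C B B F C A G B E D)) (Us A B C C D B E A G F)) (Us B B B D F A B G E C)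
   (Sp D F G (Hx F G D C E B) (Sp D E F (Hx F D E B G C) (Sp A E F (Sp A B E (Hx E A B F G C) (Hx E A B F G C) (Us B F F
   A B C D E F G) (Sp B E F (Us A B C C D G E F B A) (Us B F A C E G B F D A) (Us A A A F B D E A C G) (Us A D F A B
   F C E G D))) (Us C D C A B C D G F E) (Us A B C C G B F A D E) (Us C B B F C A D B E G)) (Hx F D E G B C) (Us B B
   B C D A B F E G)) (Hx F G D C E B) (Sp A E F (Sp A B E (Hx E A B F G C) (Hx E A B F G C) (Us B F F A B C D E F G)
   (Sp B E F (Us A B C C D G E F B A) (Us B F A C E G B F D A) (Us C C D A C F D G E B) (Us A E F F D A B G E C)))
   (Us C D C A B C D G F E) (Us A F C C E G A F B D) (Us B B E B A C E F D G))))) (Sp B F G (Qd B F G C) (Qd B F G C)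
   (Sp D F G (Us A B E B E A F D G C) (Us A A A F B D G A C E) (Us A D F A D F E G C B) (Sp E F G (Hx F G E B D C) (Sp
   B D E (Hx B D E A C F) (Sp B C E (Us A D F F D B G C E A) (Us A A A B C D E A F G) (Us B F F B D C E F G A) (Us C
   D F A D B C E F G)) (Hx B D E A C F) (Us A F B A G E F B C D)) (Hx F G E C B D) (Us C E B B A C E D G F))) (Us C
   E C A B C D E F G))) (Sp B F G (Qd B F G C) (Us A A A G B C F A D E) (Sp B C E (Hx B C E F D G) (Us C B A C A G E
   F D B) (Sp B D G (Us A D G G C B F D E A) (Us A G E A C G F B E D) (Sp B D F (Qd B D F C) (Qd B D F C) (Sp C D G (Hx
   G C D F E A) (Sp C D E (Hx C D E G A F) (Us C C G C A G E F D B) (Hx C D E G B F) (Sp B E G (Hx G B E D C F) (Hx G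
   B E F D C) (Sp D E G (Qd D E G C) (Us A A A G B D E A C F) (Qd D E G C) (Us C D F A B G D E C F)) (Us C B D C A G
   E F D B))) (Sp D F G (Qd D F G C) (Sp D E G (Sp A D E (Us C D G A B C D E F G) (Us A D D B G A D C F E) (Us C C D C
   G D E A F B) (Us A B C B C F E D G A)) (Us B E D C A G D F E B) (Us B F F G D C E F B A) (Us B G G C G B F D A
   E)) (Qd D F G C) (Sp E F G (Hx F G E B D C) (Sp B E G (Hx G B E F D C) (Hx G B E F D C) (Us A F C A E F G B C D) (Us
   B C B C F G D E A B)) (Hx F G E C B D) (Us C C D C A G E F D B))) (Us A D F A G C E F B D)) (Sp B D E (Hx B D E A
   C F) (Us B F F B D C E F G A) (Hx B D E A C F) (Us A E F B E C F D G A))) (Us A F B A F D C G E B)) (Hx B C E F D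
   G)) (Qd B F G C))) (Hx C F B G A D) (Sp B C E (Hx B C E D F A) (Sp C D E (Hx E C D B G A) (Us A A A C B D E A F G)
   (Us B F F C B D E F G A) (Us C D F A B C D E F G)) (Hx B C E A D F) (Us C B B C D A F B G E))) (Sp D F G (Us A B F
   G F A D C B E) (Us A B C A E B F C D G) (Us A A A F C D G A B E) (Sp C E F (Us B E B C B A F G D E) (Sp C D G (Qd
   C D G F) (Qd C D G F) (Sp B C E (Hx C E B F G A) (Hx C E B F G A) (Us B F F C F D G E B A) (Sp C D E (Hx E C D F G
   B) (Us B E G C F D G E A B) (Sp E F G (Qd E F G C) (Sp B D E (Qd B D E C) (Qd B D E C) (Us C C E C F G D E A B) (Sp
   B E G (Us B F A A E F G B D C) (Us A B C A D F E B G C) (Us A G G C B E D G A F) (Us A G G C E G B F A D))) (Qd E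
   F G C) (Us A F B A D E C F B G)) (Us A D F A D C B G E F))) (Us A A A C D F G A B E)) (Us B C E A E G C F B D)
   (Us A E F C D A E F G B))) (Sp C E F (Hx F C E A G D) (Hx F C E A G D) (Sp C D E (Hx E C D F G A) (Hx E C D F G A)
   (Us A D F A E C B F D G) (Sp D F G (Us C A A C B A D E F G) (Sp D E F (Hx F D E A G C) (Sp A E F (Us A C C A C E G
   F D B) (Us A F B B E F A C D G) (Us A B C C G B F A D E) (Sp A F G (Hx A F G D E C) (Hx A F G C D E) (Sp A D E (Sp
   A B E (Hx E A B D G F) (Hx E A B D G F) (Us C C E A B C D E G F) (Sp A D G (Hx G A D F E C) (Hx G A D F C E) (Sp D
   E G (Qd D E G A) (Us C C E A B C D E F G) (Qd D E G A) (Us A F B B F D A E C G)) (Hx A D G E B F))) (Qd A D E F)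
   (Qd A D E F) (Us B G D C B A D E F G)) (Us A A A A E F G B C D))) (Hx F D E G A C) (Us B C G B D C A F G E)) (Us A
   G F A C G E F B D) (Us A F B A E D C G B F))) (Us A A A C E F G A B D)))) (Sp A D E (Hx A D E B C F) (Sp C D E (Us
   A A A D A C E B F G) (Qd C D E A) (Qd C D E A) (Sp A F G (Sp A E F (Us A B E A B G D E C F) (Hx F A E G C D) (Us A
   B F E D G C A B F) (Sp A B F (Hx F A B G E C) (Sp A D G (Hx A D G E F C) (Hx G A D F E C) (Sp E F G (Us A A A E A F
   G B C D) (Sp D E G (Qd D E G A) (Qd D E G A) (Sp C D G (Qd C D G E) (Qd C D G E) (Us A A A D C E G A B F) (Us C A D
   A D E C G B F)) (Sp D F G (Qd D F G A) (Sp B D F (Us B C B E A F G B C D) (Sp B F G (Us B F A A F C B G E D) (Us B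
   F A D F C B A E G) (Us A B C A E C F G B D) (Sp B C F (Hx F B C D A G) (Us A B C A G E B F C D) (Sp B E F (Hx F B
   E D A C) (Us A E F F C A G B E D) (Us B C E A D E G F C B) (Us A A A F B E G A C D)) (Hx F B C D A G))) (Qd B D F
   A) (Us A G G A F D B G C E)) (Qd D F G A) (Us A B C A C B G D F E))) (Qd E F G A) (Qd E F G A)) (Hx A D G E C F))
   (Hx F A B G C E) (Us A E F A B C E F G D))) (Us C A F A F B D C E G) (Us C D A A B C D E F G) (Us A E F A F D C G
   E B))) (Hx A D E B C F) (Sp A D G (Hx A D G B C F) (Sp A F G (Hx G A F D C E) (Us C D D A B C D E F G) (Hx G A F D
   C E) (Sp A E F (Hx F A E C G D) (Hx F A E C G D) (Us C A F A D B C G E F) (Us B E D D B A E C F G))) (Sp D E G (Us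
   A A A D A E G B C F) (Qd D E G A) (Qd D E G A) (Sp A F G (Sp A B F (Hx F A B G C D) (Sp C D F (Qd C D F A) (Qd C D F
   A) (Sp A B G (Hx G A B F D E) (Hx G A B F D E) (Sp D F G (Qd D F G A) (Sp B D F (Qd B D F A) (Hx D F B A G C) (Qd B D
   F A) (Us A G G A F D B G C E)) (Qd D F G A) (Sp E F G (Xx G E F D A) (Sp B D F (Us A B F F G B E D C A) (Us C C C A
   C G E F D B) (Us B E D A C D F G B E) (Sp B F G (Qd B F G A) (Qd B F G A) (Us A G G A D G E F C B) (Us A G G A G F
   E B C D))) (Xx G E F D A) (Us A A A G D E F A B C))) (Us B F F A G B F D E C)) (Us B E F A C D F G B E)) (Hx F A
   B G C D) (Us B E C A C D F G B E)) (Sp C F G (Qd C F G A) (Qd C F G A) (Us C B E A E B G C D F) (Sp E F G (Us A D F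
   B E G D F A C) (Xx G E F C A) (Us A A A G C E F A B D) (Us A E F G D A C E F B))) (Us A D F B D A C G E F) (Us A
   F C C F D A G B E))) (Hx A D G B C F)))) (Sp C E F (Us A D F B A C D E G F) (Sp B C E (Hx C E B F G A) (Hx C E B F
   G A) (Us B C D A B C D E G F) (Sp B C G (Hx B C G A D E) (Sp C F G (Hx G C F B A E) (Hx G C F B A E) (Sp A E F (Sp A
   B E (Hx E A B F G C) (Hx E A B F G C) (Us B F F A B C D E F G) (Sp A B G (Sp B E G (Qd B E G A) (Qd B E G C) (Qd B E
   G A) (Sp E F G (Us A B F A E B F G D C) (Sp B E F (Us A D F C F E D B A G) (Us A E F E C A G F B D) (Sp A F G (Hx G
   A F B C E) (Us B F A G E D B A C F) (Hx G A F B C E) (Xx E F B G A)) (Us A A A E B F G A C D)) (Qd E F G C) (Us B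
   F A B E D F A C G))) (Sp A F G (Hx G A F B C E) (Hx G A F B C E) (Sp A B F (Hx F A B E G C) (Sp A D F (Sp B D F (Us
   A A A F A B D C E G) (Sp C D F (Hx F C D E G A) (Us B E D A G F C D E B) (Us B G B A B C D E F G) (Hx F C D E G
   A)) (Qd B D F A) (Qd B D F A)) (Hx F A D E G C) (Sp A D G (Us B D A B E A F C G D) (Hx G A D F E C) (Sp A D E (Sp B
   D E (Qd B D E A) (Us B B B F C A G B D E) (Qd B D E A) (Sp B E F (Qd B E F A) (Qd B E F A) (Us B G C A B C D E F G)
   (Us B B C A B C D E G F))) (Hx E A D F G B) (Us B F F A D E F B C G) (Sp D E F (Us A G F B A D G E C F) (Sp B D E
   (Us A B F E A F G D C B) (Us A B E D C F A E G B) (Us A F C A B C D E G F) (Sp B D G (Qd B D G A) (Us B B G A B C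
   D E G F) (Us B B D A E C F B G D) (Qd B D G A))) (Qd D E F A) (Us A F B B G F A D C E))) (Us B E G A C G E F B
   D)) (Hx F A D E G C)) (Hx A B F D G E) (Hx F A B E G C)) (Sp B F G (Us A G F C A G E F D B) (Us A B E G D B A F E
   C) (Sp E F G (Us A A A G A E F B C D) (Sp B E G (Qd B E G A) (Qd B E G A) (Sp B D E (Us B F B A B C D E F G) (Us B C
   B F E B G D A C) (Us B G A A B C D E F G) (Us A G G C B E D G A F)) (Sp B D E (Us A B F B G D F E C A) (Us A B F
   B G D F E A C) (Us B F G A B C D E F G) (Us A G F A G E F B C D))) (Qd E F G A) (Qd E F G A)) (Us A F B C E B A G
   D F))) (Hx A B G D C E) (Hx A B G D C E))) (Qd A E F C) (Qd A E F C) (Us B F D A B C D E F G)) (Sp E F G (Qd E F G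
   C) (Sp B C F (Hx B C F G D E) (Sp B E G (Us B F A A E F G B D C) (Us A B C A D F E B G C) (Sp B F G (Us A E B A G C
   D E F B) (Us A G E A C G E F D B) (Sp B D E (Sp A B E (Hx B E A D G C) (Us A D F F A B G D C E) (Hx B E A D G C)
   (Sp A B G (Qd A B G E) (Us B F B A B C D E F G) (Qd A B G E) (Hx A B G D E C))) (Us B C C F E B G D A C) (Sp B E F
   (Qd B E F C) (Qd B E F C) (Us A C F A B C D E G F) (Us B C G A B C D E G F)) (Us A G G C B E D G A F)) (Us A F B A
   E B C G D F)) (Sp B E F (Qd B E F C) (Qd B E F C) (Sp B D E (Hx E B D F G C) (Hx E B D F G C) (Us A C F A B C D E G
   F) (Us B B B A B C D E G F)) (Us A A A E B F G A C D))) (Us A D F A F C D E B G) (Sp B E G (Qd B E G C) (Qd B E G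
   C) (Sp B F G (Qd B F G C) (Qd B F G C) (Sp B D E (Sp A B E (Hx B E A D G C) (Us A D F F A B G D C E) (Hx B E A D G
   C) (Sp A B G (Qd A B G E) (Us B F B A B C D E F G) (Qd A B G E) (Hx A B G D E C))) (Us B C B F E B G D A C) (Sp B E
   F (Hx B E F G D C) (Hx B E F G D C) (Us A C F A B C D E G F) (Us B B B A B C D E F G)) (Us A G G C B E D G A F))
   (Us A F B A E B C G D F)) (Us A F B A F B C G D E))) (Us A A A G C E F A B D) (Qd E F G C))) (Sp B E G (Qd B E G
   C) (Us A A A B C E G A D F) (Qd B E G C) (Sp B C F (Hx B C F G E A) (Sp B E F (Qd B E F C) (Qd B E F C) (Sp B D E (Hx
   E B D F G C) (Hx E B D F G C) (Us A C F A B C D E G F) (Sp B D G (Hx B D G E A C) (Us A G F D B C G E A F) (Sp B F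
   G (Sp C F G (Hx C F G E B A) (Qd C F G B) (Us A E B A B C D E G F) (Us A D F A G C D E F B)) (Us A G E A B C G E D
   F) (Us B C B C E B F D A G) (Us A D F A G B C E F D)) (Hx B D G A C E))) (Sp B F G (Us B E D C D E G B A F) (Us A
   D F A E B D G F C) (Us B A G A B C D E G F) (Us A A A B E F G A C D))) (Us A D F A B C D E G F) (Us B C E A F E
   C B D G))) (Hx B C G A D E))) (Sp A E F (Qd A E F C) (Qd A E F C) (Sp A D E (Hx E A D F G C) (Hx E A D F G C) (Us A
   F C B D C A E G F) (Sp A D G (Hx A D G B C E) (Sp C D E (Hx E C D F G A) (Hx E C D F G A) (Sp C D F (Us A F B B D A
   C E G F) (Sp D E F (Qd D E F C) (Xx E F D A C) (Us A A A E C D F A B G) (Qd D E F C)) (Us A A A C D E F A B G) (Us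
   B E G C A E G F B D)) (Sp E F G (Us A B F A E D F G B C) (Us B F A D E B F A C G) (Sp D E F (Us B F F E F A D G C
   B) (Sp A F G (Qd A F G E) (Us B F A G E B D A C F) (Hx G A F E D C) (Qd A F G E)) (Us A D F A F E B C D G) (Us A G
   G A G E C F B D)) (Sp D E G (Qd D E G A) (Qd D E G A) (Us A G G A D E C G B F) (Sp A D F (Hx A D F G C E) (Us A G A
   B C A G F E D) (Us A B G A B D E G F C) (Sp A F G (Hx G A F D C E) (Hx A F G E C D) (Hx G A F D C E) (Us A F B B F
   D A G C E)))))) (Sp D E G (Us A A A D A E G B C F) (Qd D E G A) (Qd D E G A) (Sp A D F (Hx A D F B C E) (Us B E B A
   B C D E G F) (Us A D F B D A C E G F) (Us B C E C F E A D B G))) (Hx A D G B C E))) (Sp A F G (Us B F C A D C B E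
   F G) (Us A D F B E A D G F C) (Sp A D F (Hx F A D G E C) (Hx F A D G C E) (Sp A D E (Sp A D G (Hx G A D F E C) (Hx G
   A D F C E) (Sp C D E (Qd C D E A) (Us B B E G A F B C E D) (Qd C D E A) (Sp D E G (Qd D E G A) (Sp B D E (Us B C F E
   A F G D C B) (Us B B B F E A G D B C) (Sp D E F (Qd D E F A) (Us B C D A B D C E G F) (Qd D E F A) (Us A F B B G D
   A E C F)) (Us B C D A B D C E F G)) (Qd D E G A) (Us A F B B F D A E C G))) (Hx A D G E B F)) (Us B F F A E F G D
   C B) (Us A D F B E A C F G D) (Us B G D C B A D E F G)) (Us A E F A D C E F G B)) (Us A A A A E F G B C D))) (Sp
   C F G (Us A D F B E C D G F A) (Sp B C F (Hx C F B G E A) (Hx C F B G A E) (Sp B C E (Sp B C G (Hx C G B F A E) (Hx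
   C G B F A E) (Sp B E G (Sp A B E (Qd A B E C) (Xx E B A G C) (Qd A B E C) (Us B C F B A C D E F G)) (Qd B E G C) (Qd
   B E G C) (Us A F B A F B C E D G)) (Hx B C G E A F)) (Us B F F C E F G B D A) (Us A D F A E C D F G B) (Us B G D
   A D C B E F G)) (Us A E F C B A E F G D)) (Sp C D F (Hx F C D G E A) (Hx F C D G A E) (Us B G E A B C D E F G) (Us
   A E F C D A E F G B)) (Us A A A C E F G A B D))) (Sp A F G (Sp C F G (Qd C F G A) (Sp A B G (Hx G A B F C E) (Hx G
   A B F C E) (Sp A B E (Sp B C E (Qd B C E A) (Sp B D E (Us A B E C F A B E D G) (Us A A A B C D E A F G) (Us B F C B
   G A F C E D) (Us C A D A B C D E F G)) (Qd B C E A) (Sp B C G (Hx C G B F A E) (Hx C G B F A E) (Us B B B D G A F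
   C B E) (Hx B C G E A D))) (Sp A D E (Hx E A D B G C) (Hx E A D B G C) (Sp B D E (Qd B D E A) (Us B F D B F A G D E
   C) (Sp A D F (Hx A D F B C E) (Sp A B F (Sp B C F (Qd B C F A) (Sp C D F (Qd C D F A) (Qd C D F A) (Hx F C D A G B)
   (Us B E F A D C F G B E)) (Qd B C F A) (Us A G G A F C B G D E)) (Hx F A B G D C) (Hx F A B G D C) (Us B E C A D C
   F G B E)) (Sp D E F (Us A A A D A E F B C G) (Us B C D A B D C E G F) (Us A B E A B C D F E G) (Us C A F A B C D
   E F G)) (Hx A D F B C E)) (Qd B D E A)) (Sp A D G (Hx A D G B C E) (Hx G A D F B E) (Sp D E G (Us A A A D A E G B C
   F) (Qd D E G A) (Qd D E G A) (Sp B D E (Qd B D E A) (Sp B C E (Us A B E D F A B E C G) (Us A A A B C D E A F G) (Us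
   A C C A B C D E F G) (Us C A D A B D C E F G)) (Qd B D E A) (Sp B E G (Qd B E G A) (Qd B E G A) (Us A B C A C F E
   B G D) (Sp B F G (Us B B B D B C E G F A) (Us A G G A F G C B D E) (Sp B D G (Hx G B D F A E) (Hx G B D F A E) (Sp
   A B F (Qd A B F G) (Us B C C A G B F D C E) (Us C A E A B C D E F G) (Qd A B F G)) (Hx B D G E A C)) (Us A G G A G
   B F E C D))))) (Hx A D G B C E))) (Hx A B E D C G) (Hx A B E D C G)) (Sp A B F (Us B F F A G B F C E D) (Sp B F G
   (Us A A A G A B F C D E) (Qd B F G A) (Sp A D F (Sp B D F (Us A A A F A B D C E G) (Us C A B A B C D E F G) (Qd B D
   F A) (Qd B D F A)) (Hx F A D G B C) (Hx F A D G B C) (Sp B D F (Qd B D F A) (Us C A B A B C D E F G) (Qd B D F A)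
   (Sp A D G (Hx A D G B F C) (Hx G A D F B C) (Us C A C A B C D E F G) (Hx A D G B C F)))) (Qd B F G A)) (Hx A B F D
   G C) (Us A A A A B F G C D E))) (Qd C F G A) (Sp C E F (Us A D F B G C D E F A) (Sp B C E (Hx C E B F G A) (Hx C E
   B F G A) (Us A E F C B A G E F D) (Sp B C F (Hx C F B E G A) (Hx C F B E G A) (Us A D F A F C D E B G) (Sp B F G
   (Us A G G C F G B A D E) (Us A E E A F D B C E G) (Sp B C G (Qd B C G F) (Sp A B G (Hx G A B F C E) (Hx G A B F C
   E) (Sp B E G (Qd B E G C) (Qd B E G C) (Sp A B E (Us B C A A E C B G D F) (Sp E F G (Qd E F G C) (Sp B D E (Us A D F
   F A B G D C E) (Us B C B F E B G D A C) (Sp B D G (Hx B D G A C E) (Us B F F G C E F B D A) (Us B C E C F E G B A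
   D) (Us A F C C F E G B A D)) (Us A G G C B E D G A F)) (Us A A A G C E F A B D) (Qd E F G C)) (Hx A B E D C G) (Hx
   A B E D C G)) (Us A F B A F B C G D E)) (Us A F A A C E G B F D)) (Us A D F A G C D E F B) (Qd B C G F)) (Us A F
   B A E B C G D F)))) (Us B F C C B A D G F E) (Us A A A C E F G A B D))) (Us A D F B C A D G E F) (Sp C F G (Qd C
   F G A) (Qd C F G A) (Sp A D G (Hx G A D F C E) (Hx G A D F C E) (Sp C D G (Hx G C D F A E) (Hx G C D F A E) (Sp A D
   E (Sp C D E (Qd C D E A) (Sp B D E (Us A B E E F C D A B G) (Us A A A D B C E A F G) (Xx D E B C A) (Sp D E G (Qd D
   E G A) (Us A E F D G A C E B F) (Qd D E G A) (Sp C D F (Us C B D C B A D E F G) (Sp A D F (Sp B D F (Hx B D F A C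
   E) (Us A B C A G E D F B C) (Us B F A C D E B A G F) (Us C B E A B C D E F G)) (Qd A D F C) (Us C A E A D C B E F
   G) (Hx A D F E B G)) (Us C A E C D A B E F G) (Us B C G A E C B D F G)))) (Qd C D E A) (Sp A E F (Sp C D F (Us C B
   F C B A D E F G) (Sp A B E (Hx E A B F G C) (Hx E A B F G C) (Us B F F A B C D E F G) (Sp A D F (Sp B D F (Us A B F
   A D C B F E G) (Us A B C A G E D F B C) (Us B F A C D E B A G F) (Sp D E G (Qd D E G A) (Qd D E G C) (Us A A A D C
   E G A B F) (Sp B D E (Hx D E B A G C) (Hx D E B A G C) (Qd B D E A) (Us C B E A B C D E F G)))) (Qd A D F C) (Hx F
   A D G C E) (Hx A D F E B G))) (Us C B C C B A D E F G) (Us A D F A D C B G E F)) (Hx A E F D G C) (Hx A E F D G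
   C) (Us C B G A B C D E F G))) (Us C C A A B C D E F G) (Sp A D F (Hx A D F B C E) (Us C B D A B C D E F G) (Us C B
   B A B C D E F G) (Hx A D F B C E)) (Sp A D F (Hx A D F G E B) (Us C B F A B C D E F G) (Us C B C A B C D E F G)
   (Us A D F B D A C G E F))) (Sp C D F (Us B F F C G D F A E B) (Sp D F G (Qd D F G C) (Sp C D E (Hx C D E F A G) (Us
   C B A C A G E F B D) (Sp A D F (Us B F A F C G E D B A) (Qd A D F C) (Sp A D E (Qd A D E C) (Qd A D E C) (Us C B B
   A B C D E F G) (Us C B C A B C D E F G)) (Qd A D F G)) (Hx C D E F B G)) (Us A A A G C D F A B E) (Qd D F G C))
   (Us B E G C A G E F B D) (Us A A A C D F G A B E))) (Us C B A A B C D E F G)) (Sp C E F (Us A D F B G C D E F A)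
   (Us B F C C D A B G F E) (Sp C D F (Hx F C D E G A) (Hx F C D E G A) (Us A E F C D A G F E B) (Sp C D E (Hx E C D F
   G A) (Hx E C D F G A) (Us A D F A E C B F D G) (Sp D F G (Us A G G C F G D A B E) (Sp D E G (Us A D C A F B D C E
   G) (Sp E F G (Hx F G E D A C) (Qd E F G C) (Us A A A G C E F A B D) (Sp C D G (Qd C D G E) (Sp A D G (Hx G A D E F
   C) (Hx G A D F C E) (Sp B D E (Us C A G A B C D E F G) (Us B C B F E D G B A C) (Sp B D G (Hx B D G A C E) (Us B F
   F G C E F D B A) (Us B C E C F E G D A B) (Us A F C C F E G D A B)) (Us A G G C D E B G A F)) (Us A B E A E B G
   D F C)) (Qd C D G E) (Us B C E A D E C G B F))) (Us A E E A E B D C F G) (Us A F B A F D C G B E)) (Us A G F A C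
   G E F B D) (Us A F B A E D C G B F)))) (Us A A A C E F G A B D))) (Sp A E F (Sp A B E (Hx E A B F G C) (Hx E A B F
   G C) (Us A E F A B C G E F D) (Sp A B F (Hx F A B E G C) (Hx F A B E G C) (Hx A B F D C E) (Sp E F G (Us A A A G A
   E F B C D) (Sp B F G (Us A F B C G E F B D A) (Us B G F A B C D E F G) (Sp B E G (Us B C F B A C D E F G) (Us A D
   C C F D B A E G) (Sp A B G (Qd A B G E) (Sp B D E (Us B F B A B C D E F G) (Us B G G A B C D E F G) (Us B G A A B
   C D E F G) (Us A G G C B E D G A F)) (Qd A B G E) (Hx A B G D C E)) (Us A F B C F B A G D E)) (Us A F B C E B A G
   D F)) (Qd E F G A) (Qd E F G A)))) (Us A D F B G A D E F C) (Sp A D E (Hx E A D F G C) (Hx E A D F G C) (Us A E F A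
   D C G E F B) (Sp A D F (Hx A D F B C E) (Hx F A D E G C) (Us A D F B F A C E D G) (Sp D E G (Us A E E B E C D A F
   G) (Us B F A B E F G D C A) (Sp D F G (Us A G F C A G E F B D) (Us A D C B E C D A F G) (Us C A A A B C D E F G)
   (Us A F B B E D A G C F)) (Us A F B B F D A G C E)))) (Us A A A A E F G B C D))))
(Sp A E G (Us B D G A B C D E F G) (Us A A A A C E G B D F) (Us B E G A B C D E F G) (Sp C E G (Us A A A C A E G B D
   F) (Qd C E G A) (Qd C E G A) (Us C F B A B C D E F G)))
(Sp B D E (Hx D E B G A C) (Us B B B F E A G D B C) (Hx D E B G A C) (Us C F C D A E C G F B))
(Sp C D F (Hx C D F A G E) (Hx C D F A G E) (Us B B B B E A G D F C) (Us C F C D A C E G B F))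
(Sp D F G (Us B B G B C D A E G F) (Us A B E G B E C D A F) (Us A B F D C E A G B F) (Us C B F D B A G F C E))
(Sp C D E (Qd C D E A) (Qd C D E A) (Sp A E F (Us C A C A C G E B D F) (Qd A E F C) (Us A B G A B F D C E G) (Us C D B
   A B F G C E D)) (Xx C E F D A))"
  by code_simp

lemma blockCG: "block C G
(Sp D E G (Hx D E G F A B) (Us A D F A E D F G B C) (Us A A A D C E G A B F) (Us B E D A B C E D F G))
(Sp D E G (Us C F F C B F D E A G) (Us B C A A D F E G B C) (Us A F B A C E F G B D) (Us A E E A D B E F C G))
(Sp D F G (Hx D F G C E A) (Hx D F G A C E) (Us C G B A B C D E F G) (Us C F C F A D C E B G))
(Sp A D F (Hx A D F B C E) (Sp C D F (Us A A A F A C D B E G) (Qd C D F A) (Sp C E F (Us A G E B A F D C G E) (Us C F G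
   A B C D E F G) (Us A F B B D E A F G C) (Sp C F G (Hx C F G A D E) (Hx C F G A D E) (Sp D E F (Us C G B B G F A C
   D E) (Sp B D F (Hx D F B E C A) (Sp B D E (Us B A B A B D C E G F) (Us A G G A B D C E G F) (Us B C B A B D C E G
   F) (Sp B D G (Hx B D G C E A) (Sp C D G (Us B B B F A B E C G D) (Us B B B F B A E D G C) (Sp C D E (Hx D E C F A
   B) (Qd C D E A) (Qd C D E F) (Us C G A A B C D E F G)) (Us B B B A F B E C G D)) (Us C F C B A D C E F G) (Hx B D
   G A C E))) (Us C F C F A D C E G B) (Hx D F B E A C)) (Us B B B B C A G F D E) (Us C G C A B C D E F G)) (Us C F
   C F A C D E B G))) (Qd C D F A)) (Us C F C A B D C E G F) (Hx A D F B C E))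
(Sp B C G (Hx C G B E A D) (Sp D E G (Us A F B B G C D E F A) (Us C G C A F C D E G B) (Us A F B B C E A G F D) (Us A
   D C B D F E A C G)) (Us C F C G A C D E F B) (Hx C G B E A D))
(Sp C D G (Us A A A G A C D B E F) (Qd C D G A) (Sp C E G (Us A F B B G D C E F A) (Us C G E A B C D E F G) (Us A F B
   B D E A G F C) (Us C G E A F C D E B G)) (Qd C D G A))
(Sp A D G (Hx A D G C E B) (Us C G F A B C D E F G) (Us C F C A B D C E F G) (Hx A D G B C E))"
  by code_simp

lemma blockDA: "block D A
(Sp C D F (Us A A A F A C D B E G) (Qd C D F A) (Us C G D A F C D E B G) (Qd C D F A))
(Sp A D E (Sp B C E (Us A G E F A B D C G E) (Us A F B F D E A B G C) (Us C F G A F C D E B G) (Sp B C G (Hx B C G A D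
   E) (Sp B D E (Us C G F D F A B C G E) (Us B B B F C A G B D E) (Sp C D E (Qd C D E A) (Qd C D E B) (Qd C D E A) (Sp
   B D F (Hx B D F A C E) (Sp A D F (Us C B D A G D C E F B) (Us D A A A B C D E F G) (Sp D E F (Hx D E F A B C) (Us B
   C C A B D C E G F) (Hx D E F A B C) (Sp D F G (Hx D F G B E A) (Hx D F G B A E) (Sp C D G (Us B B B B A F E C G D)
   (Us B B B A B F E C G D) (Us C G A A F C D E B G) (Us C E B A E B F C D G)) (Sp B D G (Hx B D G E A C) (Us D A A B
   G D C E A F) (Us C B B D C A F G E B) (Sp D E G (Hx D E G A B C) (Us C G F D A E G B C F) (Hx D E G A B F) (Us A A
   A D E F G A B C))))) (Hx A D F E B C)) (Us C F C B A D C E G F) (Hx B D F A C E))) (Us C G G B A C D E F G)) (Us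
   C F C B A C D E F G) (Hx B C G A D E))) (Sp C D E (Us A A A D A C E B F G) (Qd C D E A) (Qd C D E A) (Sp D E G (Us
   A G F B A D C E F G) (Us C F D A B C D E F G) (Us A F B B C G A D F E) (Sp D E F (Hx D E F A G C) (Hx D E F A G
   C) (Sp B C E (Us A F B F C E B A G D) (Sp B D E (Hx D E B F G C) (Us A A A B C D E A F G) (Qd B D E C) (Sp B D G (Hx
   B D G C E A) (Sp C D G (Us B B B F A B E C G D) (Us B B B F B A E D G C) (Us B B B B E A F D C G) (Us C F E A B C
   D E F G)) (Us C F C B A D C E F G) (Hx B D G A C E))) (Us A C C B A C D E G F) (Sp C D G (Us C F F A B C D E F G)
   (Us C C F A B D F C G E) (Us B B B B E A F D C G) (Us C F E A B C D E F G))) (Us C F C D A E C G B F)))) (Us C G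
   D A B C D E F G) (Us C G G A B C D E F G))
(Sp B C E (Us A G E F A B D C G E) (Us A F B F D E A B G C) (Us C F G A F C D E B G) (Sp B C G (Hx B C G A D E) (Sp B
   D E (Us C G F D F A B C G E) (Us B B B F C A G B D E) (Sp C D E (Qd C D E A) (Qd C D E B) (Qd C D E A) (Sp B D F (Hx
   B D F A C E) (Sp A B E (Sp C E G (Us A B F A C D G E F B) (Us C C C A F C G B E D) (Sp C D G (Us A D F B G C F D A
   E) (Us A E F C B A E G D F) (Us A A A C D E G A B F) (Sp A E G (Xx C G D E A) (Xx C G D E A) (Hx A E G D C B) (Hx A
   E G D B C))) (Us B F A D C F G A B E)) (Qd A B E D) (Sp A E F (Us B F F A B C D E F G) (Hx A E F D B C) (Hx A E F
   D B C) (Sp C D G (Us C G F C B A D E F G) (Us C G F C A B D E F G) (Sp C E G (Us A B E E F D C A G B) (Us A E F C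
   B A D E G F) (Us A A A C D E G A B F) (Sp A E G (Qd A E G C) (Qd A E G C) (Hx A E G B F D) (Sp A B F (Us A F C B F
   C A E D G) (Sp A F G (Hx A F G B C E) (Hx A F G B C E) (Us C B G A B C D E F G) (Us A A A A E F G B C D)) (Hx A B
   F D C E) (Hx A B F D C E)))) (Sp A D G (Qd A D G C) (Qd A D G C) (Sp A E G (Sp C E G (Qd C E G A) (Sp D E G (Qd D E G
   C) (Us A F B A B D C E F G) (Qd D E G C) (Xx G D A E C)) (Xx C G D E A) (Qd C E G A)) (Us A F B B G D A E F C) (Hx
   A E G D F B) (Sp D E F (Hx D E F B A C) (Sp E F G (Us A A A E A F G B C D) (Us A B C C D B E A F G) (Us A B F G E
   C F A B D) (Us A B C A G C D E B F)) (Hx D E F A B C) (Us A F C C G D A E B F))) (Hx A D G E C B)))) (Qd A B E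
   D)) (Us C F C B A D C E G F) (Hx B D F A C E))) (Us C G G B A C D E F G)) (Us C F C B A C D E F G) (Hx B C G A D
   E)))
(Sp B C E (Qd B C E D) (Us A A A B C D E A F G) (Us A C C A B C D E F G) (Qd B C E D))
(Sp D E G (Hx G D E B C A) (Hx G D E B C A) (Us C E A A E B G F D C) (Sp D F G (Hx G D F B C A) (Hx G D F B C A) (Us B
   B B A G B E D F C) (Us C B B D B A G E F C)))
(Sp C F G (Hx G C F A D E) (Hx G C F A D E) (Us B B B B G A E C F D) (Us C B B C D B G F E A))
(Sp C E F (Hx C E F G D A) (Hx C E F G D A) (Us A D F A E C B D F G) (Us C G F C A D E F B G))"
  by code_simp

lemma blockDB: "block D B
(Sp C F G (Hx G C F A D E) (Hx G C F A D E) (Us B B B B G A E C F D) (Us D A G D A C E F B G))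
(Sp C F G (Hx C F G B A D) (Hx C F G B A D) (Us A A A C D F G A B E) (Us A E F C E A D F G B))
(Sp C E F (Hx F C E B A D) (Hx F C E B A D) (Us A E F C G A E D F B) (Us D B B A B C D E F G))
(Sp C E G (Hx G C E A F D) (Hx G C E A F D) (Us B B B B G A E C D F) (Us D A G D A C E F B G))
(Sp C F G (Hx C F G E D A) (Us A G F A C D G F E B) (Us A A A C D F G A B E) (Us D B D A B C D E F G))
(Sp D E F (Us A D F B E D G F A C) (Us A E F D B A C E F G) (Us A A A D C E F A B G) (Sp C E F (Qd C E F D) (Qd C E F
   D) (Us A A A C D E F A B G) (Sp D E G (Us D A B D C E F G B A) (Us D A B D C E F G A B) (Us D A G A B D E F G C)
   (Us A E F D G A C E F B))))
(Sp D E F (Us A D F B E D G F A C) (Hx D E F C G B) (Us A A A D C E F A B G) (Us A G G C G D A E B F))"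
  by code_simp

lemma blockDC: "block D C
(Sp B C G (Hx C G B E A D) (Us C G F C A B G D F E) (Us A A A C B E G A D F) (Hx C G B E A D))
(Sp D E G (Us D A G C B D E G A F) (Sp B D E (Hx D E B G A C) (Hx D E B G A C) (Us D A G C A D E G B F) (Us A E F D B
   C F E G A)) (Us A D F A E D B G C F) (Us A A A D E F G A B C))
(Sp D F G (Hx D F G E A C) (Hx D F G A C E) (Us C G F D A C F E B G) (Us D C B A B C D E F G))
(Sp A D F (Hx A D F B C E) (Sp C D E (Qd C D E A) (Qd C D E A) (Sp A D G (Hx A D G F C E) (Us D A A A G D C E B F) (Sp B
   D E (Xx D E B C A) (Us D A D A B C D E F G) (Sp B D F (Hx B D F A C E) (Sp C D F (Us C G F D B A C E G F) (Us C G F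
   D A B C E G F) (Us D B F A B C D E F G) (Sp C D G (Hx C D G B E F) (Hx C D G B E F) (Sp C E G (Us C G F C B A G D
   F E) (Sp B C E (Hx C E B G D A) (Hx C E B G D A) (Us C G G B A D C E G F) (Us D C A A B C D E F G)) (Us D A G A B
   C D E F G) (Sp B C E (Us D A F A B C D E F G) (Us D A B C B D E F A G) (Us C G G B A D C E G F) (Sp C E F (Us B B
   B B E D G C F A) (Us D B A A B C D E F G) (Us D A G A B C D F G E) (Us C B B C B A E F G D)))) (Sp C E F (Us C D
   F B F C A E D G) (Sp B C E (Hx C E B F D A) (Hx C E B F D A) (Us B C D A B C D E G F) (Us D B E A B C D E F G))
   (Us A E F C G A E D F B) (Us C C D B A C G D F E)))) (Us C F C B A D C E G F) (Hx B D F A C E)) (Sp B D G (Hx B D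
   G A C E) (Sp B C E (Qd B C E D) (Qd B C E D) (Sp B C F (Hx B C F A D E) (Sp C D F (Us A G F B F D C A G E) (Us B B B
   G B A E C F D) (Sp D E G (Us D B G A B C D E F G) (Us B F F D E B G C F A) (Us A G G B C D F E A G) (Us D B F A G
   C D E F B)) (Sp C D G (Hx C D G B E F) (Hx C D G B E F) (Sp C E F (Hx F C E B D A) (Hx F C E B A D) (Us D A G A B C
   D F G E) (Sp B C G (Hx B C G A D E) (Us D A B B G C D E A F) (Sp C E G (Us C G F C B A G D F E) (Us C E B A D F B
   E G C) (Us C C D B F C E G D A) (Us C B B C B A E F G D)) (Us D A E B A D C E F G))) (Us D B C A B C D E F G)))
   (Us C F C B A C D E G F) (Hx B C F A D E)) (Us C G G B A D C E F G)) (Us C F C B A D C E F G) (Hx B D G A C E)))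
   (Sp C D G (Qd C D G A) (Qd C D G A) (Sp B D E (Xx D E B C A) (Us D A D A B C D E F G) (Sp B D F (Hx B D F A C E) (Sp
   C D F (Us C G F D B A C E G F) (Us C G F D A B C E G F) (Sp C E F (Us B E D B G D E C A F) (Us B E D A G D E C B
   F) (Us A A A C D E F A B G) (Sp D E F (Qd D E F C) (Qd D E F C) (Us A A A D C E F A B G) (Sp D E G (Us D A B D C E
   F G B A) (Us D A B D C E F G A B) (Us A D F A C D B E F G) (Us A E F D G A C E F B)))) (Sp B C E (Sp C E G (Us C G
   F C B A G D F E) (Hx C E G B A D) (Hx C E G B D A) (Us D A F A B C D E F G)) (Us D A B C B D E F A G) (Us C G G B
   A D C E G F) (Sp B C G (Hx B C G D E A) (Sp C E G (Us D A G F B C G A D E) (Us C G F C A B G D F E) (Us D A G A B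
   C D E F G) (Sp C E F (Us B B B B E D G C F A) (Us D B A A B C D E F G) (Us D A G A B C D F G E) (Us C B B C B A E
   F G D))) (Us C F C B A C D E F G) (Hx B C G A D E)))) (Us C F C B A D C E G F) (Hx B D F A C E)) (Sp B D G (Hx B D
   G A C E) (Sp B C E (Qd B C E D) (Qd B C E D) (Sp B C F (Hx B C F D E A) (Sp C D F (Us B B B G A B E D F C) (Us B B B
   G B A E C F D) (Sp C E F (Us B C E G A F D C B E) (Us A D F A E C G F B D) (Us A A A C D E F A B G) (Sp D E G (Hx
   G D E B C A) (Hx G D E B C A) (Us A E F D F B G C E A) (Us B E D A B D E C G F))) (Us D A E A B C D E F G)) (Us C
   F C B A C D E G F) (Hx B C F A D E)) (Us C G G B A D C E F G)) (Us C F C B A D C E F G) (Hx B D G A C E))) (Sp B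
   D E (Xx D E B C A) (Us D A D A B C D E F G) (Sp B D F (Hx B D F A C E) (Sp C D F (Us C G F D B A C E G F) (Us C G F
   D A B C E G F) (Us D B F A B C D E F G) (Sp C E F (Us C D F B F C A E D G) (Sp B C E (Hx C E B F D A) (Hx C E B F
   D A) (Us B C D A B C D E G F) (Us D B E A B C D E F G)) (Us A E F C G A E D F B) (Us C C D B A C G D F E))) (Us C
   F C B A D C E G F) (Hx B D F A C E)) (Sp B D G (Hx B D G A C E) (Sp B C E (Qd B C E D) (Qd B C E D) (Sp B C F (Hx B
   C F D E A) (Sp C D F (Us D A G G B D C A E F) (Us B B B G B A E C F D) (Sp C E F (Us B C E G A F D C B E) (Us A D
   F A E C G F B D) (Us A A A C D E F A B G) (Sp D E F (Qd D E F C) (Qd D E F C) (Us A A A D C E F A B G) (Sp D F G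
   (Hx D F G A C E) (Hx D F G A C E) (Us A D F A C D B F E G) (Us A F C B G C D F A E)))) (Us D B C A B C D E F G))
   (Us C F C B A C D E G F) (Hx B C F A D E)) (Us C G G B A D C E F G)) (Us C F C B A D C E F G) (Hx B D G A C
   E))))) (Sp B C E (Xx C E B D A) (Us D A D A B D C E G F) (Sp B C F (Hx B C F A D E) (Sp B D E (Qd B D E C) (Qd B D E
   C) (Us C G G B A C D E G F) (Sp B D G (Hx B D G C E A) (Sp C D G (Us D C A B A C E G F D) (Us B B B F B A E D G C)
   (Sp C E F (Us D B G A B D C E G F) (Us B F F C E B F D G A) (Us A G G B D C G E A F) (Us D B F A F D C E G B)) (Sp
   C D F (Hx C D F B G E) (Hx C D F B G E) (Sp C E F (Sp C E G (Us C F A C F B E G D A) (Hx C E G D F B) (Hx C E G F B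
   D) (Us A G G D F C A E B G)) (Us D A G A G C B F D E) (Us D A G B A C D E G F) (Sp C F G (Hx C F G B A E) (Hx C F
   G B A E) (Us D C A A D C E G B F) (Us C B B C B A F E G D))) (Sp C E F (Hx F C E A D B) (Hx F C E B A D) (Sp D F G
   (Us A B F F D A G C B E) (Us A B C A E B D C G F) (Us A A A D C F G A B E) (Us A G F B D C G F A E)) (Us D B B A
   B C D E F G)))) (Us C F C B A D C E F G) (Hx B D G A C E))) (Us C F C B A C D E G F) (Hx B C F A D E)) (Sp B C G
   (Hx B C G A D E) (Sp C D G (Us C G F C B A D E F G) (Us C G F C A B D E F G) (Us D B F A B D C E G F) (Sp C D F (Hx
   C D F B G E) (Hx C D F B G E) (Sp D E F (Us C G F D B A F C G E) (Sp B D E (Hx D E B F A C) (Hx D E B F A C) (Us D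
   C A A F D C E G B) (Us C G G B A C D E F G)) (Us D A G A B D C E G F) (Us D C C A B C D E F G)) (Sp C F G (Us A G
   F B C D G F E A) (Us B B B E G A B C D F) (Us A A A C D F G A B E) (Sp C E F (Us C D F B F C A E D G) (Us D B D A
   B C D E F G) (Us D A G A B C F G E D) (Us A E F C E A D F G B))))) (Us C F C B A C D E F G) (Hx B C G A D E))))
   (Us C F C A B D C E G F) (Hx A D F B C E))
(Sp A D E (Us D A C A B C D E F G) (Sp C D E (Us A A A D A C E B F G) (Qd C D E A) (Qd C D E A) (Sp D E G (Us A G E B A
   D C E F G) (Us C F D A B C D E F G) (Us A F B B C G A D F E) (Sp A E G (Us C F G A F E C G D B) (Us A D F B E A F
   C G D) (Us C G F A B C E G F D) (Sp A E F (Hx A E F G C D) (Sp C E F (Us A A A F A C E B D G) (Qd C E F A) (Qd C E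
   F A) (Sp C F G (Us A G E B A F E C D G) (Us C F G A B C E G F D) (Sp C E G (Qd C E G A) (Qd C E G A) (Us B E D A B
   C G E F D) (Us B E D A B E G C D F)) (Us A F B B E G A F D C))) (Hx A E F D G C) (Us C F C A D E C G B F))))) (Us
   D C D A B C D E F G) (Us C G G A B C D E F G))
(Sp B D G (Hx B D G A C E) (Sp B D F (Hx D F B E A C) (Us D A B B A D C E F G) (Us D C E B A D C E F G) (Hx D F B E A
   C)) (Us C F C B A D C E F G) (Hx B D G A C E))
(Sp B D E (Hx D E B G A F) (Hx D E B G A F) (Us D A G A C D E G B F) (Us A E F D B A F E G C))"
  by code_simp

text \<open>Swaps are excluded here. If AB swaps C and D, then BCD has the colour of ACD, since
  otherwise the four-set is rainbow or falls under \<open>rule A A A\<close>. In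
  \<open>rule D D D\<close>, where moreover ACE has colour G, the pair AC can give G only the
  colours D or E: E is the double swap of \<open>rule C F C\<close>, and D is split by the colour of
  ACF into \<open>rule D A B\<close>, \<open>rule D C E\<close> and
  \<open>rule D D C\<close>.\<close>

lemma blockDD: "block D D
(Sp D E G (Us C G F D B E G A C F) (Us D C G A B C D E F G) (Us D C G A C B D E F G) (Us A A A D E F G A B C))
(Sp D F G (Us C B B D B C G A F E) (Hx D F G C E A) (Us C B D A B D C E G F) (Us D D A A B C D E F G))
(Sp A D E (Sp B C E (Us A G E F A B D C G E) (Us A F B F D E A B G C) (Us C F G A F C D E B G) (Sp B C G (Hx B C G A D
   E) (Sp B D E (Us C G F D F A B C G E) (Us B B B F C A G B D E) (Sp C D E (Qd C D E A) (Qd C D E B) (Qd C D E A) (Sp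
   C D G (Us D A G F B C D A E G) (Us C G F C A B D E F G) (Us D B F A B D C E G F) (Sp B D F (Hx B D F A C E) (Sp B
   C F (Us B F A F D G E B A C) (Us D A A B F C D E A G) (Us D C E B A C D E F G) (Sp C D F (Hx C D F B G E) (Hx C D
   F B G E) (Sp D E F (Hx D E F A B C) (Us C G F D A B F C G E) (Hx D E F A B C) (Us D C C B A C D E F G)) (Us D B F
   A B D C F G E))) (Us C F C B A D C E G F) (Hx B D F A C E)))) (Us C G G B A C D E F G)) (Us C F C B A C D E F G)
   (Hx B C G A D E))) (Sp C D E (Us A A A D A C E B F G) (Qd C D E A) (Qd C D E A) (Sp D E G (Us A G F B A D C E F G)
   (Us C F D A B C D E F G) (Us A F B B C G A D F E) (Sp D E F (Hx D E F A G C) (Hx D E F A G C) (Sp C D G (Us C G F C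
   B A D E F G) (Sp B C E (Us A F B F C E B A G D) (Sp B D E (Qd B D E C) (Us A A A B C D E A F G) (Qd B D E C) (Us D
   C E D A E C G B F)) (Us A C C B A C D E G F) (Us C C F A B D F C G E)) (Us B B B B E A F D C G) (Us C G G D A E
   C G B F)) (Us C F C D A E C G B F)))) (Sp A D F (Hx A D F B C E) (Sp A D G (Hx A D G F C E) (Us D B F F B G A D C
   E) (Us D C E A B D C E G F) (Sp C D F (Qd C D F A) (Qd C D F A) (Sp D E F (Us D D A C B G D A E F) (Sp B D E (Us B A
   B A B D C E G F) (Us A G G A B D C E G F) (Us D C A A F D C E G B) (Us D C F A B C D E F G)) (Us D B F A B F D C
   E G) (Us D D B A B C D E F G)) (Sp C D G (Us D D A F B E C A G D) (Qd C D G A) (Sp C E G (Us D D A D B F C A E G)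
   (Sp B C E (Us B A B A B C D E F G) (Us A G G A B C D E F G) (Us D C F A B D C E G F) (Us D D A D A F C B E G)) (Us
   D B F A B G C D E F) (Us D D B A B D C E G F)) (Sp B C F (Xx C F B D A) (Us D C B B E A C F D G) (Sp C F G (Us A D
   F B F C E G A D) (Sp B C E (Sp B C G (Hx C G B F A D) (Us B B B E G A B C D F) (Hx C G B F A D) (Hx B C G E A D))
   (Us B F F C D F G B E A) (Us C F C B A C D E G F) (Us D B D A E C D B F G)) (Us A A A C D F G A B E) (Sp C E G (Hx
   G C E A F D) (Hx G C E A F D) (Us B B B B G A E C D F) (Us D D A A B D C E G F))) (Us D B F A B D C F G E)))))
   (Us C F C A B D C E G F) (Hx A D F B C E)) (Us C G G A B C D E F G))
(Sp A C G (Hx A C G B D E) (Sp A C F (Hx A C F G D E) (Us D A B A B C D E F G) (Us D C E A B C D E F G) (Us D D C A B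
   C D E F G)) (Us C F C A B C D E F G) (Hx A C G B D E))
(Sp B C D (Us A A A B A C D E F G) (Sp A C E (Sp A D E (Us D D A E F G A C B D) (Us A D F F D A G C E B) (Us D D D A B
   D C E G F) (Us D D D A B D C E F G)) (Sp A D E (Us A D F F C A G D E B) (Us A A A A C D E B F G) (Us D D D A B D
   C E G F) (Us D D D A B D C E F G)) (Us D D D A B C D E G F) (Us D D D A B C D E F G)) (Qd B C D A) (Qd B C D A))
(Sp A C D (Us A A A A B C D E F G) (Us D D E A B C D E F G) (Us D D E A B C D F E G) (Us D D E A B C D G E F))
(Sp C D F (Us D D F C D A F B E G) (Qd C D F A) (Sp C F G (Us D D F C F A G B D E) (Xx A D C G F) (Us D D F F G C D A
   B E) (Us D C C A B D F C G E)) (Us D D F D F C G A B E))"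
  by code_simp

text \<open>The leaves \<open>Us D D F\<close> cut every branch on which some pair swaps two points.
  This keeps the remaining trees short.\<close>

lemma blockDE: "block D E
(Sp C D E (Us D D F D E A C B F G) (Hx C D E G A F) (Us D D F D E C F A B G) (Us D D F C D E G A B F))
(Sp C D G (Us D D F C G A D B E F) (Qd C D G A) (Us D E A A B C D E F G) (Us D D F C D F G A B E))
(Sp C D F (Us D D F C D A F B E G) (Us B F A G C B F A E D) (Us D D F D F C E A B G) (Us D E B A B C D E F G))
(Sp A D F (Us D D F A F B D C E G) (Us D D F A D C F B E G) (Sp A E F (Us D D F A E B F C D G) (Us D C C B G D A E F
   C) (Us D D F A F D E B C G) (Sp A E G (Hx A E G D B F) (Sp A C E (Hx E A C D B F) (Us D D F A E C D B F G) (Sp A C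
   F (Hx F A C B D E) (Us D D F A C D F B E G) (Us D D F A C E F B D G) (Sp A C G (Hx A C G D F B) (Sp A F G (Hx A F G
   B D E) (Us D D F A F C G B D E) (Sp A D G (Hx A D G E F C) (Us D D F A G C D B E F) (Sp D E F (Us D D F D F A E B
   C G) (Qd D E F A) (Us D E C A B C D E F G) (Sp D F G (Us D D F F G A D B C E) (Us D D B A C E F G D B) (Us D D G A
   B C D E F G) (Us D D F D F E G A B C))) (Us D D F A G D F B C E)) (Us D D F A F E G B C D)) (Hx A C G B D F) (Us
   D D F A C F G B D E))) (Us D D F A E C G B D F)) (Hx A E G D B F) (Us D D F A E F G B C D))) (Hx A D F E C B))
(Sp C D G (Us D D F C D A G B E F) (Us D D F C G B D A E F) (Us D D F C D E G A B F) (Sp C D F (Hx C D F G E B) (Hx C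
   D F B G E) (Sp D E G (Us D D F D G A E B C F) (Hx D E G A B C) (Us D D F D E C G A B F) (Us D C C A B C D G E F))
   (Us D D F C D F G A B E)))
(Sp C D F (Hx D F C G A B) (Hx D F C G A B) (Us D E A B A F D E G C) (Us D D F D F C G A B E))
(Sp C D E (Us D D F D E A C B F G) (Us D D F D E B C A F G) (Sp D E G (Us D D F D G A E B C F) (Us D D F D G B E A C
   F) (Us D D F D G C E A B F) (Sp D E F (Sp C E F (Us D E C D B A E F C G) (Us B F A A E B F D G C) (Us D D F C E D
   F A B G) (Sp C E G (Us D D G D B A E F C G) (Us D D G D A B E F C G) (Us D D F C G D E A B F) (Us D D F C E F G A
   B D))) (Sp C E F (Us B F A A E B F C G D) (Us D E C D A B E F C G) (Us D D F C E D F A B G) (Sp C E G (Us D D G D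
   B A E F C G) (Us D D G D A B E F C G) (Us D D F C G D E A B F) (Us D D F C E F G A B D))) (Us D D F D E C F A B
   G) (Us D D F D E F G A B C))) (Us D D F C D E G A B F))"
  by code_simp

lemma blockDF: "block D F
(Sp A C E (Qd A C E D) (Us D D F A E C D B F G) (Hx A C E D B G) (Us D D F A C E G B D F))
(Sp B D G (Hx B D G E C A) (Us D D F B D C G A E F) (Sp C D G (Us D D F C D A G B E F) (Us D D F C D B G A E F) (Us D
   E G A B C D E F G) (Sp C D E (Us D D F D E A C B F G) (Us D D F D E B C A F G) (Sp A C G (Qd A C G D) (Us D D F A
   C D G B E F) (Us D F A A B C D E F G) (Sp B C G (Qd B C G D) (Us D D F B C D G A E F) (Us D F A B A C D E F G) (Sp
   A C F (Hx A C F B G D) (Sp B C F (Hx B C F A G D) (Us D E G A B D C F E G) (Hx B C F A G D) (Us D D F B C F G A D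
   E)) (Hx A C F B G D) (Us D D F A C F G B D E)))) (Us D E G A B E D G F C))) (Hx B D G E A C))
(Sp B C D (Us D D F B C A D E F G) (Sp B D E (Us D D F B D A E C F G) (Us D D F B D C E A F G) (Sp B C E (Xx B E C D
   A) (Us D D F B C D E A F G) (Sp B C F (Hx B C F D E A) (Sp B D F (Us D D F B F A D C E G) (Us D D F B F C D A E G)
   (Us D D F B D E F A C G) (Sp B E F (Us D D F B E A F C D G) (Us D D F B E C F A D G) (Us D D F B E D F A C G) (Sp
   D E F (Xx B F A E D) (Us D D F D E B F A C G) (Xx B F A E D) (Sp B D G (Hx B D G C E F) (Hx B D G C E F) (Sp D E G
   (Us D D F D G A E B C F) (Us D D F D G B E A C F) (Us D D B B A F D G E C) (Us D D F D E F G A B C)) (Us D D F B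
   D F G A C E))))) (Us D D F B C E F A D G) (Hx B C F A D E)) (Sp B C G (Hx B C G A D E) (Sp C D E (Us D D F D E A C
   B F G) (Us D D F C D B E A F G) (Sp C D F (Hx C D F B A E) (Hx C D F B E A) (Us D D F C D E F A B G) (Sp C D G (Us
   D D F C D A G B E F) (Us D D F C G B D A E F) (Sp A C G (Us D C C A F B C D G E) (Us D D F A C D G B E F) (Sp A C
   E (Qd A C E B) (Us D D F A E C D B F G) (Hx A C E B G D) (Us D D F A C E G B D F)) (Us D E E B A D C G F E)) (Us D
   D F C D F G A B E))) (Us D E E A B C D E F G)) (Us D D F B C E G A D F) (Hx B C G A D E))) (Qd B D E A)) (Qd B C
   D A) (Sp B D E (Us D D F B D A E C F G) (Us D F B A B C D E F G) (Sp B D F (Us D D F B F A D C E G) (Hx B D F A E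
   C) (Us D D F B D E F A C G) (Sp B D G (Hx B D G A E F) (Us D D F B D C G A E F) (Sp D E G (Us D D F D G A E B C F)
   (Us D D F D G B E A C F) (Sp C D G (Us D D F C D A G B E F) (Us D D F C D B G A E F) (Us D D F D G C E A B F) (Us
   D E D D B C G E F A)) (Sp D F G (Us D E B B C F D E G A) (Us D D F D F B G A C E) (Sp A D F (Us D D F A F B D C E
   G) (Qd A D F B) (Us D E F A B C D E F G) (Us D E D D A F G E C B)) (Us D D F D G E F A B C))) (Us D D F B D F G A
   C E))) (Qd B D E A)))
(Sp A C D (Us D D F A C B D E F G) (Us D D F A D C E B F G) (Us D E D A B C D E F G) (Sp A D G (Hx A D G E B C) (Us D
   D F A D C G B E F) (Us D F C A B C D E F G) (Hx A D G E B C)))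
(Sp A C G (Hx G A C F B E) (Hx G A C F B E) (Us D D F A C E G B D F) (Us D D F A G C F B D E))
(Sp A C E (Hx E A C F B D) (Hx E A C F B D) (Us D D F A E C F B D G) (Sp A E G (Us D D F A G B E C D F) (Us D D F A E
   C G B D F) (Us D D F A E D G B C F) (Sp A F G (Sp A C F (Us D F D A E B F C G D) (Sp A D F (Us D D F A F B D C E
   G) (Us D D F A F C D B E G) (Us D F E A G E C B D F) (Hx F A D G C E)) (Us D D F A F C E B D G) (Hx F A C G E B))
   (Us D F E A B C D E F G) (Us D F E A B D C E F G) (Us D D F A G E F B C D))))
(Sp A E F (Us D D F A E B F C D G) (Us D F F A B C D E F G) (Sp A E G (Us D D F A G B E C D F) (Hx A E G F B D) (Us D
   D F A E D G B C F) (Sp A D G (Sp E F G (Us D D F E G A F B C D) (Sp D E F (Us D D F E F A D B C G) (Us D F D E A B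
   F D G C) (Sp A D F (Us D D F A F B D C E G) (Hx A D F B E G) (Us D D F A F D E B C G) (Sp B D E (Us D D F B D A E
   C F G) (Qd B D E A) (Us D E F G A C E B F D) (Sp B E F (Us D D F B E A F C D G) (Xx A D B F E) (Us D F B A B D E F
   C G) (Us D D F E F B G A C D)))) (Us D D B A C D E G F B)) (Us B F A D E C F A B G) (Us D E C A C D E F G B)) (Sp
   A F G (Hx G A F D E B) (Sp A C E (Hx E A C F B D) (Us D E A B F D A C E G) (Sp A C D (Us D D F A C B D E F G) (Sp A
   C F (Hx A C F B D E) (Us D E G B C E A D G F) (Us D D F A C E F B D G) (Hx A C F B D E)) (Us D E F C B G A F D E)
   (Us D D F A D C G B E F)) (Us D F D A E C G F D B)) (Hx G A F D B E) (Us D D F A G E F B C D)) (Us D D F A D E G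
   B C F) (Us D E A B C D A F E G))) (Us D F D A B G E F D C))"
  by code_simp

text \<open>At the pair AB, a path C, D, E, F of colours can continue only back to D: E would be a
  swap, and C or G a fourth colour. The cycle of D, E, F is then refuted with the help of the colour
  of ADE. A cycle of C, D, E leads back to such a path when the colour of ABF lies on it, and to
  four colours otherwise. Finally any single literal is a renaming of \<open>rule D G F\<close>,
  which refutes the empty list.\<close>

lemma blockDG: "block D G
(Sp A C F (Us D F E A C E G B D F) (Sp B E F (Us D D F B E A F C D G) (Us D F B A B E F D G C) (Us D D F B F D E A C
   G) (Qd B E F A)) (Us D D F A F C E B D G) (Hx F A C E B D))
(Sp A E F (Us D D F A E B F C D G) (Us D G A A B C D E F G) (Us D D F A F D E B C G) (Us D G A A B G D E F C))
(Sp A B G (Hx A B G F D E) (Us D F D A B G D E F C) (Us D F G A B C D E F G) (Sp B D F (Us D D F B F A D C E G) (Us D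
   F G B A G F D E C) (Sp A D F (Us D D F A F B D C E G) (Us D F F A B G F D E C) (Us D G B A B C D E F G) (Us D F D
   A B G F D E C)) (Us D F D B A G F D E C)))
(Sp A B F (Hx A B F C D E) (Sp A D E (Us D D F A D B E C F G) (Us D F D A B C D E F G) (Sp B D E (Us D D F B D A E C F
   G) (Us D F D B A C D E F G) (Us D G B A B C E F D G) (Us D G C B A C D E F G)) (Us D G C A B C D E F G)) (Us D D
   F A B E F C D G) (Hx A B F C D E))
(Sp A B E (Sp A B F (Us D G D A B F C D E G) (Us D G D A B F D E C G) (Us D G D A B F E C D G) (Hx A B F E C D)) (Us D
   D F A B D E C F G) (Us D G D A B C D E F G) (Us D G D A B C D E G F))
(Sp A B D (Us D D F A B C D E F G) (Us D G E A B C D E F G) (Us D G E A B C D F E G) (Us D G E A B C D G E F))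
(Sp A B C (Us D G F A B C D E F G) (Us D G F A B C E D F G) (Us D G F A B C F D E G) (Us D G F A B C G D E F))"
  by code_simp

section \<open>No admissible colouring of seven points\<close>

lemma block_ok:
  assumes "block x y a b c d e f g"
  shows "\<exists>t. ok rule x y z t (rule x y z)"
  using assms unfolding block_def by (cases z) auto

lemmas blocks =
  blockAA[THEN block_ok] blockAB[THEN block_ok] blockAC[THEN block_ok] blockAD[THEN block_ok] blockAE[THEN block_ok] blockAF[THEN block_ok] blockAG[THEN block_ok]
  blockBA[THEN block_ok] blockBB[THEN block_ok] blockBC[THEN block_ok] blockBD[THEN block_ok] blockBE[THEN block_ok] blockBF[THEN block_ok] blockBG[THEN block_ok]
  blockCA[THEN block_ok] blockCB[THEN block_ok] blockCC[THEN block_ok] blockCD[THEN block_ok] blockCE[THEN block_ok] blockCF[THEN block_ok] blockCG[THEN block_ok]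
  blockDA[THEN block_ok] blockDB[THEN block_ok] blockDC[THEN block_ok] blockDD[THEN block_ok] blockDE[THEN block_ok] blockDF[THEN block_ok] blockDG[THEN block_ok]

lemma ok_ex: "\<exists>t. ok rule x y z t (rule x y z)"
proof -
  \<comment> \<open>Both this list and the one named D G G are empty, so a single citation under the
    identity permutation suffices.\<close>
  have late: "ok rule x y z (Us D G G A B C D E F G) (rule x y z)" if "x \<in> {E, F, G}"
    using that by (auto simp: lex_def)
  show ?thesis
  proof (cases "x \<in> {E, F, G}")
    case True
    then show ?thesis using late by blast
  next
    case False
    then have "x = A \<or> x = B \<or> x = C \<or> x = D" by (cases x) auto
    then show ?thesis
      by (elim disjE; cases y; simp only: blocks)
  qed
qed

primrec rk :: "pt \<Rightarrow> nat" where
  "rk A = 0" | "rk B = 1" | "rk C = 2" | "rk D = 3" | "rk E = 4" | "rk F = 5" | "rk G = 6"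

lemma lt_rk: "lt x y \<Longrightarrow> rk x < rk y"
  by (cases x; cases y; simp)

lemma rk_less: "rk x < 7"
  by (cases x) simp_all

lemma lex_rk: "lex x y z x' y' z' \<Longrightarrow> 49 * rk x + 7 * rk y + rk z < 49 * rk x' + 7 * rk y' + rk z'"
  using rk_less[of x] rk_less[of y] rk_less[of z] lt_rk[of x x'] lt_rk[of y y'] lt_rk[of z z'] unfolding lex_def by auto

text \<open>Reading a name as a number in base seven turns the order of citations into a
  well-founded induction.\<close>

lemma nogood_rule: "nogood (rule x y z)"
proof (induction "49 * rk x + 7 * rk y + rk z" arbitrary: x y z rule: less_induct)
  case less
  obtain t where "ok rule x y z t (rule x y z)" using ok_ex by blast
  then show ?case using less lex_rk by (rule_tac ok_nogood) auto
qed

text \<open>The list named D G G is empty, so every colouring agrees with it, and its refutation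
  leaves no admissible colouring at all.\<close>

lemma not_admissible: "\<not> admissible (d :: pt \<Rightarrow> pt \<Rightarrow> pt \<Rightarrow> pt)"
  using nogood_rule[of D G G] unfolding nogood_def by simp

section \<open>From rich colourings to seven points, and the small cases\<close>

text \<open>Seven vertices that contain a name for the colour of each of their triples, outside that
  triple, carry an admissible colouring once they are identified with the points. Injectivity of
  \<open>h\<close> ensures that equal names mean equal colours, so the exclusions pass from
  \<open>c\<close> to the names.\<close>

lemma (in rich_colouring) closed_not_avoiding:
  fixes \<sigma> :: "pt \<Rightarrow> 'a" and h :: "'c \<Rightarrow> 'a"
  assumes bij: "bij_betw \<sigma> UNIV W" and W: "W \<subseteq> V"
    and closed: "\<And>x y z. \<lbrakk>{x, y, z} \<subseteq> W; distinct [x, y, z]\<rbrakk> \<Longrightarrow> h (c x y z) \<in> W - {x, y, z}"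
    and h: "inj h"
  shows False
proof -
  define \<tau> where "\<tau> = inv \<sigma>"
  have inj: "inj \<sigma>" and rng: "range \<sigma> = W" using bij unfolding bij_betw_def by auto
  have dis: "distinct (map \<sigma> xs) = distinct xs" for xs using inj by (simp add: distinct_map inj_on_def)
  have mem: "\<sigma> x \<in> V" "\<sigma> x \<in> W" for x using rng W by auto
  have \<tau>: "\<tau> u = \<tau> w \<longleftrightarrow> u = w" if "u \<in> W" "w \<in> W" for u w
    using that rng unfolding \<tau>_def by (metis f_inv_into_f)
  have \<sigma>\<tau>: "\<tau> u = x \<longleftrightarrow> u = \<sigma> x" if "u \<in> W" for u x
    using that rng inj unfolding \<tau>_def by (metis f_inv_into_f inv_f_f)
  define d where "d x y z = \<tau> (h (c (\<sigma> x) (\<sigma> y) (\<sigma> z)))" for x y z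
  have cl: "h (c (\<sigma> x) (\<sigma> y) (\<sigma> z)) \<in> W - {\<sigma> x, \<sigma> y, \<sigma> z}" if "distinct [x, y, z]" for x y z
    using closed[of "\<sigma> x" "\<sigma> y" "\<sigma> z"] that dis[of "[x, y, z]"] mem by simp
  have deq: "d x y z = d x' y' z' \<longleftrightarrow> c (\<sigma> x) (\<sigma> y) (\<sigma> z) = c (\<sigma> x') (\<sigma> y') (\<sigma> z')"
    if "distinct [x, y, z]" "distinct [x', y', z']" for x y z x' y' z'
    unfolding d_def using \<tau> cl[OF that(1)] cl[OF that(2)] inj_eq[OF h] by simp
  have "admissible d" unfolding admissible_def
  proof (intro conjI allI impI)
    fix x y z :: pt
    show "d x y z = d y x z" unfolding d_def by (simp only: sym1[of "\<sigma> x" "\<sigma> y" "\<sigma> z"])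
    show "d x y z = d x z y" unfolding d_def by (simp only: sym2[of "\<sigma> x" "\<sigma> y" "\<sigma> z"])
  next
    fix x y z :: pt assume "distinct [x, y, z]"
    from cl[OF this] \<sigma>\<tau> show "d x y z \<notin> {x, y, z}" unfolding d_def by auto
  next
    fix x y z w :: pt assume a: "distinct [x, y, z, w]"
    have "{\<sigma> x, \<sigma> y, \<sigma> z, \<sigma> w} \<subseteq> V" using mem by auto
    from no_rainbow_quad[OF this] a dis[of "[x, y, z, w]"]
    show "\<not> distinct [d x y z, d x y w, d x z w, d y z w]" by (auto simp: deq)
  next
    fix x y p q r s :: pt assume a: "distinct [x, y, p, q, r, s]"
    have "{\<sigma> x, \<sigma> y, \<sigma> p, \<sigma> q, \<sigma> r, \<sigma> s} \<subseteq> V" using mem by auto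
    from card_colours_le[OF this] a dis[of "[x, y, p, q, r, s]"]
    show "\<not> distinct [d x y p, d x y q, d x y r, d x y s]" by (auto simp: deq)
  next
    fix v p q r s :: pt assume a: "distinct [v, p, q, r, s]"
    have V': "{\<sigma> v, \<sigma> p, \<sigma> q, \<sigma> r, \<sigma> s} \<subseteq> V" using mem by auto
    have a': "distinct [\<sigma> v, \<sigma> p, \<sigma> q, \<sigma> r, \<sigma> s]" using a dis[of "[v, p, q, r, s]"] by simp
    from eight_count[OF V' a'] a
    show "\<not> (\<forall>i \<in> {d v p q}. \<forall>j \<in> {d v p r, d v p s}. \<forall>k \<in> {d v q r, d v r s}.
         \<forall>l \<in> {d v q s}. \<forall>m \<in> {d p r s, d q r s}. distinct [i, j, k, l, m])"
      by (simp add: deq)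
  qed
  with not_admissible show False by blast
qed

text \<open>With at most six vertices the set cannot be enlarged to seven points.\<close>

lemma (in rich_colouring) small_spanning:
  assumes V: "3 \<le> card V" "card V \<le> 6" and k: "1 \<le> k"
  shows "\<exists>i. \<forall>p \<in> V. \<exists>y z. {p, y, z} \<subseteq> V \<and> distinct [p, y, z] \<and> c p y z = i"
proof (rule ccontr)
  assume neg: "\<not> ?thesis"
  have ns: "\<exists>p \<in> V. \<forall>y z. y \<in> V \<longrightarrow> z \<in> V \<longrightarrow> distinct [p, y, z] \<longrightarrow> c p y z \<noteq> i" for i
    using neg by (metis empty_subsetI insert_subset)
  have Nne: "\<exists>w. w \<in> N x y z" if "x \<in> V" "y \<in> V" "z \<in> V" "x \<noteq> y" "x \<noteq> z" "y \<noteq> z" for x y z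
    using card_N[OF that] k by (metis card.empty ex_in_conv not_one_le_zero order_trans)
  obtain J where "J \<subseteq> V" "card J = 3" using V(1) by (meson obtain_subset_with_card_n)
  then obtain x y z where xyz: "x \<in> V" "y \<in> V" "z \<in> V" "x \<noteq> y" "x \<noteq> z" "y \<noteq> z" by (auto simp: card_3_iff)
  \<comment> \<open>The four points \<open>x\<close>, \<open>y\<close>, \<open>z\<close>,
    \<open>w\<close> form a monochromatic copy; the vertex \<open>p\<close> found next lies on no
    edge of its colour.\<close>
  obtain w where "w \<in> N x y z" using Nne xyz by blast
  then have w: "w \<in> V" "w \<noteq> x" "w \<noteq> y" "w \<noteq> z" "c x y w = c x y z" "c x z w = c x y z" "c y z w = c x y z"
    unfolding N_iff by auto
  obtain p where p: "p \<in> V" "\<And>u v. \<lbrakk>u \<in> V; v \<in> V; distinct [p, u, v]\<rbrakk> \<Longrightarrow> c p u v \<noteq> c x y z"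
    using ns[of "c x y z"] by blast
  have pn: "p \<noteq> x" "p \<noteq> y" "p \<noteq> z" "p \<noteq> w"
    using p(2)[of y z] p(2)[of x z] p(2)[of x y] p(2)[of x y] xyz w sym(1)[of y x z] sym(4)[of x y z] sym(4)[of x y w]
    by auto
  obtain u where "u \<in> N p x y" using Nne p(1) xyz pn by blast
  then have u: "u \<in> V" "u \<noteq> p" "u \<noteq> x" "u \<noteq> y" "c p x u = c p x y" "c x y u = c p x y" unfolding N_iff by auto
  \<comment> \<open>A second monochromatic copy \<open>p\<close>, \<open>x\<close>,
    \<open>y\<close>, \<open>u\<close> has another colour because it contains \<open>p\<close>. The
    triples \<open>x y z\<close> and \<open>x y w\<close> have the first colour, so \<open>u\<close>
    is a sixth vertex and no others remain.\<close>
  have un: "u \<noteq> z" "u \<noteq> w" using u(6) w(5) p(2)[of x y] xyz pn by auto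
  have "card {x, y, z, w, p, u} = 6" using xyz w pn u un by auto
  then have Veq: "V = {x, y, z, w, p, u}"
    using V(2) finite_V xyz w p u by (metis card_seteq empty_subsetI insert_subset)
  \<comment> \<open>A vertex that the second colour misses must lie outside the second copy, which
    leaves only \<open>z\<close> and \<open>w\<close>.\<close>
  obtain r where r: "r \<in> V" "\<And>s t. \<lbrakk>s \<in> V; t \<in> V; distinct [r, s, t]\<rbrakk> \<Longrightarrow> c r s t \<noteq> c p x y"
    using ns[of "c p x y"] by blast
  have "r \<noteq> p" using r(2)[of x y] xyz pn by auto
  moreover have "r \<noteq> x" using r(2)[of p y] p(1) xyz pn sym(1)[of p x y] by auto
  moreover have "r \<noteq> y" using r(2)[of p x] p(1) xyz pn sym(4)[of p x y] by auto
  moreover have "r \<noteq> u" using r(2)[of x y] u xyz sym(4)[of x y u] by auto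
  ultimately have rzw: "r = z \<or> r = w" using r(1) Veq by blast
  have rx: "r \<noteq> x" "r \<noteq> p" by fact+
  \<comment> \<open>The edge \<open>r x p\<close> contains a vertex missed by each of the two
    colours, so it has a third colour. Every vertex outside it completes a triple of the first
    colour with \<open>r x\<close> or one of the second with \<open>x p\<close>, hence no room is
    left for \<open>s\<close>.\<close>
  obtain s where "s \<in> N r x p" using Nne r(1) xyz(1) p(1) rx pn by metis
  then have s: "s \<in> V" "s \<noteq> r" "s \<noteq> x" "s \<noteq> p" "c r x s = c r x p" "c x p s = c r x p" unfolding N_iff by auto
  have nA: "c r x p \<noteq> c x y z" using p(2)[of r x] r(1) xyz(1) rx pn sym(4)[of r x p] by auto
  have nB: "c r x p \<noteq> c p x y" using r(2)[of x p] p(1) xyz(1) rx pn by auto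
  have "s \<noteq> u" using s(6) nB u(5) sym(1)[of x p u] by auto
  moreover have "s \<noteq> y"
    using s(5) nA rzw w(5) sym(4)[of x y z] sym(4)[of x y w] sym(2)[of z x y] sym(2)[of w x y] by metis
  moreover have "s \<noteq> z" "s \<noteq> w"
    using s(2,5) nA rzw w(6) sym(3)[of z x w] sym(3)[of w x z] sym(2)[of x z w] sym(1)[of x z w] sym by metis+
  ultimately show False using s(1,2,3,4) Veq by blast
qed

lemma nsets3: "{x, y, z} \<subseteq> V \<Longrightarrow> distinct [x, y, z] \<Longrightarrow> {x, y, z} \<in> [V]\<^bsup>3\<^esup>"
  by (simp add: nsets_def card_insert_if)

text \<open>A monochromatic copy containing an edge is that edge plus one vertex, and distinct
  copies give distinct vertices. Applying \<open>h\<close> to the colours preserves equalities, so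
  all these vertices survive any merging.\<close>

lemma rich_colouringI:
  fixes V :: "'a set" and \<chi> :: "'a set \<Rightarrow> nat" and h :: "nat \<Rightarrow> 'c"
  assumes fin: "finite V"
    and mono: "\<forall>e \<in> [V]\<^bsup>3\<^esup>. card {K \<in> mono_K4_copies V \<chi>. e \<subseteq> K} \<ge> card V div 4"
  shows "rich_colouring V (\<lambda>x y z. h (\<chi> {x, y, z})) (card V div 4)"
proof
  show "finite V" by fact
  show "h (\<chi> {x, y, z}) = h (\<chi> {y, x, z})" "h (\<chi> {x, y, z}) = h (\<chi> {x, z, y})" for x y z
    by (simp_all add: insert_commute)
  show "card V \<le> 4 * (card V div 4) + 3" by simp
next
  fix x y z assume V: "{x, y, z} \<subseteq> V" and d: "distinct [x, y, z]"
  let ?e = "{x, y, z}"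
  let ?M = "{w \<in> V. w \<notin> ?e \<and> h (\<chi> {x, y, w}) = h (\<chi> ?e) \<and> h (\<chi> {x, z, w}) = h (\<chi> ?e) \<and> h (\<chi> {y, z, w}) = h (\<chi> ?e)}"
  have "{K \<in> mono_K4_copies V \<chi>. ?e \<subseteq> K} \<subseteq> (\<lambda>w. insert w ?e) ` ?M"
  proof
    fix K assume K: "K \<in> {K \<in> mono_K4_copies V \<chi>. ?e \<subseteq> K}"
    then have eK: "?e \<subseteq> K" and "K \<in> mono_K4_copies V \<chi>" by simp_all
    from this(2) have K4: "K \<in> [V]\<^bsup>4\<^esup> \<and> (\<exists>c. \<forall>e \<in> [K]\<^bsup>3\<^esup>. \<chi> e = c)"
      unfolding mono_K4_copies_def by (rule CollectD)
    from K4[THEN conjunct2] obtain i where i: "\<forall>e \<in> [K]\<^bsup>3\<^esup>. \<chi> e = i" by (rule exE)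
    have KV: "K \<subseteq> V" "finite K" "card K = 4"
      using K4[THEN conjunct1, unfolded nsets_def, THEN CollectD] by simp_all
    have "card ?e = 3" using d by simp
    then have "card (K - ?e) = 1" using KV eK by (simp add: card_Diff_subset)
    then obtain w where w: "K - ?e = {w}" by (rule card_1_singletonE)
    have "w \<in> K - ?e" unfolding w by (rule singletonI)
    then have Kw: "w \<notin> ?e" "w \<in> V" "w \<in> K" using KV(1) by auto
    have "K = (K - ?e) \<union> ?e" using eK by blast
    then have Kins: "K = insert w ?e" unfolding w by auto
    have sub: "{x, y, w} \<subseteq> K" "{x, z, w} \<subseteq> K" "{y, z, w} \<subseteq> K" using Kw(3) eK by simp_all
    have dd: "distinct [x, y, w]" "distinct [x, z, w]" "distinct [y, z, w]" using d Kw(1) by auto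
    have ci: "\<chi> {x, y, w} = i" "\<chi> {x, z, w} = i" "\<chi> {y, z, w} = i" "\<chi> ?e = i"
      by (fact bspec[OF i nsets3[OF sub(1) dd(1)]] bspec[OF i nsets3[OF sub(2) dd(2)]]
          bspec[OF i nsets3[OF sub(3) dd(3)]] bspec[OF i nsets3[OF eK d]])+
    have "w \<in> ?M" using Kw ci by simp
    with Kins show "K \<in> (\<lambda>w. insert w ?e) ` ?M" by (rule image_eqI)
  qed
  then have "card {K \<in> mono_K4_copies V \<chi>. ?e \<subseteq> K} \<le> card ((\<lambda>w. insert w ?e) ` ?M)"
    using fin by (intro card_mono) auto
  also have "\<dots> \<le> card ?M" using fin by (intro card_image_le) auto
  finally show "card V div 4 \<le> card ?M" using bspec[OF mono nsets3[OF V d]] by linarith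
qed

section \<open>Naming colours by missed vertices\<close>

lemma card_pt: "card (UNIV :: pt set) = 7"
  by (simp add: UNIV_pt)

theorem theorem1p3:
  fixes V :: "'a set" and n :: nat and \<chi> :: "'a set \<Rightarrow> nat"
  assumes "finite V" and "card V = n" and "n \<ge> 3"
    and "\<forall>e \<in> [V]\<^bsup>3\<^esup>. card {Q \<in> mono_K4_copies V \<chi>. e \<subseteq> Q} \<ge> n div 4"
  shows "\<exists>i. spanning_colour V \<chi> i"
proof (rule ccontr)
  assume neg: "\<not> ?thesis"
  note fin = assms(1)
  have mono: "\<forall>e \<in> [V]\<^bsup>3\<^esup>. card {K \<in> mono_K4_copies V \<chi>. e \<subseteq> K} \<ge> card V div 4" using assms(2,4) by simp
  note rich = rich_colouringI[OF fin mono]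
  define misses where "misses i u \<longleftrightarrow> u \<in> V \<and> (\<forall>e \<in> [V]\<^bsup>3\<^esup>. u \<in> e \<longrightarrow> \<chi> e \<noteq> i)" for i u
  have miss: "\<exists>u. misses i u" for i
  proof -
    from neg have "\<not> spanning_colour V \<chi> i" by simp
    then have "\<exists>u\<in>V. \<not> (\<exists>e \<in> [V]\<^bsup>3\<^esup>. u \<in> e \<and> \<chi> e = i)" unfolding spanning_colour_def by simp
    then obtain u where "u \<in> V" "\<not> (\<exists>e \<in> [V]\<^bsup>3\<^esup>. u \<in> e \<and> \<chi> e = i)" by (elim bexE)
    then have "misses i u" unfolding misses_def by simp
    then show ?thesis by (rule exI)
  qed
  have missV: "u \<in> V" if "misses i u" for i u using that unfolding misses_def by simp
  have missE: "u \<notin> e" if "misses (\<chi> e) u" "e \<in> [V]\<^bsup>3\<^esup>" for u e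
    using bspec[OF conjunct2[OF that(1)[unfolded misses_def]] that(2)] by simp
  have missD: "u \<notin> {x, y, z}" if "misses (\<chi> {x, y, z}) u" "{x, y, z} \<subseteq> V" "distinct [x, y, z]" for u x y z
    using missE[OF that(1) nsets3[OF that(2,3)]] .
  have V3: "3 \<le> card V" using assms(2,3) by simp
  \<comment> \<open>A seven-point subset must exist later. With three vertices the only edge spans;
    with four, five or six vertices the lower bound \<open>k\<close> is one and
    \<open>small_spanning\<close> applies to the colouring as it stands.\<close>
  have big: "7 \<le> card V"
  proof (rule ccontr)
    assume "\<not> 7 \<le> card V"
    then have le: "card V \<le> 6" by simp
    show False
    proof (cases "card V = 3")
      case True
      then have VV: "V \<in> [V]\<^bsup>3\<^esup>" using fin by (simp add: nsets_def)
      obtain u where "misses (\<chi> V) u" using miss by (rule exE)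
      then show False using missE[OF _ VV] missV by simp
    next
      case False
      then have "1 \<le> card V div 4" using V3 by arith
      from rich_colouring.small_spanning[OF rich[of "\<lambda>i. i"] V3 le this]
      obtain i where i: "\<forall>p \<in> V. \<exists>y z. {p, y, z} \<subseteq> V \<and> distinct [p, y, z] \<and> \<chi> {p, y, z} = i" by (rule exE)
      obtain u where u: "misses i u" using miss by (rule exE)
      from bspec[OF i missV[OF u]] obtain y z where yz: "{u, y, z} \<subseteq> V" "distinct [u, y, z]" "\<chi> {u, y, z} = i"
        by (elim exE conjE)
      have "u \<notin> {u, y, z}" by (rule missD[OF _ yz(1,2)]) (simp only: yz(3) u)
      then show False by simp
    qed
  qed
  have "V \<noteq> {}" using big by auto
  then obtain v where v: "v \<in> V" by auto
  \<comment> \<open>The first naming, by arbitrary missed vertices. Colours with the same name are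
    merged, which the locale tolerates, and no name lies in an edge of its colour.\<close>
  define g where "g i = (SOME u. misses i u)" for i
  have g: "misses i (g i)" for i unfolding g_def by (rule someI_ex[OF miss])
  have gV: "g i \<in> V" for i by (rule missV[OF g])
  interpret g: rich_colouring V "\<lambda>x y z. g (\<chi> {x, y, z})" "card V div 4" by (rule rich)
  let ?star = "\<Union>x\<in>V - {v}. g.colours v x"
  have avoid: "g (\<chi> {x, y, z}) \<notin> {x, y, z}" if "{x, y, z} \<subseteq> V" "distinct [x, y, z]" for x y z
    by (rule missD[OF g that])
  have star6: "card ?star \<le> 6"
  proof (rule g.card_star_le[OF v V3])
    fix i
    \<comment> \<open>A name lies outside its edge, so neither \<open>v\<close> nor \<open>x\<close>
      occurs among the names at the pair \<open>v x\<close>. Hence a vertex other than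
      \<open>v\<close> is absent from its own set, and no name is common to all the sets.\<close>
    have out: "j \<notin> g.colours v x" if x: "x \<in> V" "x \<noteq> v" "j = v \<or> j = x" for j x
    proof
      assume "j \<in> g.colours v x"
      then obtain y where y: "y \<in> V - {v, x}" "j = g (\<chi> {v, x, y})" unfolding g.colours_def by (elim imageE)
      have "g (\<chi> {v, x, y}) \<notin> {v, x, y}" by (rule avoid) (use x v y(1) in auto)
      then show False using x(3) y(2) by auto
    qed
    have "\<not> V \<subseteq> {v}" using big card_mono[of "{v}" V] by auto
    then obtain x where x: "x \<in> V" "x \<noteq> v" by auto
    show "\<exists>x \<in> V - {v}. i \<notin> g.colours v x"
    proof (cases "i \<in> V \<and> i \<noteq> v")
      case True
      then show ?thesis using out[of i i] by (intro bexI[of _ i]) auto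
    next
      case False
      have "i \<notin> g.colours v x"
      proof (cases "i = v")
        case True
        then show ?thesis using out[of x i] x by simp
      next
        case False
        with \<open>\<not> (i \<in> V \<and> i \<noteq> v)\<close> have "i \<notin> V" by simp
        show ?thesis
        proof
          assume "i \<in> g.colours v x"
          then obtain y where "i = g (\<chi> {v, x, y})" unfolding g.colours_def by (elim imageE)
          with \<open>i \<notin> V\<close> gV show False by simp
        qed
      qed
      then show ?thesis using x by (intro bexI[of _ x]) auto
    qed
  qed
  have starV: "?star \<subseteq> V" by (auto simp: g.colours_def gV)
  \<comment> \<open>Six names at most, and \<open>v\<close> itself: this is the origin of the number
    seven.\<close>
  have c7: "card (insert v ?star) \<le> 7" by (rule card_insert_le_m1) (use star6 in simp_all)
  have "insert v ?star \<subseteq> V" using starV v by (rule insert_subsetI[rotated])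
  from exists_subset_between[OF c7 big this fin]
  obtain W where W: "insert v ?star \<subseteq> W" "W \<subseteq> V" "card W = 7" by (elim exE conjE)
  \<comment> \<open>A colour absent from the edges at \<open>v\<close> misses \<open>v\<close>; any
    other is the colour of an edge at \<open>v\<close>, and its first name then belongs to the
    star.\<close>
  have hit: "\<exists>u. u \<in> insert v ?star \<and> misses i u" for i
  proof (cases "misses i v")
    case True
    then show ?thesis by (intro exI[of _ v]) simp
  next
    case False
    then have "\<exists>e \<in> [V]\<^bsup>3\<^esup>. v \<in> e \<and> \<chi> e = i" using v unfolding misses_def by simp
    then obtain e where e: "e \<in> [V]\<^bsup>3\<^esup>" "v \<in> e" "\<chi> e = i" by (elim bexE conjE)
    have eV: "e \<subseteq> V" "finite e" "card e = 3" using e(1)[unfolded nsets_def, THEN CollectD] by simp_all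
    then have "card (e - {v}) = 2" using e(2) by simp
    then obtain x y where xy: "e - {v} = {x, y}" "x \<noteq> y" by (auto simp: card_2_iff)
    have "e = insert v (e - {v})" using e(2) by (simp add: insert_absorb)
    then have exy: "e = {v, x, y}" unfolding xy(1) .
    have "x \<in> e - {v}" "y \<in> e - {v}" unfolding xy(1) by simp_all
    then have mem: "x \<in> V - {v}" "y \<in> V - {v, x}" using eV(1) xy(2) by auto
    have "g i \<in> g.colours v x" unfolding g.colours_def using mem(2) by (rule image_eqI[rotated]) (simp add: exy[symmetric] e(3))
    then have "g i \<in> ?star" using mem(1) by (rule UN_I[rotated])
    then show ?thesis using g[of i] by (intro exI[of _ "g i"]) simp
  qed
  \<comment> \<open>The second naming selects the missed vertices inside the small set for all
    colours, including those that never occur at \<open>v\<close>. Triples of \<open>W\<close> are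
    thereby coloured by points of \<open>W\<close>.\<close>
  define h0 where "h0 i = (SOME u. u \<in> insert v ?star \<and> misses i u)" for i
  have h0: "h0 i \<in> insert v ?star \<and> misses i (h0 i)" for i unfolding h0_def by (rule someI_ex[OF hit])
  interpret h: rich_colouring V "\<lambda>x y z. h0 (\<chi> {x, y, z})" "card V div 4" by (rule rich)
  have fW: "finite W" by (rule finite_subset[OF W(2) fin])
  have fpt: "finite (UNIV :: pt set)" unfolding UNIV_pt by simp
  have "card (UNIV :: pt set) = card W" using W(3) card_pt by simp
  from finite_same_card_bij[OF fpt fW this] obtain \<sigma> :: "pt \<Rightarrow> 'a" where \<sigma>: "bij_betw \<sigma> UNIV W" by (rule exE)
  show False
  \<comment> \<open>After the second naming the colours are already vertices, so the identity serves
    as the injective naming map.\<close>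
  proof (rule h.closed_not_avoiding[OF \<sigma> W(2), of "\<lambda>x. x"])
    fix x y z assume xyz: "{x, y, z} \<subseteq> W" "distinct [x, y, z]"
    have "h0 (\<chi> {x, y, z}) \<in> W" by (rule subsetD[OF W(1) conjunct1[OF h0]])
    moreover have "h0 (\<chi> {x, y, z}) \<notin> {x, y, z}"
      by (rule missD[OF conjunct2[OF h0] subset_trans[OF xyz(1) W(2)] xyz(2)])
    ultimately show "h0 (\<chi> {x, y, z}) \<in> W - {x, y, z}" by (rule DiffI)
  qed simp
qed

end
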